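(* Let $0<a<b<\infty$ and assign to the edges of the $\mathbb{Z}^2$ nearest-neighbour lattice independent weights $(\omega_e)$, each uniformly distributed on $\{a,b\}$. Let $\alpha<1/22$ and $\beta\in(0,1)$ be fixed. Then for any sequence $(k_n)_{n\ge1}$ of positive integers with $k_n\le n^\alpha$, and for any choice of $\beta$-quantile $q_\beta=q_\beta(n)$ of $\tau(n,k_n)$, we have $$\lim_{n\to\infty}\mathbb{P}\big(\tau(n,k_n)<q_\beta\big)=1-\lim_{n\to\infty}\mathbb{P}\big(\tau(n,k_n)>q_\beta\big)=\beta,$$ and the sequence of functions $f_n:=\mathbbm{1}_{\{\tau(n,k_n)>q_\beta\}}$ is noise sensitive.
   Context: For a path $\Gamma$ (a finite sequence of edges), $T(\Gamma):=\sum_{e\in\Gamma}\omega_e$. For $k\ge1$, $\mathcal{P}_k(n)$ is the set of nearest-neighbour paths contained in $[0,n]\times[0,n-1]$ that connect the left side $\{0\}\times[0,n-1]$ to the right side $\{n\}\times[0,n-1]$ and are contained in $[0,n]\times[m,m+k-1]$ for some integer $m$; and $\tau(n,k):=\inf\{T(\Gamma):\Gamma\in\mathcal{P}_k(n)\}$. A $\beta$-quantile of a random variable $X$ is any $q$ with $\mathbb{P}(X<q)\le\beta\le\mathbb{P}(X\le q)$. Each $f_n$ depends only on the finitely many weights of edges in $[0,n]\times[0,n-1]$, so it is a function on $\{a,b\}^{E_n}$ ($E_n$ that finite edge set) equipped with the uniform product measure. Given $\omega$, let $\omega^\varepsilon$ be obtained by independently, for each edge, resampling $\omega_e$ (from the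 uniform distribution on $\{a,b\}$) with probability $\varepsilon$. A sequence $(f_n)$ of such $\{0,1\}$-valued functions is noise sensitive if for every $\varepsilon>0$, $\mathbb{E}[f_n(\omega)f_n(\omega^\varepsilon)]-\mathbb{E}[f_n(\omega)]^2\to0$ as $n\to\infty$. *)

theory Defs
  imports "HOL-Probability.Probability"
begin

type_synonym vertex = "int \<times> int"
type_synonym edge = "vertex set"
type_synonym config = "edge \<Rightarrow> real"

definition adjacent :: "vertex \<Rightarrow> vertex \<Rightarrow> bool" where
  "adjacent u v \<longleftrightarrow> \<bar>fst u - fst v\<bar> + \<bar>snd u - snd v\<bar> = 1"

definition in_box :: "nat \<Rightarrow> vertex \<Rightarrow> bool" where
  "in_box n v \<longleftrightarrow> 0 \<le> fst v \<and> fst v \<le> int n \<and> 0 \<le> snd v \<and> snd v \<le> int n - 1"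

definition edges_box :: "nat \<Rightarrow> edge set" where
  "edges_box n = {{u, v} | u v. adjacent u v \<and> in_box n u \<and> in_box n v}"

definition path_edges :: "vertex list \<Rightarrow> edge list" where
  "path_edges vs = map2 (\<lambda>u v. {u, v}) vs (tl vs)"

definition passage_time :: "config \<Rightarrow> vertex list \<Rightarrow> real" where
  "passage_time \<omega> vs = sum_list (map \<omega> (path_edges vs))"

definition paths_k :: "nat \<Rightarrow> nat \<Rightarrow> vertex list set" where
  "paths_k n k = {vs. vs \<noteq> [] \<and>
      (\<forall>i. Suc i < length vs \<longrightarrow> adjacent (vs ! i) (vs ! Suc i)) \<and>
      (\<forall>v\<in>set vs. in_box n v) \<and>
      fst (hd vs) = 0 \<and> fst (last vs) = int n \<and>
      (\<exists>m::int. \<forall>v\<in>set vs. m \<le> snd v \<and> snd v \<le> m + int k - 1)}"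

definition tau :: "nat \<Rightarrow> nat \<Rightarrow> config \<Rightarrow> real" where
  "tau n k \<omega> = Inf (passage_time \<omega> ` paths_k n k)"

definition weight_pmf :: "real \<Rightarrow> real \<Rightarrow> nat \<Rightarrow> config pmf" where
  "weight_pmf a b n = Pi_pmf (edges_box n) 0 (\<lambda>_. pmf_of_set {a, b})"

definition resample_pmf :: "real \<Rightarrow> real \<Rightarrow> nat \<Rightarrow> real \<Rightarrow> config \<Rightarrow> config pmf" where
  "resample_pmf a b n \<epsilon> \<omega> = Pi_pmf (edges_box n) 0
     (\<lambda>e. bind_pmf (bernoulli_pmf \<epsilon>)
            (\<lambda>r. if r then pmf_of_set {a, b} else return_pmf (\<omega> e)))"

definition noisy_pair_pmf :: "real \<Rightarrow> real \<Rightarrow> nat \<Rightarrow> real \<Rightarrow> (config \<times> config) pmf" where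
  "noisy_pair_pmf a b n \<epsilon> =
     bind_pmf (weight_pmf a b n) (\<lambda>\<omega>. map_pmf (\<lambda>\<eta>. (\<omega>, \<eta>)) (resample_pmf a b n \<epsilon> \<omega>))"

definition is_quantile :: "'x pmf \<Rightarrow> ('x \<Rightarrow> real) \<Rightarrow> real \<Rightarrow> real \<Rightarrow> bool" where
  "is_quantile p X \<beta> q \<longleftrightarrow>
     measure_pmf.prob p {x. X x < q} \<le> \<beta> \<and> \<beta> \<le> measure_pmf.prob p {x. X x \<le> q}"

definition noise_sensitive :: "real \<Rightarrow> real \<Rightarrow> (nat \<Rightarrow> config \<Rightarrow> real) \<Rightarrow> bool" where
  "noise_sensitive a b f \<longleftrightarrow>
     (\<forall>\<epsilon>>0. (\<lambda>n. measure_pmf.expectation (noisy_pair_pmf a b n \<epsilon>) (\<lambda>(\<omega>, \<eta>). f n \<omega> * f n \<eta>)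
              - (measure_pmf.expectation (weight_pmf a b n) (f n))\<^sup>2) \<longlonglongrightarrow> 0)"

end

theory Submission
  imports Defs "HOL-Probability.Hoeffding" "HOL-Real_Asymp.Real_Asymp"
begin

text \<open>
  \<open>\<tau>\<close> is the minimum over the strips \<open>[m, m + k - 1]\<close> of the crossing times \<open>T\<^sub>m\<close>. Disjoint
  strips are independent, so \<open>P(\<tau> < q) \<le> \<beta> < 1\<close> forces \<open>P(T\<^sub>m < q) = O(k / n)\<close>.

  No atom: the event \<open>T\<^sub>m < q\<close> is a down-set in the hypercube of edge weights of the strip, so its edge
  boundary is the expectation of \<open>#a - #b\<close> over it, at most \<open>s P(T\<^sub>m < q)\<close> up to a Chernoff error, with
  \<open>s = n\<^bsup>3/4\<^esup>\<close>. By the self-duality of bond percolation at \<open>1/2\<close> every crossing of the strip has at least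
  a constant times \<open>n / k\<close> edges of weight \<open>b\<close>, except with exponentially small probability, and
  lowering any such edge of a minimal path leads from \<open>T\<^sub>m = q\<close> into the down-set. Hence \<open>P(T\<^sub>m = q)\<close> is at most
  \<open>O(s k / n) P(T\<^sub>m < q)\<close>, and summing over \<open>m\<close> gives \<open>P(\<tau> = q) \<rightarrow> 0\<close>.

  Noise sensitivity: \<open>\<tau> > q\<close> means that none of many local rare events occurs. Making the noise
  independent block of rows after block of rows, each step changes \<open>E f f'\<close> by at most \<open>P(B)\<^bsup>1+\<delta>\<^esup>\<close> by
  hypercontractivity, where \<open>B\<close> is the union of the events touching the block; the \<open>P(B)\<close> have a bounded sum
  and tend to \<open>0\<close> uniformly.
\<close>

section \<open>Product measures\<close>

text \<open>A union bound over roughly \<open>n\<close> overlapping strips needs atoms of order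
  \<open>o(1/n)\<close>, whereas anticoncentration of a sum of about \<open>n\<close> independent
  weights only suggests order \<open>1/sqrt n\<close>. The way out is to compare the atom of
  \<open>T\<^sub>m\<close> at \<open>q\<close> with its lower tail below the same \<open>q\<close>:
  that tail is already \<open>O(k/n)\<close>, and the comparison gains a further small factor. The
  comparison needs many weights whose decrease pushes a configuration across the level. A fast path
  might consist almost entirely of edges of weight \<open>a\<close>, and planar duality is what
  excludes this for strips of every width. For the noise, the obstacle is that overlapping strips
  give dependent rare events. Grouping the strips by the block of \<open>k\<close> rows in which
  they begin leaves dependence only between neighbouring groups, so both the even and the odd groups
  are independent families, and changing the noise on one block of rows concerns two groups
  only.\<close>

abbreviation expect :: "'a pmf \<Rightarrow> ('a \<Rightarrow> real) \<Rightarrow> real" where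
  "expect p f \<equiv> measure_pmf.expectation p f"

abbreviation pr :: "'a pmf \<Rightarrow> 'a set \<Rightarrow> real" where
  "pr p A \<equiv> measure_pmf.prob p A"

definition depends_on :: "'e set \<Rightarrow> (('e \<Rightarrow> 'v) \<Rightarrow> 'r) \<Rightarrow> bool" where
  "depends_on S F \<longleftrightarrow> (\<forall>\<omega> \<eta>. (\<forall>e\<in>S. \<omega> e = \<eta> e) \<longrightarrow> F \<omega> = F \<eta>)"

lemma depends_onD: "depends_on S F \<Longrightarrow> (\<And>e. e \<in> S \<Longrightarrow> \<omega> e = \<eta> e) \<Longrightarrow> F \<omega> = F \<eta>"
  unfolding depends_on_def by blast

lemma depends_on_mono: "depends_on S F \<Longrightarrow> S \<subseteq> T \<Longrightarrow> depends_on T F"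
  unfolding depends_on_def by (meson subsetD)

lemma depends_on_comp: "depends_on S F \<Longrightarrow> depends_on S (\<lambda>\<omega>. h (F \<omega>))"
  unfolding depends_on_def by metis

lemma depends_on_indicator:
  "depends_on S (\<lambda>\<omega>. \<omega> \<in> A) \<Longrightarrow> depends_on S (indicator A :: _ \<Rightarrow> real)"
  by (auto simp: depends_on_def indicator_def)

lemma expectation_finite_support:
  assumes "finite (set_pmf p)"
  shows "expect p f = (\<Sum>x\<in>set_pmf p. pmf p x * f x)"
  by (subst integral_measure_pmf[OF assms]) (auto simp: set_pmf_eq)

lemma integrable_finite_support [simp]:
  "finite (set_pmf p) \<Longrightarrow> integrable (measure_pmf p) (f :: _ \<Rightarrow> real)"
  by (rule integrable_measure_pmf_finite)

lemma expectation_bind_pmf: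
  fixes h :: "'b \<Rightarrow> real"
  assumes "finite (set_pmf p)" "\<And>x. x \<in> set_pmf p \<Longrightarrow> finite (set_pmf (f x))"
  shows "expect (bind_pmf p f) h = expect p (\<lambda>x. expect (f x) h)"
  using pmf_expectation_bind[of "set_pmf p" f p h] assms
  by (simp add: expectation_finite_support)

lemma finite_set_Pi_pmf:
  assumes "finite E" "\<And>e. e \<in> E \<Longrightarrow> finite (set_pmf (p e))"
  shows "finite (set_pmf (Pi_pmf E d p))"
  using assms by (auto simp: set_Pi_pmf)

lemma expectation_cong_support:
  assumes "\<And>x. x \<in> set_pmf p \<Longrightarrow> f x = g x"
  shows "expect p f = expect p g"
  by (rule integral_cong_AE) (auto simp: AE_measure_pmf_iff assms)

lemma expectation_mono_support:
  assumes "finite (set_pmf p)" "\<And>x. x \<in> set_pmf p \<Longrightarrow> f x \<le> g x"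
  shows "expect p f \<le> expect p g"
  by (rule integral_mono_AE) (auto simp: AE_measure_pmf_iff assms)

lemma prob_eq_expectation: "pr p A = expect p (indicator A)"
  by simp

lemma expectation_Pi_pmf_split:
  fixes F G :: "('e \<Rightarrow> 'v) \<Rightarrow> real"
  assumes "finite E" "S \<subseteq> E" "\<And>e. e \<in> E \<Longrightarrow> finite (set_pmf (p e))"
    and F: "depends_on S F" and G: "depends_on (- S) G"
  shows "expect (Pi_pmf E d p) (\<lambda>\<omega>. F \<omega> * G \<omega>) =
    expect (Pi_pmf S d p) F * expect (Pi_pmf (E - S) d p) G"
proof -
  let ?mix = "\<lambda>f g x. if x \<in> S then f x else g x"
  have fin: "finite S" "finite (E - S)"
    using assms finite_subset by auto
  have "Pi_pmf E d p = Pi_pmf (S \<union> (E - S)) d p"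
    using assms(2) by (simp add: Un_absorb1)
  also have "\<dots> = bind_pmf (Pi_pmf S d p) (\<lambda>f. map_pmf (?mix f) (Pi_pmf (E - S) d p))"
    using fin by (subst Pi_pmf_union) (auto simp: pair_pmf_def map_bind_pmf map_pmf_def
        bind_assoc_pmf bind_return_pmf)
  finally have eq: "Pi_pmf E d p = bind_pmf (Pi_pmf S d p) (\<lambda>f. map_pmf (?mix f) (Pi_pmf (E - S) d p))" .
  have "expect (Pi_pmf E d p) (\<lambda>\<omega>. F \<omega> * G \<omega>) =
     expect (Pi_pmf S d p) (\<lambda>f. expect (map_pmf (?mix f) (Pi_pmf (E - S) d p)) (\<lambda>\<omega>. F \<omega> * G \<omega>))"
    unfolding eq using fin assms(2,3)
    by (intro expectation_bind_pmf) (auto intro!: finite_set_Pi_pmf)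
  also have "\<dots> = expect (Pi_pmf S d p) (\<lambda>f. expect (Pi_pmf (E - S) d p) (\<lambda>g. F f * G g))"
  proof -
    have "F (?mix f g) = F f" "G (?mix f g) = G g" for f g
      by (rule depends_onD[OF F], simp) (rule depends_onD[OF G], simp)
    then show ?thesis by simp
  qed
  finally show ?thesis by simp
qed

lemma expectation_Pi_pmf_marginal:
  fixes F :: "('e \<Rightarrow> 'v) \<Rightarrow> real"
  assumes "finite E" "S \<subseteq> E" "\<And>e. e \<in> E \<Longrightarrow> finite (set_pmf (p e))" "depends_on S F"
  shows "expect (Pi_pmf E d p) F = expect (Pi_pmf S d p) F"
  using expectation_Pi_pmf_split[OF assms, where G = "\<lambda>_. 1" and d = d] by (simp add: depends_on_def)

lemma expectation_Pi_pmf_indep: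
  fixes F G :: "('e \<Rightarrow> 'v) \<Rightarrow> real"
  assumes "finite E" "S \<subseteq> E" "\<And>e. e \<in> E \<Longrightarrow> finite (set_pmf (p e))"
    and F: "depends_on S F" and G: "depends_on T G" and "S \<inter> T = {}"
  shows "expect (Pi_pmf E d p) (\<lambda>\<omega>. F \<omega> * G \<omega>) =
    expect (Pi_pmf E d p) F * expect (Pi_pmf E d p) G"
proof -
  have G': "depends_on (- S) G" by (rule depends_on_mono[OF G]) (use assms(6) in blast)
  have "expect (Pi_pmf E d p) G = expect (Pi_pmf (E - S) d p) G"
    using expectation_Pi_pmf_split[OF assms(1-3) _ G', where F = "\<lambda>_. 1" and d = d]
    by (simp add: depends_on_def)
  then show ?thesis
    using expectation_Pi_pmf_split[OF assms(1-4) G', where d = d]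
      expectation_Pi_pmf_marginal[OF assms(1-4), where d = d] by simp
qed

lemma expectation_Pi_pmf_prod_indep:
  fixes F :: "'i \<Rightarrow> ('e \<Rightarrow> 'v) \<Rightarrow> real"
  assumes "finite E" "\<And>e. e \<in> E \<Longrightarrow> finite (set_pmf (p e))" "finite I"
    and "\<And>i. i \<in> I \<Longrightarrow> S i \<subseteq> E" "\<And>i. i \<in> I \<Longrightarrow> depends_on (S i) (F i)"
    and "\<And>i j. i \<in> I \<Longrightarrow> j \<in> I \<Longrightarrow> i \<noteq> j \<Longrightarrow> S i \<inter> S j = {}"
  shows "expect (Pi_pmf E d p) (\<lambda>\<omega>. \<Prod>i\<in>I. F i \<omega>) = (\<Prod>i\<in>I. expect (Pi_pmf E d p) (F i))"
  using assms(3-6)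
proof (induction rule: finite_induct)
  case (insert i I)
  have "depends_on (\<Union>j\<in>I. S j) (\<lambda>\<omega>. \<Prod>j\<in>I. F j \<omega>)"
    unfolding depends_on_def
  proof (intro allI impI prod.cong refl)
    fix \<omega> \<eta> :: "'e \<Rightarrow> 'v" and j assume "\<forall>e\<in>(\<Union>j\<in>I. S j). \<omega> e = \<eta> e" "j \<in> I"
    then show "F j \<omega> = F j \<eta>"
      using insert.prems(2)[of j] by (intro depends_onD[of "S j" "F j"]) auto
  qed
  moreover have "S i \<inter> (\<Union>j\<in>I. S j) = {}"
    using insert.prems(3)[of i] insert.hyps by blast
  ultimately have "expect (Pi_pmf E d p) (\<lambda>\<omega>. F i \<omega> * (\<Prod>j\<in>I. F j \<omega>)) =
      expect (Pi_pmf E d p) (F i) * expect (Pi_pmf E d p) (\<lambda>\<omega>. \<Prod>j\<in>I. F j \<omega>)"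
    using insert.prems assms(1,2) by (intro expectation_Pi_pmf_indep[where S = "S i"]) auto
  then show ?case using insert by simp
qed simp

text \<open>By independence the probability that no \<open>U i\<close> occurs is
  \<open>\<Prod> (1 - P(U i))\<close>, at most \<open>exp (- \<Sum> P(U i))\<close>. In this way the
  quantile condition, which keeps the probability that no strip is fast away from 0, controls each
  single strip.\<close>

lemma sum_prob_le_ln_prob_none:
  fixes U :: "'i \<Rightarrow> ('e \<Rightarrow> 'v) set"
  assumes "finite E" "\<And>e. e \<in> E \<Longrightarrow> finite (set_pmf (p e))" "finite I"
    and "\<And>i. i \<in> I \<Longrightarrow> S i \<subseteq> E" "\<And>i. i \<in> I \<Longrightarrow> depends_on (S i) (\<lambda>\<omega>. \<omega> \<in> U i)"
    and "\<And>i j. i \<in> I \<Longrightarrow> j \<in> I \<Longrightarrow> i \<noteq> j \<Longrightarrow> S i \<inter> S j = {}"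
    and "0 < c" "c \<le> pr (Pi_pmf E d p) {\<omega>. \<forall>i\<in>I. \<omega> \<notin> U i}"
  shows "(\<Sum>i\<in>I. pr (Pi_pmf E d p) (U i)) \<le> - ln c"
proof -
  let ?P = "Pi_pmf E d p"
  have fin: "finite (set_pmf ?P)" using assms by (simp add: finite_set_Pi_pmf)
  have "c \<le> pr ?P {\<omega>. \<forall>i\<in>I. \<omega> \<notin> U i}" by fact
  also have "\<dots> = expect ?P (\<lambda>\<omega>. \<Prod>i\<in>I. 1 - indicator (U i) \<omega>)"
    unfolding prob_eq_expectation
    by (rule expectation_cong_support) (use assms(3) in \<open>auto simp: indicator_def prod_zero_iff\<close>)
  also have "\<dots> = (\<Prod>i\<in>I. expect ?P (\<lambda>\<omega>. 1 - indicator (U i) \<omega>))"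
    using assms(1-6) by (intro expectation_Pi_pmf_prod_indep[where S = S]
        depends_on_comp[where h = "\<lambda>x. 1 - x"])
      (auto intro!: depends_on_indicator)
  also have "\<dots> = (\<Prod>i\<in>I. 1 - pr ?P (U i))"
    using fin by simp
  also have "\<dots> \<le> (\<Prod>i\<in>I. exp (- pr ?P (U i)))"
    using exp_ge_add_one_self[of "- pr ?P (U i)" for i] by (intro prod_mono) auto
  also have "\<dots> = exp (- (\<Sum>i\<in>I. pr ?P (U i)))"
    using assms(3) by (simp add: exp_sum sum_negf[symmetric])
  finally have "ln c \<le> - (\<Sum>i\<in>I. pr ?P (U i))"
    using \<open>0 < c\<close> by (metis ln_exp ln_mono exp_gt_zero)
  then show ?thesis by simp
qed

section \<open>Invariance of i.i.d. weights under relabelling of coordinates\<close>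

lemma map_Pi_pmf_image:
  assumes "finite S" "inj_on h S"
  shows "map_pmf (\<lambda>\<omega> e. if e \<in> S then \<omega> (h e) else d) (Pi_pmf (h ` S) d (\<lambda>_. \<mu>)) = Pi_pmf S d (\<lambda>_. \<mu>)"
  using assms
proof (induction rule: finite_induct)
  case (insert x S)
  have ne: "h e \<noteq> h x" if "e \<in> S" for e
    using insert.prems insert.hyps that by (auto simp: inj_on_def)
  have nx: "h x \<notin> h ` S" using ne by (metis imageE)
  have "map_pmf (\<lambda>\<omega> e. if e \<in> insert x S then \<omega> (h e) else d) (Pi_pmf (h ` insert x S) d (\<lambda>_. \<mu>)) =
     bind_pmf \<mu> (\<lambda>y. bind_pmf (Pi_pmf (h ` S) d (\<lambda>_. \<mu>))
      (\<lambda>f. return_pmf (\<lambda>e. if e \<in> insert x S then (f(h x := y)) (h e) else d)))"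
    using nx insert.hyps by (simp add: Pi_pmf_insert' map_bind_pmf cong: if_cong)
  also have "\<dots> = bind_pmf \<mu> (\<lambda>y. bind_pmf (Pi_pmf (h ` S) d (\<lambda>_. \<mu>))
      (\<lambda>f. return_pmf ((\<lambda>e. if e \<in> S then f (h e) else d)(x := y))))"
    by (intro bind_pmf_cong refl arg_cong[where f = return_pmf] ext)
       (use ne insert.hyps in auto)
  also have "\<dots> = bind_pmf \<mu> (\<lambda>y. bind_pmf (map_pmf (\<lambda>f e. if e \<in> S then f (h e) else d) (Pi_pmf (h ` S) d (\<lambda>_. \<mu>)))
      (\<lambda>f. return_pmf (f(x := y))))"
    by (simp add: bind_map_pmf)
  also have "\<dots> = Pi_pmf (insert x S) d (\<lambda>_. \<mu>)"
    using insert by (simp add: Pi_pmf_insert')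
  finally show ?case .
qed simp

text \<open>Any \<open>h\<close> that embeds \<open>S\<close> into \<open>E\<close> preserves the
  law of what \<open>F\<close> reads. This covers lattice symmetries that do not map the box to
  itself: vertical shifts of a strip and the duality map of a block.\<close>

lemma expectation_Pi_pmf_reindex:
  fixes F :: "('e \<Rightarrow> 'v) \<Rightarrow> real"
  assumes "finite E" "S \<subseteq> E" "inj_on h S" "h ` S \<subseteq> E" "finite (set_pmf \<mu>)" "depends_on S F"
  shows "expect (Pi_pmf E d (\<lambda>_. \<mu>)) (\<lambda>\<omega>. F (\<omega> \<circ> h)) = expect (Pi_pmf E d (\<lambda>_. \<mu>)) F"
proof -
  have fin: "finite S" using assms finite_subset by auto
  have "expect (Pi_pmf E d (\<lambda>_. \<mu>)) (\<lambda>\<omega>. F (\<omega> \<circ> h)) = expect (Pi_pmf (h ` S) d (\<lambda>_. \<mu>)) (\<lambda>\<omega>. F (\<omega> \<circ> h))"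
    using assms by (intro expectation_Pi_pmf_marginal) (auto simp: depends_on_def)
  also have "\<dots> = expect (Pi_pmf (h ` S) d (\<lambda>_. \<mu>)) (\<lambda>\<omega>. F (\<lambda>e. if e \<in> S then \<omega> (h e) else d))"
    by (intro Bochner_Integration.integral_cong refl depends_onD[OF assms(6)]) auto
  also have "\<dots> = expect (map_pmf (\<lambda>\<omega> e. if e \<in> S then \<omega> (h e) else d) (Pi_pmf (h ` S) d (\<lambda>_. \<mu>))) F"
    by simp
  also have "\<dots> = expect (Pi_pmf S d (\<lambda>_. \<mu>)) F"
    by (simp only: map_Pi_pmf_image[OF fin assms(3)])
  also have "\<dots> = expect (Pi_pmf E d (\<lambda>_. \<mu>)) F"
    using assms by (intro expectation_Pi_pmf_marginal[symmetric]) auto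
  finally show ?thesis .
qed

lemma prob_Pi_pmf_reindex:
  fixes A :: "('e \<Rightarrow> 'v) set"
  assumes "finite E" "S \<subseteq> E" "inj_on h S" "h ` S \<subseteq> E" "finite (set_pmf \<mu>)" "depends_on S (\<lambda>\<omega>. \<omega> \<in> A)"
  shows "pr (Pi_pmf E d (\<lambda>_. \<mu>)) {\<omega>. \<omega> \<circ> h \<in> A} = pr (Pi_pmf E d (\<lambda>_. \<mu>)) A"
proof -
  have "depends_on S (indicator A :: _ \<Rightarrow> real)"
    using assms(6) by (auto simp: depends_on_def indicator_def)
  then have "expect (Pi_pmf E d (\<lambda>_. \<mu>)) (\<lambda>\<omega>. indicator A (\<omega> \<circ> h)) = expect (Pi_pmf E d (\<lambda>_. \<mu>)) (indicator A)"
    by (rule expectation_Pi_pmf_reindex[OF assms(1-5)])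
  moreover have "(\<lambda>\<omega>. indicator A (\<omega> \<circ> h) :: real) = indicator {\<omega>. \<omega> \<circ> h \<in> A}"
    by (auto simp: indicator_def)
  ultimately show ?thesis by simp
qed

section \<open>Hypercontractivity and noise\<close>

lemma Bernoulli_powr:
  fixes w s :: real
  assumes "0 \<le> w" "1 \<le> s"
  shows "1 + s * w \<le> (1 + w) powr s"
proof -
  have "(\<lambda>w. (1 + w) powr s - s * w) 0 \<le> (\<lambda>w. (1 + w) powr s - s * w) w"
  proof (rule DERIV_nonneg_imp_nondecreasing[OF assms(1)])
    fix x :: real assume x: "0 \<le> x" "x \<le> w"
    have "((\<lambda>w. (1 + w) powr s - s * w) has_real_derivative s * ((1 + x) powr (s - 1) - 1)) (at x)"
      using x by (auto intro!: derivative_eq_intros simp: algebra_simps)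
    moreover have "1 \<le> (1 + x) powr (s - 1)"
      using x assms by (intro ge_one_powr_ge_zero) auto
    ultimately show "\<exists>y. ((\<lambda>w. (1 + w) powr s - s * w) has_real_derivative y) (at x) \<and> 0 \<le> y"
      using assms by (intro exI conjI) (assumption, simp)
  qed
  then show ?thesis by simp
qed

text \<open>Write the powers as exponentials and use \<open>exp x >= 1 + x\<close>. The linear terms
  add up to \<open>s * ln (1 - u^2)\<close>, a product of two nonpositive numbers.\<close>

lemma symmetric_powr_ge_2:
  fixes u s :: real
  assumes "0 \<le> u" "u < 1" "s \<le> 0"
  shows "2 \<le> (1 + u) powr s + (1 - u) powr s"
proof -
  have "1 + s * ln (1 + u) \<le> (1 + u) powr s" "1 + s * ln (1 - u) \<le> (1 - u) powr s"
    using assms exp_ge_add_one_self[of "s * ln (1 + u)"] exp_ge_add_one_self[of "s * ln (1 - u)"]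
    by (auto simp: powr_def)
  moreover have "ln (1 + u) + ln (1 - u) \<le> 0"
  proof -
    have "ln (1 + u) + ln (1 - u) = ln ((1 + u) * (1 - u))"
      using assms by (subst ln_mult) auto
    also have "\<dots> \<le> ln 1"
    proof -
      have "(1 + u) * (1 - u) = 1 - u\<^sup>2" by (simp add: power2_eq_square algebra_simps)
      moreover have "0 < (1 + u) * (1 - u)" using assms by simp
      ultimately show ?thesis by simp
    qed
    finally show ?thesis by simp
  qed
  then have "0 \<le> s * (ln (1 + u) + ln (1 - u))"
    using assms(3) by (rule mult_nonpos_nonpos[rotated])
  ultimately show ?thesis by (simp add: distrib_left)
qed

text \<open>Both sides and their first derivatives agree at \<open>u = 0\<close>. The second
  derivative of the difference is \<open>p (p - 1)\<close> times
  \<open>(1 + u) powr (p - 2) + (1 - u) powr (p - 2) - 2\<close>, nonnegative by the preceding lemma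
  as \<open>p - 2 <= 0\<close>. At \<open>u = 1\<close> differentiability may fail, so the last
  integration uses the open interval and continuity.\<close>

lemma symmetric_powr_lower_bound:
  fixes u p :: real
  assumes "0 \<le> u" "u \<le> 1" "1 \<le> p" "p \<le> 2"
  shows "2 + p * (p - 1) * u\<^sup>2 \<le> (1 + u) powr p + (1 - u) powr p"
proof -
  define g' where "g' = (\<lambda>u. p * ((1 + u) powr (p - 1) - (1 - u) powr (p - 1)) - 2 * p * (p - 1) * u)"
  have g'_nonneg: "0 \<le> g' x" if x: "0 \<le> x" "x < 1" for x
  proof -
    have "(\<lambda>u. (1 + u) powr (p - 1) - (1 - u) powr (p - 1) - 2 * (p - 1) * u) 0
        \<le> (\<lambda>u. (1 + u) powr (p - 1) - (1 - u) powr (p - 1) - 2 * (p - 1) * u) x"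
    proof (rule DERIV_nonneg_imp_nondecreasing[OF x(1)])
      fix t assume t: "0 \<le> t" "t \<le> x"
      have "((\<lambda>u. (1 + u) powr (p - 1) - (1 - u) powr (p - 1) - 2 * (p - 1) * u) has_real_derivative
         (p - 1) * ((1 + t) powr (p - 2) + (1 - t) powr (p - 2) - 2)) (at t)"
        using t x by (auto intro!: derivative_eq_intros simp: algebra_simps)
      moreover have "2 \<le> (1 + t) powr (p - 2) + (1 - t) powr (p - 2)"
        using t x assms by (intro symmetric_powr_ge_2) auto
      ultimately show "\<exists>y. ((\<lambda>u. (1 + u) powr (p - 1) - (1 - u) powr (p - 1) - 2 * (p - 1) * u) has_real_derivative y) (at t) \<and> 0 \<le> y"
        using assms by (intro exI conjI) (assumption, simp)
    qed
    then have "0 \<le> p * ((1 + x) powr (p - 1) - (1 - x) powr (p - 1) - 2 * (p - 1) * x)"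
      using assms by (intro mult_nonneg_nonneg) auto
    then show ?thesis by (simp add: g'_def algebra_simps)
  qed
  have "(\<lambda>u. (1 + u) powr p + (1 - u) powr p - p * (p - 1) * u\<^sup>2) 0
      \<le> (\<lambda>u. (1 + u) powr p + (1 - u) powr p - p * (p - 1) * u\<^sup>2) u"
  proof (rule DERIV_nonneg_imp_increasing_open[OF assms(1)])
    fix x assume x: "0 < x" "x < u"
    have "((\<lambda>u. (1 + u) powr p + (1 - u) powr p - p * (p - 1) * u\<^sup>2) has_real_derivative g' x) (at x)"
      using x assms by (auto intro!: derivative_eq_intros simp: g'_def algebra_simps)
    then show "\<exists>y. ((\<lambda>u. (1 + u) powr p + (1 - u) powr p - p * (p - 1) * u\<^sup>2) has_real_derivative y) (at x) \<and> 0 \<le> y"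
      using g'_nonneg[of x] x assms by auto
  next
    show "continuous_on {0..u} (\<lambda>u. (1 + u) powr p + (1 - u) powr p - p * (p - 1) * u\<^sup>2)"
      using assms by (intro continuous_intros continuous_on_powr') auto
  qed
  then show ?thesis by simp
qed

text \<open>Bonami's two-point inequality for a nonnegative function with values \<open>x\<close>,
  \<open>y\<close>: for \<open>\<rho> >= 0\<close> the left side is the squared 2-norm after its
  non-constant part is damped by \<open>sqrt \<rho>\<close>, the right side the squared
  \<open>p\<close>-norm. After scaling to mean 1 the values are \<open>1 + u\<close> and
  \<open>1 - u\<close>; Bernoulli's inequality with exponent \<open>2 / p\<close> then reduces the
  claim to \<open>symmetric_powr_lower_bound\<close>.\<close>

lemma two_point_norm_bound:
  fixes x y p \<rho> :: real
  assumes "0 \<le> x" "0 \<le> y" "1 \<le> p" "p \<le> 2" "\<rho> \<le> p - 1"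
  shows "((x + y) / 2)\<^sup>2 + \<rho> * ((x - y) / 2)\<^sup>2 \<le> (((x powr p + y powr p) / 2) powr (1 / p))\<^sup>2"
  using assms(1,2)
proof (induction x y rule: linorder_wlog)
  case (le y x)
  have swap: "((y + x) / 2)\<^sup>2 + \<rho> * ((y - x) / 2)\<^sup>2 = ((x + y) / 2)\<^sup>2 + \<rho> * ((x - y) / 2)\<^sup>2"
    "y powr p + x powr p = x powr p + y powr p"
    by (simp_all add: power_divide power2_commute add.commute)
  define c where "c = (x + y) / 2"
  have "((x + y) / 2)\<^sup>2 + \<rho> * ((x - y) / 2)\<^sup>2 \<le> (((x powr p + y powr p) / 2) powr (1 / p))\<^sup>2"
  proof (cases "c = 0")
    case True
    then have "x = 0" "y = 0" using le by (auto simp: c_def)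
    then show ?thesis by simp
  next
    case False
    then have c: "c > 0" using le by (auto simp: c_def)
    define u where "u = (x - y) / (x + y)"
    have u: "0 \<le> u" "u \<le> 1" using le c by (auto simp: u_def c_def divide_simps)
    have xy: "x = c * (1 + u)" "y = c * (1 - u)"
      using c by (auto simp: u_def c_def field_simps)
    define w where "w = p * (p - 1) * u\<^sup>2 / 2"
    have w: "0 \<le> w" using assms by (simp add: w_def)
    have "((x + y) / 2)\<^sup>2 + \<rho> * ((x - y) / 2)\<^sup>2 = c\<^sup>2 * (1 + \<rho> * u\<^sup>2)"
      unfolding xy by (simp add: field_simps power2_eq_square)
    also have "\<dots> \<le> c\<^sup>2 * (1 + 2 / p * w)"
      using assms by (intro mult_left_mono add_left_mono) (auto simp: w_def intro!: mult_right_mono)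
    also have "\<dots> \<le> c\<^sup>2 * (1 + w) powr (2 / p)"
      using assms w by (intro mult_left_mono Bernoulli_powr) auto
    also have "\<dots> \<le> c\<^sup>2 * (((1 + u) powr p + (1 - u) powr p) / 2) powr (2 / p)"
      using symmetric_powr_lower_bound[OF u assms(3,4)] w assms
      by (intro mult_left_mono powr_mono2) (auto simp: w_def)
    also have "\<dots> = (c powr p * (((1 + u) powr p + (1 - u) powr p) / 2)) powr (2 / p)"
      using c assms u by (subst powr_mult) (auto simp: powr_powr powr_numeral)
    also have "c powr p * (((1 + u) powr p + (1 - u) powr p) / 2) = (x powr p + y powr p) / 2"
      unfolding xy using c u powr_mult[of c "1 + u" p] powr_mult[of c "1 - u" p]
      by (simp only: powr_mult distrib_left add_divide_distrib times_divide_eq_right)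
    also have "((x powr p + y powr p) / 2) powr (2 / p) = (((x powr p + y powr p) / 2) powr (1 / p))\<^sup>2"
      by (simp add: power2_eq_square powr_add[symmetric])
    finally show ?thesis .
  qed
  then show ?case using swap by (simp only:)
next
  case (sym x y)
  then show ?case by (simp add: power_divide add.commute power2_commute)
qed

text \<open>The bilinear form of hypercontractivity, a statement about a correlated pair with law
  \<open>\<nu>\<close> rather than about an operator. In this form it passes to products by
  conditioning alone.\<close>

definition hypercontractive :: "real \<Rightarrow> ('a \<times> 'a) pmf \<Rightarrow> bool" where
  "hypercontractive p \<nu> \<longleftrightarrow> (\<forall>f g. (\<forall>x. 0 \<le> f x) \<longrightarrow> (\<forall>x. 0 \<le> g x) \<longrightarrow>
     expect \<nu> (\<lambda>z. f (fst z) * g (snd z)) \<le>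
       expect \<nu> (\<lambda>z. f (fst z) powr p) powr (1 / p) * expect \<nu> (\<lambda>z. g (snd z) powr p) powr (1 / p))"

lemma hypercontractiveD:
  assumes "hypercontractive p \<nu>" "\<And>x. 0 \<le> f x" "\<And>x. 0 \<le> g x"
  shows "expect \<nu> (\<lambda>z. f (fst z) * g (snd z)) \<le>
       expect \<nu> (\<lambda>z. f (fst z) powr p) powr (1 / p) * expect \<nu> (\<lambda>z. g (snd z) powr p) powr (1 / p)"
  using assms unfolding hypercontractive_def by blast

text \<open>Tensorization. With the pair at coordinate \<open>x\<close> frozen, the induction
  hypothesis bounds the inner expectation by a product of \<open>p\<close>-norms of sections,
  \<open>f\<close> and \<open>g\<close>. The inequality for \<open>\<nu> x\<close> then applies to
  \<open>f\<close> and \<open>g\<close>, and averaging their \<open>p\<close>-th powers over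
  \<open>x\<close> restores the full norms.\<close>

lemma hypercontractive_Pi_pmf:
  fixes F G :: "('e \<Rightarrow> 'v) \<Rightarrow> real"
  assumes "finite E" "\<And>e. e \<in> E \<Longrightarrow> finite (set_pmf (\<nu> e))" "\<And>e. e \<in> E \<Longrightarrow> hypercontractive p (\<nu> e)"
    and "0 < p" "\<And>\<omega>. 0 \<le> F \<omega>" "\<And>\<omega>. 0 \<le> G \<omega>"
  shows "expect (Pi_pmf E (d, d) \<nu>) (\<lambda>z. F (fst \<circ> z) * G (snd \<circ> z)) \<le>
     expect (Pi_pmf E (d, d) \<nu>) (\<lambda>z. F (fst \<circ> z) powr p) powr (1 / p) *
     expect (Pi_pmf E (d, d) \<nu>) (\<lambda>z. G (snd \<circ> z) powr p) powr (1 / p)"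
  using assms(1-3,5,6)
proof (induction arbitrary: F G rule: finite_induct)
  case empty
  then show ?case using assms(4) by (simp add: powr_powr o_def)
next
  case (insert x E)
  let ?Q = "Pi_pmf E (d, d) \<nu>"
  have finQ: "finite (set_pmf ?Q)" using insert by (intro finite_set_Pi_pmf) auto
  have eqPi: "Pi_pmf (insert x E) (d, d) \<nu> = bind_pmf (\<nu> x) (\<lambda>y. map_pmf (\<lambda>z. z(x := y)) ?Q)"
    using insert by (simp add: Pi_pmf_insert' map_pmf_def)
  have split: "expect (Pi_pmf (insert x E) (d, d) \<nu>) h = expect (\<nu> x) (\<lambda>y. expect ?Q (\<lambda>z. h (z(x := y))))" for h
    unfolding eqPi using insert finQ by (subst expectation_bind_pmf) auto
  have upd: "fst \<circ> z(x := y) = (fst \<circ> z)(x := fst y)" "snd \<circ> z(x := y) = (snd \<circ> z)(x := snd y)"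
    for z :: "'e \<Rightarrow> 'v \<times> 'v" and y by auto
  define f where "f = (\<lambda>u. expect ?Q (\<lambda>z. F ((fst \<circ> z)(x := u)) powr p) powr (1 / p))"
  define g where "g = (\<lambda>u. expect ?Q (\<lambda>z. G ((snd \<circ> z)(x := u)) powr p) powr (1 / p))"
  have fp: "f u powr p = expect ?Q (\<lambda>z. F ((fst \<circ> z)(x := u)) powr p)"
    and gp: "g u powr p = expect ?Q (\<lambda>z. G ((snd \<circ> z)(x := u)) powr p)" for u
    using assms(4) by (simp_all add: f_def g_def powr_powr)
  have "expect (Pi_pmf (insert x E) (d, d) \<nu>) (\<lambda>z. F (fst \<circ> z) * G (snd \<circ> z)) =
     expect (\<nu> x) (\<lambda>y. expect ?Q (\<lambda>z. F ((fst \<circ> z)(x := fst y)) * G ((snd \<circ> z)(x := snd y))))"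
    by (simp only: split upd)
  also have "\<dots> \<le> expect (\<nu> x) (\<lambda>y. f (fst y) * g (snd y))"
  proof (rule expectation_mono_support)
    fix y :: "'v \<times> 'v"
    define F' where "F' = (\<lambda>\<omega>. F (fun_upd \<omega> x (fst y)))"
    define G' where "G' = (\<lambda>\<omega>. G (fun_upd \<omega> x (snd y)))"
    show "expect ?Q (\<lambda>z. F ((fst \<circ> z)(x := fst y)) * G ((snd \<circ> z)(x := snd y))) \<le> f (fst y) * g (snd y)"
      using insert.IH[of F' G'] insert.prems by (simp add: F'_def G'_def f_def g_def o_def)
  qed (use insert.prems in auto)
  also have "\<dots> \<le> expect (\<nu> x) (\<lambda>y. f (fst y) powr p) powr (1 / p) * expect (\<nu> x) (\<lambda>y. g (snd y) powr p) powr (1 / p)"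
    using insert.prems by (intro hypercontractiveD) (auto simp: f_def g_def)
  also have "\<dots> = expect (Pi_pmf (insert x E) (d, d) \<nu>) (\<lambda>z. F (fst \<circ> z) powr p) powr (1 / p) *
     expect (Pi_pmf (insert x E) (d, d) \<nu>) (\<lambda>z. G (snd \<circ> z) powr p) powr (1 / p)"
    by (simp only: split upd fp gp)
  finally show ?case .
qed

section \<open>Noise on product spaces\<close>

definition noise_law :: "'a pmf \<Rightarrow> real \<Rightarrow> ('a \<times> 'a) pmf" where
  "noise_law \<mu> r = bind_pmf \<mu> (\<lambda>x. map_pmf (Pair x)
     (bind_pmf (bernoulli_pmf r) (\<lambda>c. if c then \<mu> else return_pmf x)))"

lemma finite_set_noise_law: "finite (set_pmf \<mu>) \<Longrightarrow> finite (set_pmf (noise_law \<mu> r))"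
  by (auto simp: noise_law_def if_distrib)

lemma map_fst_noise_law: "map_pmf fst (noise_law \<mu> r) = \<mu>"
  by (simp add: noise_law_def map_bind_pmf map_pmf_comp o_def bind_return_pmf')

lemma map_snd_noise_law: "map_pmf snd (noise_law \<mu> r) = \<mu>"
proof -
  have "map_pmf snd (noise_law \<mu> r) = bind_pmf \<mu> (\<lambda>x. bind_pmf (bernoulli_pmf r) (\<lambda>c. if c then \<mu> else return_pmf x))"
    by (simp add: noise_law_def map_bind_pmf map_pmf_comp o_def)
  also have "\<dots> = bind_pmf (bernoulli_pmf r) (\<lambda>c. bind_pmf \<mu> (\<lambda>x. if c then \<mu> else return_pmf x))"
    by (rule bind_commute_pmf)
  also have "\<dots> = bind_pmf (bernoulli_pmf r) (\<lambda>c. \<mu>)"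
  proof (intro bind_pmf_cong refl)
    show "bind_pmf \<mu> (\<lambda>x. if c then \<mu> else return_pmf x) = \<mu>" for c
      by (cases c) (simp_all add: bind_return_pmf')
  qed
  finally show ?thesis by simp
qed

text \<open>In terms of means \<open>x\<close>, \<open>y\<close> and half-differences
  \<open>x'\<close>, \<open>y'\<close> the correlation is \<open>x y + \<rho> x' y'\<close> with
  \<open>\<rho> = 1 - r\<close>. Cauchy-Schwarz with weights \<open>1\<close> and
  \<open>\<rho>\<close> separates the two functions, and each factor falls under the two-point bound
  because \<open>2 - p <= r\<close> says \<open>\<rho> <= p - 1\<close>.\<close>

lemma hypercontractive_noise_law:
  assumes "a \<noteq> b" "0 \<le> r" "r \<le> 1" "1 \<le> p" "p \<le> 2" "2 - p \<le> r"
  shows "hypercontractive p (noise_law (pmf_of_set {a, b}) r)"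
  unfolding hypercontractive_def
proof (intro allI impI)
  let ?\<mu> = "pmf_of_set {a, b}" and ?\<nu> = "noise_law (pmf_of_set {a, b}) r"
  fix f g :: "'a \<Rightarrow> real"
  assume nn: "\<forall>x. 0 \<le> f x" "\<forall>x. 0 \<le> g x"
  have E\<mu>: "expect ?\<mu> h = (h a + h b) / 2" for h
    using assms(1) by (simp add: integral_pmf_of_set)
  have E\<nu>: "expect ?\<nu> h = (\<lambda>x. r * ((h (x, a) + h (x, b)) / 2) + (1 - r) * h (x, x)) a / 2
      + (\<lambda>x. r * ((h (x, a) + h (x, b)) / 2) + (1 - r) * h (x, x)) b / 2" for h
    unfolding noise_law_def using assms(2,3)
    by (subst expectation_bind_pmf)
      (auto simp: expectation_bind_pmf E\<mu> add_divide_distrib if_distrib mult.commute split: if_splits)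
  have marg: "expect ?\<nu> (\<lambda>z. h (fst z)) = expect ?\<mu> h" "expect ?\<nu> (\<lambda>z. h (snd z)) = expect ?\<mu> h" for h
    using integral_map_pmf[of fst ?\<nu> h] integral_map_pmf[of snd ?\<nu> h]
    by (simp_all add: map_fst_noise_law map_snd_noise_law)
  define x where "x = (f a + f b) / 2"
  define x' where "x' = (f a - f b) / 2"
  define y where "y = (g a + g b) / 2"
  define y' where "y' = (g a - g b) / 2"
  define \<rho> where "\<rho> = 1 - r"
  define M where "M = ((f a powr p + f b powr p) / 2) powr (1 / p)"
  define M' where "M' = ((g a powr p + g b powr p) / 2) powr (1 / p)"
  have \<rho>: "0 \<le> \<rho>" "\<rho> \<le> p - 1" using assms by (auto simp: \<rho>_def)
  have "x\<^sup>2 + \<rho> * x'\<^sup>2 \<le> M\<^sup>2" "y\<^sup>2 + \<rho> * y'\<^sup>2 \<le> M'\<^sup>2"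
    unfolding x_def x'_def y_def y'_def M_def M'_def using nn assms \<rho>
    by (auto intro!: two_point_norm_bound)
  then have "(x\<^sup>2 + \<rho> * x'\<^sup>2) * (y\<^sup>2 + \<rho> * y'\<^sup>2) \<le> M\<^sup>2 * M'\<^sup>2"
    using \<rho> by (intro mult_mono) auto
  moreover have "(x * y + \<rho> * (x' * y'))\<^sup>2 \<le> (x\<^sup>2 + \<rho> * x'\<^sup>2) * (y\<^sup>2 + \<rho> * y'\<^sup>2)"
  proof -
    have "(x\<^sup>2 + \<rho> * x'\<^sup>2) * (y\<^sup>2 + \<rho> * y'\<^sup>2) - (x * y + \<rho> * (x' * y'))\<^sup>2 = \<rho> * (x * y' - x' * y)\<^sup>2"
      by algebra
    then show ?thesis using \<rho> by (smt (verit) mult_nonneg_nonneg zero_le_power2)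
  qed
  ultimately have "(x * y + \<rho> * (x' * y'))\<^sup>2 \<le> (M * M')\<^sup>2"
    by (simp add: power_mult_distrib)
  then have "x * y + \<rho> * (x' * y') \<le> M * M'"
    by (rule power2_le_imp_le) (simp add: M_def M'_def)
  moreover have "expect ?\<nu> (\<lambda>z. f (fst z) * g (snd z)) = x * y + \<rho> * (x' * y')"
    unfolding E\<nu> x_def x'_def y_def y'_def \<rho>_def by (simp add: field_simps)
  ultimately show "expect ?\<nu> (\<lambda>z. f (fst z) * g (snd z)) \<le>
       expect ?\<nu> (\<lambda>z. f (fst z) powr p) powr (1 / p) * expect ?\<nu> (\<lambda>z. g (snd z) powr p) powr (1 / p)"
    unfolding marg[of "\<lambda>x. f x powr p"] marg[of "\<lambda>x. g x powr p"] by (simp add: E\<mu> M_def M'_def)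
qed

lemma Pi_pmf_map_dep:
  assumes "finite E"
  shows "Pi_pmf E d (\<lambda>e. map_pmf (H e) (p e)) =
    map_pmf (\<lambda>z e. if e \<in> E then H e (z e) else d) (Pi_pmf E d' p)"
  using Pi_pmf_bind[OF assms, of d p "\<lambda>e x. return_pmf (H e x)" d'] assms
  by (simp add: map_pmf_def)

text \<open>The rate \<open>r\<close> varies with the edge so that noise can be turned into full
  resampling on one block of edges at a time.\<close>

definition noisy :: "'a pmf \<Rightarrow> ('e \<Rightarrow> real) \<Rightarrow> 'e set \<Rightarrow> 'a \<Rightarrow> ('e \<Rightarrow> 'a \<times> 'a) pmf" where
  "noisy \<mu> r E d = Pi_pmf E (d, d) (\<lambda>e. noise_law \<mu> (r e))"

lemma noisy_bind:
  assumes "finite E"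
  shows "noisy \<mu> r E d = bind_pmf (Pi_pmf E d (\<lambda>_. \<mu>)) (\<lambda>\<omega>.
     map_pmf (\<lambda>\<eta> e. if e \<in> E then (\<omega> e, \<eta> e) else (d, d))
       (Pi_pmf E d (\<lambda>e. bind_pmf (bernoulli_pmf (r e)) (\<lambda>c. if c then \<mu> else return_pmf (\<omega> e)))))"
  unfolding noisy_def noise_law_def
  by (subst Pi_pmf_bind[OF assms, where d' = d], subst Pi_pmf_map_dep[OF assms, where d' = d]) simp

lemma finite_set_noisy:
  "finite E \<Longrightarrow> finite (set_pmf \<mu>) \<Longrightarrow> finite (set_pmf (noisy \<mu> r E d))"
  unfolding noisy_def by (intro finite_set_Pi_pmf finite_set_noise_law) auto

lemma expectation_noisy:
  fixes F G :: "('e \<Rightarrow> 'a) \<Rightarrow> real"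
  assumes "finite E" "finite (set_pmf \<mu>)"
  shows "expect (noisy \<mu> r E d) (\<lambda>z. F (fst \<circ> z) * G (snd \<circ> z)) =
    expect (Pi_pmf E d (\<lambda>_. \<mu>)) (\<lambda>\<omega>. F \<omega> * expect
      (Pi_pmf E d (\<lambda>e. bind_pmf (bernoulli_pmf (r e)) (\<lambda>c. if c then \<mu> else return_pmf (\<omega> e)))) G)"
proof -
  let ?W = "Pi_pmf E d (\<lambda>_. \<mu>)"
  let ?K = "\<lambda>\<omega>. Pi_pmf E d (\<lambda>e. bind_pmf (bernoulli_pmf (r e)) (\<lambda>c. if c then \<mu> else return_pmf (\<omega> e)))"
  have fin: "finite (set_pmf ?W)" "finite (set_pmf (?K \<omega>))" for \<omega>
    using assms by (auto intro!: finite_set_Pi_pmf split: if_splits)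
  have "expect (noisy \<mu> r E d) (\<lambda>z. F (fst \<circ> z) * G (snd \<circ> z)) =
    expect ?W (\<lambda>\<omega>. expect (?K \<omega>) (\<lambda>\<eta>. F (fst \<circ> (\<lambda>e. if e \<in> E then (\<omega> e, \<eta> e) else (d, d))) *
       G (snd \<circ> (\<lambda>e. if e \<in> E then (\<omega> e, \<eta> e) else (d, d)))))"
    unfolding noisy_bind[OF assms(1)] using fin by (subst expectation_bind_pmf) auto
  also have "\<dots> = expect ?W (\<lambda>\<omega>. expect (?K \<omega>) (\<lambda>\<eta>. F \<omega> * G \<eta>))"
  proof (intro expectation_cong_support)
    fix \<omega> \<eta> assume w: "\<omega> \<in> set_pmf ?W" "\<eta> \<in> set_pmf (?K \<omega>)"
    \<comment> \<open>Off \<open>E\<close> both samples equal the default \<open>d\<close>, so the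
      two projections of the glued pair are exactly \<open>\<omega>\<close> and
      \<open>\<eta>\<close>.\<close>
    have "\<forall>e. e \<notin> E \<longrightarrow> \<omega> e = d" "\<forall>e. e \<notin> E \<longrightarrow> \<eta> e = d"
      using subsetD[OF set_Pi_pmf_subset[OF assms(1)] w(1)] subsetD[OF set_Pi_pmf_subset[OF assms(1)] w(2)]
      by simp_all
    then have "fst \<circ> (\<lambda>e. if e \<in> E then (\<omega> e, \<eta> e) else (d, d)) = \<omega>"
      "snd \<circ> (\<lambda>e. if e \<in> E then (\<omega> e, \<eta> e) else (d, d)) = \<eta>"
      by (auto simp: fun_eq_iff)
    then show "F (fst \<circ> (\<lambda>e. if e \<in> E then (\<omega> e, \<eta> e) else (d, d))) *
       G (snd \<circ> (\<lambda>e. if e \<in> E then (\<omega> e, \<eta> e) else (d, d))) = F \<omega> * G \<eta>"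
      by simp
  qed
  finally show ?thesis by simp
qed

lemma expectation_noisy_full:
  fixes F :: "('e \<Rightarrow> 'a) \<Rightarrow> real"
  assumes "finite E" "finite (set_pmf \<mu>)" "\<And>e. e \<in> E \<Longrightarrow> r e = 1"
  shows "expect (noisy \<mu> r E d) (\<lambda>z. F (fst \<circ> z) * F (snd \<circ> z)) = (expect (Pi_pmf E d (\<lambda>_. \<mu>)) F)\<^sup>2"
proof -
  have "bernoulli_pmf 1 = return_pmf True"
  proof (rule pmf_eqI)
    show "pmf (bernoulli_pmf 1) x = pmf (return_pmf True) x" for x by (cases x) auto
  qed
  then have "Pi_pmf E d (\<lambda>e. bind_pmf (bernoulli_pmf (r e)) (\<lambda>c. if c then \<mu> else return_pmf (\<omega> e))) =
      Pi_pmf E d (\<lambda>_. \<mu>)" for \<omega>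
    using assms(3) by (intro Pi_pmf_cong) (auto simp: bind_return_pmf)
  then show ?thesis
    using expectation_noisy[OF assms(1,2), of r d F F] by (simp add: power2_eq_square)
qed

lemma map_fst_noisy: "finite E \<Longrightarrow> map_pmf (\<lambda>z. fst \<circ> z) (noisy \<mu> r E d) = Pi_pmf E d (\<lambda>_. \<mu>)"
  using Pi_pmf_map[of E fst "(d, d)" d "\<lambda>e. noise_law \<mu> (r e)"]
  by (simp add: noisy_def map_fst_noise_law)

lemma map_snd_noisy: "finite E \<Longrightarrow> map_pmf (\<lambda>z. snd \<circ> z) (noisy \<mu> r E d) = Pi_pmf E d (\<lambda>_. \<mu>)"
  using Pi_pmf_map[of E snd "(d, d)" d "\<lambda>e. noise_law \<mu> (r e)"]
  by (simp add: noisy_def map_snd_noise_law)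

lemma expectation_fst_noisy:
  fixes F :: "('e \<Rightarrow> 'a) \<Rightarrow> real"
  shows "finite E \<Longrightarrow> expect (noisy \<mu> r E d) (\<lambda>z. F (fst \<circ> z)) = expect (Pi_pmf E d (\<lambda>_. \<mu>)) F"
  by (simp flip: map_fst_noisy[of E \<mu> r d])

lemma expectation_snd_noisy:
  fixes F :: "('e \<Rightarrow> 'a) \<Rightarrow> real"
  shows "finite E \<Longrightarrow> expect (noisy \<mu> r E d) (\<lambda>z. F (snd \<circ> z)) = expect (Pi_pmf E d (\<lambda>_. \<mu>)) F"
  by (simp flip: map_snd_noisy[of E \<mu> r d])

text \<open>If \<open>\<Phi>\<close> sees the pair at \<open>e\<close> only through
  \<open>H e\<close>, then only the image law under \<open>H e\<close> matters. This isolates what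
  an expectation knows of the rates.\<close>

lemma expectation_noisy_cong:
  assumes "finite E"
    and H: "\<And>e. e \<in> E \<Longrightarrow> map_pmf (H e) (noise_law \<mu> (r e)) = map_pmf (H e) (noise_law \<mu> (r' e))"
    and \<Phi>: "\<And>z. \<Phi> (\<lambda>e. if e \<in> E then H e (z e) else (d, d)) = \<Phi> (\<lambda>e. if e \<in> E then z e else (d, d))"
  shows "expect (noisy \<mu> r E d) \<Phi> = expect (noisy \<mu> r' E d) \<Phi>"
proof -
  have *: "expect (noisy \<mu> r E d) \<Phi> = expect (Pi_pmf E (d, d) (\<lambda>e. map_pmf (H e) (noise_law \<mu> (r e)))) \<Phi>" for r
  proof -
    have "expect (noisy \<mu> r E d) \<Phi> = expect (noisy \<mu> r E d) (\<lambda>z. \<Phi> (\<lambda>e. if e \<in> E then H e (z e) else (d, d)))"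
    proof (rule expectation_cong_support)
      fix z assume "z \<in> set_pmf (noisy \<mu> r E d)"
      then have "z = (\<lambda>e. if e \<in> E then z e else (d, d))"
        using set_Pi_pmf_subset[OF assms(1)] by (force simp: noisy_def)
      then show "\<Phi> z = \<Phi> (\<lambda>e. if e \<in> E then H e (z e) else (d, d))"
        using \<Phi>[of z] by simp
    qed
    then show ?thesis
      by (simp add: Pi_pmf_map_dep[OF assms(1), where d' = "(d, d)"] noisy_def)
  qed
  have "Pi_pmf E (d, d) (\<lambda>e. map_pmf (H e) (noise_law \<mu> (r e))) =
      Pi_pmf E (d, d) (\<lambda>e. map_pmf (H e) (noise_law \<mu> (r' e)))"
    using H by (intro Pi_pmf_cong) auto
  then show ?thesis using *[of r] *[of r'] by simp
qed

text \<open>When \<open>G\<close> ignores \<open>S\<close>, only the copy read by \<open>F\<close>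
  is seen on \<open>S\<close>, and its law is \<open>\<mu>\<close> whatever the rate. The maps
  \<open>?H1\<close> and \<open>?H2\<close> overwrite the unseen copy by \<open>d\<close>.\<close>

lemma expectation_noisy_resample:
  fixes F G :: "('e \<Rightarrow> 'a) \<Rightarrow> real"
  assumes "finite E" "\<And>e. e \<in> E \<Longrightarrow> e \<notin> S \<Longrightarrow> r e = r' e" and G: "depends_on (- S) G"
  shows "expect (noisy \<mu> r E d) (\<lambda>z. F (fst \<circ> z) * G (snd \<circ> z)) =
      expect (noisy \<mu> r' E d) (\<lambda>z. F (fst \<circ> z) * G (snd \<circ> z))"
    and "expect (noisy \<mu> r E d) (\<lambda>z. G (fst \<circ> z) * F (snd \<circ> z)) =
      expect (noisy \<mu> r' E d) (\<lambda>z. G (fst \<circ> z) * F (snd \<circ> z))"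
proof -
  let ?H1 = "\<lambda>e y. if e \<in> S then (fst y, d) else y"
  show "expect (noisy \<mu> r E d) (\<lambda>z. F (fst \<circ> z) * G (snd \<circ> z)) =
      expect (noisy \<mu> r' E d) (\<lambda>z. F (fst \<circ> z) * G (snd \<circ> z))"
  proof (rule expectation_noisy_cong[OF assms(1), where H = ?H1])
    fix e assume e: "e \<in> E"
    have "map_pmf (\<lambda>y. (fst y, d)) (noise_law \<mu> q) = map_pmf (\<lambda>x. (x, d)) \<mu>" for q
    proof -
      have "map_pmf (\<lambda>y. (fst y, d)) (noise_law \<mu> q) = map_pmf (\<lambda>x. (x, d)) (map_pmf fst (noise_law \<mu> q))"
        by (simp add: map_pmf_comp)
      then show ?thesis by (simp only: map_fst_noise_law)
    qed
    then show "map_pmf (?H1 e) (noise_law \<mu> (r e)) = map_pmf (?H1 e) (noise_law \<mu> (r' e))"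
      using assms(2)[OF e] by (cases "e \<in> S") auto
  next
    fix z :: "'e \<Rightarrow> 'a \<times> 'a"
    show "F (fst \<circ> (\<lambda>e. if e \<in> E then ?H1 e (z e) else (d, d))) * G (snd \<circ> (\<lambda>e. if e \<in> E then ?H1 e (z e) else (d, d))) =
      F (fst \<circ> (\<lambda>e. if e \<in> E then z e else (d, d))) * G (snd \<circ> (\<lambda>e. if e \<in> E then z e else (d, d)))"
      by (intro arg_cong2[where f = "(*)"] arg_cong[where f = F] depends_onD[OF G]) auto
  qed
  let ?H2 = "\<lambda>e y. if e \<in> S then (d, snd y) else y"
  show "expect (noisy \<mu> r E d) (\<lambda>z. G (fst \<circ> z) * F (snd \<circ> z)) =
      expect (noisy \<mu> r' E d) (\<lambda>z. G (fst \<circ> z) * F (snd \<circ> z))"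
  proof (rule expectation_noisy_cong[OF assms(1), where H = ?H2])
    fix e assume e: "e \<in> E"
    have "map_pmf (\<lambda>y. (d, snd y)) (noise_law \<mu> q) = map_pmf (\<lambda>x. (d, x)) \<mu>" for q
    proof -
      have "map_pmf (\<lambda>y. (d, snd y)) (noise_law \<mu> q) = map_pmf (\<lambda>x. (d, x)) (map_pmf snd (noise_law \<mu> q))"
        by (simp add: map_pmf_comp)
      then show ?thesis by (simp only: map_snd_noise_law)
    qed
    then show "map_pmf (?H2 e) (noise_law \<mu> (r e)) = map_pmf (?H2 e) (noise_law \<mu> (r' e))"
      using assms(2)[OF e] by (cases "e \<in> S") auto
  next
    fix z :: "'e \<Rightarrow> 'a \<times> 'a"
    show "G (fst \<circ> (\<lambda>e. if e \<in> E then ?H2 e (z e) else (d, d))) * F (snd \<circ> (\<lambda>e. if e \<in> E then ?H2 e (z e) else (d, d))) =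
      G (fst \<circ> (\<lambda>e. if e \<in> E then z e else (d, d))) * F (snd \<circ> (\<lambda>e. if e \<in> E then z e else (d, d)))"
      by (intro arg_cong2[where f = "(*)"] arg_cong[where f = F] depends_onD[OF G]) auto
  qed
qed

text \<open>Small-set expansion: a function below the indicator of \<open>B\<close> has noise
  correlation at most \<open>P(B)\<close> to the power \<open>2 / p\<close>. For
  \<open>p < 2\<close> this beats the trivial bound \<open>P(B)\<close> when \<open>B\<close> is
  rare.\<close>

lemma noisy_small_set_bound:
  fixes h :: "('e \<Rightarrow> 'a) \<Rightarrow> real"
  assumes "finite E" "a \<noteq> b" "1 \<le> p" "p \<le> 2" "\<And>e. e \<in> E \<Longrightarrow> 2 - p \<le> r e \<and> 0 \<le> r e \<and> r e \<le> 1"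
    and "\<And>\<omega>. 0 \<le> h \<omega>" "\<And>\<omega>. h \<omega> \<le> indicator B \<omega>"
  shows "expect (noisy (pmf_of_set {a, b}) r E d) (\<lambda>z. h (fst \<circ> z) * h (snd \<circ> z))
    \<le> pr (Pi_pmf E d (\<lambda>_. pmf_of_set {a, b})) B powr (2 / p)"
proof -
  let ?W = "Pi_pmf E d (\<lambda>_. pmf_of_set {a, b})" and ?N = "noisy (pmf_of_set {a, b}) r E d"
  have fin: "finite (set_pmf ?W)" using assms(1) by (intro finite_set_Pi_pmf) auto
  have "expect ?N (\<lambda>z. h (fst \<circ> z) * h (snd \<circ> z)) \<le>
      expect ?N (\<lambda>z. h (fst \<circ> z) powr p) powr (1 / p) * expect ?N (\<lambda>z. h (snd \<circ> z) powr p) powr (1 / p)"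
    unfolding noisy_def using assms
    by (intro hypercontractive_Pi_pmf finite_set_noise_law hypercontractive_noise_law) auto
  also have "\<dots> = expect ?W (\<lambda>\<omega>. h \<omega> powr p) powr (1 / p) * expect ?W (\<lambda>\<omega>. h \<omega> powr p) powr (1 / p)"
    using expectation_fst_noisy[OF assms(1), of "pmf_of_set {a, b}" r d "\<lambda>\<omega>. h \<omega> powr p"]
      expectation_snd_noisy[OF assms(1), of "pmf_of_set {a, b}" r d "\<lambda>\<omega>. h \<omega> powr p"] by simp
  also have "\<dots> = expect ?W (\<lambda>\<omega>. h \<omega> powr p) powr (2 / p)"
    by (simp add: powr_add[symmetric])
  also have "\<dots> \<le> expect ?W (indicator B) powr (2 / p)"
  proof (rule powr_mono2)
    have "h \<omega> powr p \<le> indicator B \<omega>" for \<omega>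
      using assms(6)[of \<omega>] assms(7)[of \<omega>] assms(3)
      by (auto simp: indicator_def powr_le_one_le split: if_splits intro: powr_le1)
    then show "expect ?W (\<lambda>\<omega>. h \<omega> powr p) \<le> expect ?W (indicator B)"
      using fin by (intro expectation_mono_support) auto
  qed (use assms in auto)
  finally show ?thesis by simp
qed

text \<open>
  One block of edges after the other is passed from noisy to independent resampling. Writing
  \<open>f = g - h\<close>, where \<open>g\<close> ignores the events touching the current block, the terms of
  \<open>f f'\<close> that involve \<open>g\<close> are not affected by the change, and \<open>h h'\<close> is small by
  hypercontractivity.
\<close>
lemma noise_covariance_bound:
  fixes U :: "nat \<Rightarrow> ('e \<Rightarrow> 'a) set" and blk :: "'e \<Rightarrow> nat" and N :: nat and a b d :: 'a and E :: "'e set"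
  defines "W \<equiv> Pi_pmf E d (\<lambda>_. pmf_of_set {a, b})"
  defines "f \<equiv> \<lambda>\<omega>. of_bool (\<forall>i<N. \<omega> \<notin> U i) :: real"
  assumes "finite E" "a \<noteq> b" "0 \<le> r0" "r0 \<le> 1"
    and dep: "\<And>i. i < N \<Longrightarrow> depends_on {e \<in> E. blk e = i \<or> blk e = Suc i} (\<lambda>\<omega>. \<omega> \<in> U i)"
    and blk: "\<And>e. e \<in> E \<Longrightarrow> blk e \<le> N"
  shows "\<bar>expect (noisy (pmf_of_set {a, b}) (\<lambda>_. r0) E d) (\<lambda>z. f (fst \<circ> z) * f (snd \<circ> z)) - (expect W f)\<^sup>2\<bar>
    \<le> (\<Sum>j\<le>N. pr W (\<Union>i\<in>{i. i < N \<and> (i = j \<or> Suc i = j)}. U i) powr (2 / (2 - r0)))"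
proof -
  \<comment> \<open>\<open>D j\<close> interpolates: blocks below \<open>j\<close> are fully
    resampled, the others carry noise \<open>r0\<close>. Thus \<open>D 0\<close> is the noisy
    correlation, and \<open>D (Suc N)\<close> the independent one because block indices reach
    \<open>N\<close>.\<close>
  define r where "r = (\<lambda>j e. if blk e < j then 1 else r0)"
  define D where "D = (\<lambda>j. expect (noisy (pmf_of_set {a, b}) (r j) E d) (\<lambda>z. f (fst \<circ> z) * f (snd \<circ> z)))"
  define B where "B = (\<lambda>j. \<Union>i\<in>{i. i < N \<and> (i = j \<or> Suc i = j)}. U i)"
  have finN: "finite (set_pmf (noisy (pmf_of_set {a, b}) q E d))" for q
    using assms(3) by (intro finite_set_noisy) auto
  have step: "\<bar>D j - D (Suc j)\<bar> \<le> pr W (B j) powr (2 / (2 - r0))" for j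
  proof -
    let ?N0 = "noisy (pmf_of_set {a, b}) (r j) E d" and ?N1 = "noisy (pmf_of_set {a, b}) (r (Suc j)) E d"
    define g where "g = (\<lambda>\<omega>. of_bool (\<forall>i<N. i \<noteq> j \<and> Suc i \<noteq> j \<longrightarrow> \<omega> \<notin> U i) :: real)"
    define h where "h = (\<lambda>\<omega>. g \<omega> - f \<omega>)"
    \<comment> \<open>By \<open>dep\<close> only \<open>U j\<close> and \<open>U (j - 1)\<close> can
      read block \<open>j\<close>. Dropping them from \<open>f\<close> changes its value only if one
      of them occurs, that is, on \<open>B j\<close>.\<close>
    have h: "0 \<le> h \<omega>" "h \<omega> \<le> indicator (B j) \<omega>" for \<omega>
      by (auto simp: h_def g_def f_def B_def indicator_def)
    have gdep: "depends_on (- {e. blk e = j}) g"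
      unfolding depends_on_def
    proof (intro allI impI)
      fix \<omega> \<eta> :: "'e \<Rightarrow> 'a" assume eq: "\<forall>e\<in>- {e. blk e = j}. \<omega> e = \<eta> e"
      have "\<omega> \<in> U i \<longleftrightarrow> \<eta> \<in> U i" if "i < N" "i \<noteq> j" "Suc i \<noteq> j" for i
        using that eq by (intro depends_onD[OF dep[of i]]) auto
      then show "g \<omega> = g \<eta>" by (auto simp: g_def)
    qed
    have expand: "f x * f y = f x * g y + g x * f y - g x * g y + h x * h y" for x y
      by (simp add: h_def algebra_simps)
    have eqr: "r j e = r (Suc j) e" if "e \<notin> {e. blk e = j}" for e
      using that by (auto simp: r_def)
    have e1: "expect ?N0 (\<lambda>z. f (fst \<circ> z) * g (snd \<circ> z)) = expect ?N1 (\<lambda>z. f (fst \<circ> z) * g (snd \<circ> z))"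
     and e2: "expect ?N0 (\<lambda>z. g (fst \<circ> z) * f (snd \<circ> z)) = expect ?N1 (\<lambda>z. g (fst \<circ> z) * f (snd \<circ> z))"
     and e3: "expect ?N0 (\<lambda>z. g (fst \<circ> z) * g (snd \<circ> z)) = expect ?N1 (\<lambda>z. g (fst \<circ> z) * g (snd \<circ> z))"
      using eqr assms(3) by (intro expectation_noisy_resample[OF _ _ gdep]; simp)+
    have "D j - D (Suc j) = expect ?N0 (\<lambda>z. h (fst \<circ> z) * h (snd \<circ> z)) - expect ?N1 (\<lambda>z. h (fst \<circ> z) * h (snd \<circ> z))"
      unfolding D_def expand using finN e1 e2 e3 by simp
    moreover have "expect ?N0 (\<lambda>z. h (fst \<circ> z) * h (snd \<circ> z)) \<le> pr W (B j) powr (2 / (2 - r0))"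
      "expect ?N1 (\<lambda>z. h (fst \<circ> z) * h (snd \<circ> z)) \<le> pr W (B j) powr (2 / (2 - r0))"
      unfolding W_def using assms h by (auto intro!: noisy_small_set_bound simp: r_def)
    \<comment> \<open>Both correlations of \<open>h\<close> lie between 0 and the same bound, so
      their difference obeys that bound without a factor 2.\<close>
    moreover have "0 \<le> expect ?N0 (\<lambda>z. h (fst \<circ> z) * h (snd \<circ> z))" "0 \<le> expect ?N1 (\<lambda>z. h (fst \<circ> z) * h (snd \<circ> z))"
      using h by (auto intro!: Bochner_Integration.integral_nonneg)
    ultimately show ?thesis by linarith
  qed
  have "\<bar>D 0 - D n\<bar> \<le> (\<Sum>j<n. pr W (B j) powr (2 / (2 - r0)))" for n
  proof (induction n)
    case (Suc n)
    then show ?case using step[of n] by simp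
  qed simp
  from this[of "Suc N"] have "\<bar>D 0 - D (Suc N)\<bar> \<le> (\<Sum>j\<le>N. pr W (B j) powr (2 / (2 - r0)))"
    by (simp only: lessThan_Suc_atMost)
  moreover have "D (Suc N) = (expect W f)\<^sup>2"
    unfolding D_def W_def using assms(3) blk
    by (intro expectation_noisy_full) (auto simp: r_def less_Suc_eq_le)
  moreover have "D 0 = expect (noisy (pmf_of_set {a, b}) (\<lambda>_. r0) E d) (\<lambda>z. f (fst \<circ> z) * f (snd \<circ> z))"
    by (simp add: D_def r_def)
  ultimately show ?thesis by (simp add: B_def)
qed

section \<open>Edge boundaries and tail bounds\<close>

lemma expectation_Pi_pmf_coordinate:
  fixes F :: "('e \<Rightarrow> 'v) \<Rightarrow> real" and a b d :: 'v
  assumes "finite E" "e \<in> E" "a \<noteq> b"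
  defines "W \<equiv> Pi_pmf E d (\<lambda>_. pmf_of_set {a, b})"
  shows "expect W F = (expect W (\<lambda>\<omega>. F (\<omega> (e := a))) + expect W (\<lambda>\<omega>. F (\<omega> (e := b)))) / 2"
proof -
  define A where "A = E - {e}"
  have A: "finite A" "e \<notin> A" "E = insert e A" using assms by (auto simp: A_def)
  let ?\<mu> = "pmf_of_set {a, b}" and ?Q = "Pi_pmf A d (\<lambda>_. pmf_of_set {a, b})"
  have finQ: "finite (set_pmf ?Q)" using A by (intro finite_set_Pi_pmf) auto
  have eqPi: "W = bind_pmf ?\<mu> (\<lambda>y. map_pmf (\<lambda>z. z(e := y)) ?Q)"
    using A by (simp add: W_def Pi_pmf_insert' map_pmf_def)
  have "expect W h = expect ?\<mu> (\<lambda>y. expect ?Q (\<lambda>z. h (z(e := y))))" for h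
    unfolding eqPi using finQ by (subst expectation_bind_pmf) auto
  then have "expect W h = (expect ?Q (\<lambda>z. h (z(e := a))) + expect ?Q (\<lambda>z. h (z(e := b)))) / 2" for h
    using assms(3) by (simp add: integral_pmf_of_set)
  from this[of F] this[of "\<lambda>\<omega>. F (\<omega> (e := a))"] this[of "\<lambda>\<omega>. F (\<omega> (e := b))"]
  show ?thesis by simp
qed

lemma expectation_Pi_pmf_single:
  fixes \<phi> :: "'v \<Rightarrow> real"
  assumes "finite E" "e \<in> E" "a \<noteq> b"
  shows "expect (Pi_pmf E d (\<lambda>_. pmf_of_set {a, b})) (\<lambda>\<omega>. \<phi> (\<omega> e)) = (\<phi> a + \<phi> b) / 2"
  using expectation_Pi_pmf_coordinate[OF assms, of d "\<lambda>\<omega>. \<phi> (\<omega> e)"] by simp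

definition spin :: "'v \<Rightarrow> 'v \<Rightarrow> real" where
  "spin a x = (if x = a then 1 else -1)"

text \<open>For a set decreasing in coordinate \<open>e\<close>, the first-order Fourier coefficient
  \<open>E[1_D spin_e]\<close> is half the probability that switching \<open>e\<close> changes
  membership in \<open>D\<close>. That is exactly the probability of being outside \<open>D\<close>
  with \<open>\<omega> e = b\<close> while lowering \<open>e\<close> leads into
  \<open>D\<close>.\<close>

lemma boundary_le_spin_sum:
  fixes D G :: "('e \<Rightarrow> 'v) set" and a b d :: 'v
  assumes "finite E" "S \<subseteq> E" "a \<noteq> b"
  defines "W \<equiv> Pi_pmf E d (\<lambda>_. pmf_of_set {a, b})"
  assumes mono: "\<And>\<omega> e. e \<in> S \<Longrightarrow> \<omega> (e := b) \<in> D \<Longrightarrow> \<omega> (e := a) \<in> D"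
    and G: "\<And>\<omega>. \<omega> \<in> G \<Longrightarrow> \<nu> \<le> real (card {e \<in> S. \<omega> e = b \<and> \<omega> \<notin> D \<and> \<omega> (e := a) \<in> D})"
  shows "\<nu> * pr W G \<le> expect W (\<lambda>\<omega>. indicator D \<omega> * (\<Sum>e\<in>S. spin a (\<omega> e)))"
proof -
  have finS: "finite S" using assms(1,2) finite_subset by auto
  have fin: "finite (set_pmf W)" unfolding W_def using assms(1) by (intro finite_set_Pi_pmf) auto
  let ?P = "\<lambda>e \<omega>. of_bool (\<omega> e = b \<and> \<omega> \<notin> D \<and> \<omega> (e := a) \<in> D) :: real"
  have "\<nu> * pr W G = expect W (\<lambda>\<omega>. \<nu> * indicator G \<omega>)"
    by simp
  also have "\<dots> \<le> expect W (\<lambda>\<omega>. \<Sum>e\<in>S. ?P e \<omega>)"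
  proof (rule expectation_mono_support[OF fin])
    fix \<omega>
    have "(\<Sum>e\<in>S. ?P e \<omega>) = real (card {e \<in> S. \<omega> e = b \<and> \<omega> \<notin> D \<and> \<omega> (e := a) \<in> D})"
      using finS by (simp add: sum_of_bool_eq Int_def)
    then show "\<nu> * indicator G \<omega> \<le> (\<Sum>e\<in>S. ?P e \<omega>)"
      using G[of \<omega>] by (auto simp: indicator_def)
  qed
  also have "\<dots> = (\<Sum>e\<in>S. expect W (?P e))"
    using fin by simp
  also have "\<dots> \<le> (\<Sum>e\<in>S. expect W (\<lambda>\<omega>. indicator D \<omega> * spin a (\<omega> e)))"
  proof (rule sum_mono)
    fix e assume e: "e \<in> S"
    then have eE: "e \<in> E" using assms(2) by auto
    note coord = expectation_Pi_pmf_coordinate[OF assms(1) eE assms(3), of d, folded W_def]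
    have "2 * expect W (?P e) = expect W (\<lambda>\<omega>. ?P e (\<omega> (e := b)))"
      using assms(3) by (subst coord) simp
    also have "\<dots> \<le> expect W (\<lambda>\<omega>. indicator D (\<omega> (e := a)) - indicator D (\<omega> (e := b)))"
      by (rule expectation_mono_support[OF fin]) (use mono[OF e] in \<open>auto simp: indicator_def\<close>)
    also have "\<dots> = 2 * expect W (\<lambda>\<omega>. indicator D \<omega> * spin a (\<omega> e))"
      using fin assms(3) by (subst (2) coord) (simp add: spin_def)
    finally show "expect W (?P e) \<le> expect W (\<lambda>\<omega>. indicator D \<omega> * spin a (\<omega> e))" by simp
  qed
  also have "\<dots> = expect W (\<lambda>\<omega>. indicator D \<omega> * (\<Sum>e\<in>S. spin a (\<omega> e)))"
    using fin by (simp add: sum_distrib_left)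
  finally show ?thesis .
qed

lemma cosh_le_exp_half_square: "0 \<le> (x::real) \<Longrightarrow> cosh x \<le> exp (x\<^sup>2 / 2)"
proof -
  assume "0 \<le> x"
  \<comment> \<open>This puts \<open>cosh x\<close> into the form
    \<open>exp (- h p) (1 + p (exp h - 1))\<close> of Hoeffding's lemma, with \<open>h = 2 x\<close>
    and \<open>p = 1/2\<close>.\<close>
  have *: "cosh x * exp x = 1 + (1/2) * (exp (2 * x) - 1)"
    by (simp add: cosh_field_def field_simps flip: exp_add)
  have "ln (cosh x) = - x + ln (cosh x * exp x)"
    by (simp add: ln_mult cosh_real_pos)
  also have "\<dots> \<le> x\<^sup>2 / 2"
    using Hoeffdings_lemma_aux[of "2 * x" "1/2"] \<open>0 \<le> x\<close> unfolding * by (simp add: power_mult_distrib)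
  finally have "exp (ln (cosh x)) \<le> exp (x\<^sup>2 / 2)" by (subst exp_le_cancel_iff)
  then show ?thesis by (subst (asm) exp_ln) (rule cosh_real_pos)
qed

lemma spin_sum_tail:
  assumes "finite E" "S \<subseteq> E" "a \<noteq> b" "S \<noteq> {}" "0 \<le> s"
  shows "pr (Pi_pmf E d (\<lambda>_. pmf_of_set {a, b})) {\<omega>. s < (\<Sum>e\<in>S. spin a (\<omega> e))} \<le> exp (- s\<^sup>2 / (2 * real (card S)))"
proof -
  let ?W = "Pi_pmf E d (\<lambda>_. pmf_of_set {a, b})"
  have finS: "finite S" using assms finite_subset by auto
  \<comment> \<open>The minimizer of the Chernoff exponent
    \<open>- l s + |S| l^2 / 2\<close>.\<close>
  define l where "l = s / card S"
  have g: "0 < real (card S)" using finS assms by (simp add: card_gt_0_iff)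
  have l: "0 \<le> l" using assms by (simp add: l_def)
  have fin: "finite (set_pmf ?W)" using assms(1) by (intro finite_set_Pi_pmf) auto
  have "pr ?W {\<omega>. s < (\<Sum>e\<in>S. spin a (\<omega> e))} \<le> expect ?W (\<lambda>\<omega>. exp (- l * s) * (\<Prod>e\<in>S. exp (l * spin a (\<omega> e))))"
    unfolding prob_eq_expectation
  proof (rule expectation_mono_support[OF fin])
    fix \<omega>
    have "(\<Prod>e\<in>S. exp (l * spin a (\<omega> e))) = exp (l * (\<Sum>e\<in>S. spin a (\<omega> e)))"
      using finS by (simp add: exp_sum sum_distrib_left)
    then have "exp (- l * s) * (\<Prod>e\<in>S. exp (l * spin a (\<omega> e))) = exp (l * ((\<Sum>e\<in>S. spin a (\<omega> e)) - s))"
      by (simp add: algebra_simps flip: exp_add)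
    moreover have "1 \<le> exp (l * ((\<Sum>e\<in>S. spin a (\<omega> e)) - s))" if "s < (\<Sum>e\<in>S. spin a (\<omega> e))"
      using that l by simp
    ultimately show "indicator {\<omega>. s < (\<Sum>e\<in>S. spin a (\<omega> e))} \<omega> \<le> exp (- l * s) * (\<Prod>e\<in>S. exp (l * spin a (\<omega> e)))"
      by (auto simp: indicator_def)
  qed
  also have "\<dots> = exp (- l * s) * (\<Prod>e\<in>S. expect ?W (\<lambda>\<omega>. exp (l * spin a (\<omega> e))))"
  proof -
    have "expect ?W (\<lambda>\<omega>. \<Prod>e\<in>S. exp (l * spin a (\<omega> e))) = (\<Prod>e\<in>S. expect ?W (\<lambda>\<omega>. exp (l * spin a (\<omega> e))))"
      by (rule expectation_Pi_pmf_prod_indep[where S = "\<lambda>e. {e}"])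
        (use assms(1,2) finS in \<open>auto simp: depends_on_def\<close>)
    then show ?thesis by simp
  qed
  also have "\<dots> = exp (- l * s) * cosh l ^ card S"
  proof -
    have "expect ?W (\<lambda>\<omega>. exp (l * spin a (\<omega> e))) = cosh l" if "e \<in> S" for e
      using assms that expectation_Pi_pmf_single[OF assms(1) _ assms(3), of e d "\<lambda>x. exp (l * spin a x)"]
      by (auto simp: spin_def cosh_field_def)
    then show ?thesis by simp
  qed
  also have "\<dots> \<le> exp (- l * s) * exp (l\<^sup>2 / 2) ^ card S"
    using l by (intro mult_left_mono power_mono cosh_le_exp_half_square cosh_real_nonneg) auto
  also have "\<dots> = exp (- l * s + card S * (l\<^sup>2 / 2))"
    by (subst exp_add, subst exp_of_nat_mult) (rule refl)
  also have "- l * s + card S * (l\<^sup>2 / 2) = - s\<^sup>2 / (2 * real (card S))"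
    using g by (simp add: l_def field_simps power2_eq_square)
  finally show ?thesis .
qed

text \<open>
  Counting the pairs of neighbouring configurations that lie inside a down-set \<open>D\<close> from above and from
  below shows that its edge boundary has size \<open>\<Sum>\<^sub>D (#a - #b)\<close>, which is small because the
  number of edges of weight \<open>a\<close> is concentrated.
\<close>
lemma boundary_prob_bound:
  fixes D G :: "('e \<Rightarrow> 'v) set" and a b d :: 'v
  assumes "finite E" "S \<subseteq> E" "a \<noteq> b" "S \<noteq> {}" "0 \<le> s"
  defines "W \<equiv> Pi_pmf E d (\<lambda>_. pmf_of_set {a, b})"
  assumes mono: "\<And>\<omega> e. e \<in> S \<Longrightarrow> \<omega> (e := b) \<in> D \<Longrightarrow> \<omega> (e := a) \<in> D"
    and G: "\<And>\<omega>. \<omega> \<in> G \<Longrightarrow> \<nu> \<le> real (card {e \<in> S. \<omega> e = b \<and> \<omega> \<notin> D \<and> \<omega> (e := a) \<in> D})"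
  shows "\<nu> * pr W G \<le> s * pr W D + card S * exp (- s\<^sup>2 / (2 * real (card S)))"
proof -
  have fin: "finite (set_pmf W)" unfolding W_def using assms(1) by (intro finite_set_Pi_pmf) auto
  let ?T = "{\<omega>. s < (\<Sum>e\<in>S. spin a (\<omega> e))}"
  have "\<nu> * pr W G \<le> expect W (\<lambda>\<omega>. indicator D \<omega> * (\<Sum>e\<in>S. spin a (\<omega> e)))"
    unfolding W_def using assms by (intro boundary_le_spin_sum) auto
  \<comment> \<open>The spin sum is at most \<open>s\<close> off the tail event and never exceeds
    \<open>card S\<close>, so a large deviation costs only the second term.\<close>
  also have "\<dots> \<le> expect W (\<lambda>\<omega>. s * indicator D \<omega> + real (card S) * indicator ?T \<omega>)"
  proof (rule expectation_mono_support[OF fin])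
    fix \<omega>
    have "(\<Sum>e\<in>S. spin a (\<omega> e)) \<le> (\<Sum>e\<in>S. 1)"
      by (intro sum_mono) (simp add: spin_def)
    then show "indicator D \<omega> * (\<Sum>e\<in>S. spin a (\<omega> e)) \<le> s * indicator D \<omega> + real (card S) * indicator ?T \<omega>"
      using \<open>0 \<le> s\<close> by (auto simp: indicator_def)
  qed
  also have "\<dots> = s * pr W D + card S * pr W ?T"
    using fin by simp
  also have "\<dots> \<le> s * pr W D + card S * exp (- s\<^sup>2 / (2 * real (card S)))"
    unfolding W_def using assms by (intro add_left_mono mult_left_mono spin_sum_tail) auto
  finally show ?thesis .
qed

text \<open>Exponential Markov inequality with a factor \<open>1/4\<close> for each event that
  occurs. If fewer than \<open>J / 4\<close> occur, then \<open>sqrt 2 ^ J * (1/4) ^ ?n\<close> is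
  at least 1, because \<open>4 = sqrt 2 ^ 4\<close>. Each factor has mean at most
  \<open>1 - 3/8 = 5/8\<close>, and \<open>sqrt 2 * 5/8 < 9/10\<close>.\<close>

lemma few_events_prob_bound:
  fixes V :: "nat \<Rightarrow> ('e \<Rightarrow> 'v) set"
  assumes "finite E" "\<And>e. e \<in> E \<Longrightarrow> finite (set_pmf (p e))"
    and "\<And>i. i < J \<Longrightarrow> S i \<subseteq> E" "\<And>i. i < J \<Longrightarrow> depends_on (S i) (\<lambda>\<omega>. \<omega> \<in> V i)"
    and "\<And>i j. i < J \<Longrightarrow> j < J \<Longrightarrow> i \<noteq> j \<Longrightarrow> S i \<inter> S j = {}"
    and "\<And>i. i < J \<Longrightarrow> 1/2 \<le> pr (Pi_pmf E d p) (V i)"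
  shows "pr (Pi_pmf E d p) {\<omega>. real (card {i. i < J \<and> \<omega> \<in> V i}) < J / 4} \<le> (9/10) ^ J"
proof -
  let ?W = "Pi_pmf E d p"
  have fin: "finite (set_pmf ?W)" using assms(1,2) by (intro finite_set_Pi_pmf) auto
  have "pr ?W {\<omega>. real (card {i. i < J \<and> \<omega> \<in> V i}) < J / 4} \<le>
      expect ?W (\<lambda>\<omega>. sqrt 2 ^ J * (\<Prod>i<J. 1 - 3/4 * indicator (V i) \<omega>))"
    unfolding prob_eq_expectation
  proof (rule expectation_mono_support[OF fin])
    fix \<omega>
    let ?n = "card {i. i < J \<and> \<omega> \<in> V i}"
    have "(\<Prod>i<J. 1 - 3/4 * indicator (V i) \<omega> :: real) = (\<Prod>i<J. if \<omega> \<in> V i then 1/4 else 1)"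
      by (intro prod.cong) (auto simp: indicator_def)
    also have "\<dots> = (1/4) ^ ?n"
      by (simp add: prod.If_cases Int_def)
    finally have eq: "sqrt 2 ^ J * (\<Prod>i<J. 1 - 3/4 * indicator (V i) \<omega> :: real) = sqrt 2 ^ J * (1/4) ^ ?n"
      by simp
    have "1 \<le> sqrt 2 ^ J * (1/4) ^ ?n" if "real ?n < J / 4"
    proof -
      have "4 ^ ?n = sqrt 2 ^ (4 * ?n)" by (simp add: power_mult power4_eq_xxxx mult.assoc)
      also have "\<dots> \<le> sqrt 2 ^ J" using that by (intro power_increasing) auto
      finally show ?thesis by (simp add: power_divide field_simps)
    qed
    moreover have "0 \<le> sqrt 2 ^ J * (1/4) ^ ?n" by simp
    ultimately show "indicator {\<omega>. real (card {i. i < J \<and> \<omega> \<in> V i}) < J / 4} \<omega> \<le>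
        sqrt 2 ^ J * (\<Prod>i<J. 1 - 3/4 * indicator (V i) \<omega>)"
      unfolding eq by (auto simp: indicator_def)
  qed
  also have "\<dots> = sqrt 2 ^ J * (\<Prod>i<J. expect ?W (\<lambda>\<omega>. 1 - 3/4 * indicator (V i) \<omega>))"
  proof -
    have "expect ?W (\<lambda>\<omega>. \<Prod>i<J. 1 - 3/4 * indicator (V i) \<omega>) = (\<Prod>i<J. expect ?W (\<lambda>\<omega>. 1 - 3/4 * indicator (V i) \<omega>))"
    proof (rule expectation_Pi_pmf_prod_indep[where S = S])
      fix i assume "i \<in> {..<J}"
      then show "depends_on (S i) (\<lambda>\<omega>. 1 - 3/4 * indicator (V i) \<omega> :: real)"
        using assms(4) by (intro depends_on_comp[where h = "\<lambda>x. 1 - 3/4 * x"] depends_on_indicator) simp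
    qed (use assms in simp_all)
    then show ?thesis by simp
  qed
  also have "\<dots> = sqrt 2 ^ J * (\<Prod>i<J. 1 - 3/4 * pr ?W (V i))"
    using fin by simp
  also have "\<dots> \<le> sqrt 2 ^ J * (\<Prod>i<J. 5/8)"
  proof (intro mult_left_mono prod_mono)
    fix i assume "i \<in> {..<J}"
    moreover have "pr ?W (V i) \<le> 1" by simp
    ultimately show "0 \<le> 1 - 3/4 * pr ?W (V i) \<and> 1 - 3/4 * pr ?W (V i) \<le> 5/8"
      using assms(6)[of i] by (auto simp del: measure_pmf.prob_le_1)
  qed simp
  also have "\<dots> = (sqrt 2 * (5/8)) ^ J"
    by (simp only: power_mult_distrib prod_constant card_lessThan)
  also have "\<dots> \<le> (9/10) ^ J"
  proof (rule power_mono)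
    have "sqrt 2 \<le> 1.44" by (rule real_le_lsqrt) (auto simp: power2_eq_square)
    then show "sqrt 2 * (5/8) \<le> 9/10" by simp
  qed simp
  finally show ?thesis .
qed

section \<open>Crossings and duality\<close>

lemma path_edges_simps [simp]:
  "path_edges [] = []" "path_edges [x] = []"
  "path_edges (x # y # zs) = {x, y} # path_edges (y # zs)"
  by (simp_all add: path_edges_def)

lemma length_path_edges: "length (path_edges vs) = length vs - 1"
  by (simp add: path_edges_def)

lemma in_set_path_edges_iff:
  "e \<in> set (path_edges vs) \<longleftrightarrow> (\<exists>i. Suc i < length vs \<and> e = {vs ! i, vs ! Suc i})"
proof -
  have "path_edges vs ! i = {vs ! i, vs ! Suc i}" if "Suc i < length vs" for i
    using that by (simp add: path_edges_def nth_tl)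
  moreover have "e \<in> set (path_edges vs) \<longleftrightarrow> (\<exists>i. Suc i < length vs \<and> e = path_edges vs ! i)"
    by (auto simp: in_set_conv_nth length_path_edges less_diff_conv)
  ultimately show ?thesis by metis
qed

lemma path_edges_endpoint: "e \<in> set (path_edges vs) \<Longrightarrow> v \<in> e \<Longrightarrow> v \<in> set vs"
  by (auto simp: in_set_path_edges_iff)

lemma path_edges_map: "path_edges (map f vs) = map (image f) (path_edges vs)"
  by (induction vs rule: induct_list012) auto

lemma successively_map_adjacent:
  assumes "\<And>u v. adjacent u v \<Longrightarrow> adjacent (f u) (f v)" "successively adjacent vs"
  shows "successively adjacent (map f vs)"
  using assms(2) by (induction vs rule: induct_list012) (auto simp: assms(1))

lemma adjacent_neq: "adjacent u v \<Longrightarrow> u \<noteq> v"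
  by (auto simp: adjacent_def)

text \<open>\<open>card (e \<inter> A) = 1\<close> says that \<open>e\<close> crosses the boundary
  of \<open>A\<close>. This parity count replaces the Jordan curve theorem in the duality argument
  below.\<close>

lemma odd_crossings_iff:
  assumes "vs \<noteq> []" "successively adjacent vs"
  shows "odd (length (filter (\<lambda>e. card (e \<inter> A) = 1) (path_edges vs))) \<longleftrightarrow> (hd vs \<in> A) \<noteq> (last vs \<in> A)"
  using assms
proof (induction vs rule: induct_list012)
  case (3 x y zs)
  have "card ({x, y} \<inter> A) = 1 \<longleftrightarrow> (x \<in> A) \<noteq> (y \<in> A)"
    using adjacent_neq[of x y] 3 by (auto simp: Int_insert_left)
  then show ?case using 3 by auto
qed auto

lemma constant_along_path:
  assumes "vs \<noteq> []" "\<And>i. Suc i < length vs \<Longrightarrow> f (vs ! i) = f (vs ! Suc i)"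
  shows "f (hd vs) = f (last vs)"
proof -
  have *: "i < length vs \<Longrightarrow> f (vs ! i) = f (vs ! 0)" for i
  proof (induction i)
    case (Suc i)
    then show ?case using assms(2)[of i] by simp
  qed simp
  from *[of "length vs - 1"] show ?thesis
    using assms(1) by (simp add: hd_conv_nth last_conv_nth)
qed

section \<open>Coordinates of lattice edges and the meeting of dual crossings\<close>

definition hedge :: "int \<Rightarrow> int \<Rightarrow> edge" where
  "hedge i j = {(i, j), (i + 1, j)}"

definition vedge :: "int \<Rightarrow> int \<Rightarrow> edge" where
  "vedge i j = {(i, j), (i, j + 1)}"

lemma hedge_eq_iff [simp]: "hedge i j = hedge i' j' \<longleftrightarrow> i = i' \<and> j = j'"
  by (auto simp: hedge_def doubleton_eq_iff)

lemma vedge_eq_iff [simp]: "vedge i j = vedge i' j' \<longleftrightarrow> i = i' \<and> j = j'"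
  by (auto simp: vedge_def doubleton_eq_iff)

lemma hedge_neq_vedge [simp]: "hedge i j \<noteq> vedge i' j'" "vedge i' j' \<noteq> hedge i j"
  by (auto simp: hedge_def vedge_def doubleton_eq_iff)

lemma adjacent_cases:
  assumes "adjacent u v"
  obtains (right) "v = (fst u + 1, snd u)" "{u, v} = hedge (fst u) (snd u)"
    | (left) "u = (fst v + 1, snd v)" "{u, v} = hedge (fst v) (snd v)"
    | (up) "v = (fst u, snd u + 1)" "{u, v} = vedge (fst u) (snd u)"
    | (down) "u = (fst v, snd v + 1)" "{u, v} = vedge (fst v) (snd v)"
proof -
  obtain x y x' y' where uv: "u = (x, y)" "v = (x', y')" by (metis surj_pair)
  have "(x' = x + 1 \<and> y' = y) \<or> (x = x' + 1 \<and> y' = y) \<or> (x' = x \<and> y' = y + 1) \<or> (x' = x \<and> y = y' + 1)"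
    using assms by (auto simp: adjacent_def uv)
  then consider "v = (fst u + 1, snd u)" | "u = (fst v + 1, snd v)" | "v = (fst u, snd u + 1)" | "u = (fst v, snd v + 1)"
    by (auto simp: uv)
  then show thesis
  proof cases
    case 1
    then show ?thesis by (intro right) (auto simp: hedge_def)
  next
    case 2
    then show ?thesis by (intro left) (auto simp: hedge_def)
  next
    case 3
    then show ?thesis by (intro up) (auto simp: vedge_def)
  next
    case 4
    then show ?thesis by (intro down) (auto simp: vedge_def)
  qed
qed

lemma edge_in_path_cases:
  assumes "successively adjacent vs" "e \<in> set (path_edges vs)"
  obtains i j where "e = hedge i j" | i j where "e = vedge i j"
proof -
  obtain i where i: "Suc i < length vs" "e = {vs ! i, vs ! Suc i}"
    using assms(2) by (auto simp: in_set_path_edges_iff)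
  have "adjacent (vs ! i) (vs ! Suc i)"
    using assms(1) i by (simp add: successively_conv_nth)
  then show thesis
    by (cases rule: adjacent_cases) (use i(2) in \<open>simp_all add: that\<close>)
qed

lemma length_filter_disj:
  assumes "\<And>x. x \<in> set xs \<Longrightarrow> P x \<longleftrightarrow> Q x \<or> R x" "\<And>x. x \<in> set xs \<Longrightarrow> \<not> (Q x \<and> R x)"
  shows "length (filter P xs) = length (filter Q xs) + length (filter R xs)"
  using assms
proof (induction xs)
  case (Cons x xs)
  then have "length (filter P xs) = length (filter Q xs) + length (filter R xs)"
    by simp
  then show ?case using Cons.prems(1)[of x] Cons.prems(2)[of x] by auto
qed simp

lemma card_Int_1_doubleton:
  "u \<noteq> v \<Longrightarrow> card ({u, v} \<inter> A) = 1 \<longleftrightarrow> (u \<in> A) \<noteq> (v \<in> A)"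
  by (auto simp: Int_insert_left)

text \<open>
  A horizontal crossing of the block meets the dual of every vertical dual crossing; the latter is
  encoded, by transposition, as a horizontal crossing \<open>D\<close>. The parity of the number of times that
  \<open>D\<close> is crossed by the half-line to the left of a vertex does not change along \<open>P\<close> unless \<open>P\<close> uses
  an edge dual to one of \<open>D\<close>.
\<close>
lemma crossing_meets_dual_crossing:
  fixes k :: int
  assumes P: "P \<noteq> []" "successively adjacent P" "\<And>v. v \<in> set P \<Longrightarrow> 0 \<le> snd v \<and> snd v < k"
      "fst (hd P) \<le> 0" "k \<le> fst (last P)"
    and D: "D \<noteq> []" "successively adjacent D" "\<And>v. v \<in> set D \<Longrightarrow> 0 \<le> snd v \<and> snd v < k"
      "fst (hd D) \<le> 0" "k \<le> fst (last D)"
  shows "(\<exists>i j. 0 \<le> i \<and> i < k \<and> 0 \<le> j \<and> j < k \<and> hedge i j \<in> set (path_edges P) \<and> hedge j i \<in> set (path_edges D)) \<or>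
    (\<exists>i j. 1 \<le> i \<and> i < k \<and> 0 \<le> j \<and> j < k - 1 \<and> vedge i j \<in> set (path_edges P) \<and> vedge (j + 1) (i - 1) \<in> set (path_edges D))"
proof (rule ccontr)
  assume "\<not> ?thesis"
  then have noh: "\<And>i j. 0 \<le> i \<Longrightarrow> i < k \<Longrightarrow> 0 \<le> j \<Longrightarrow> j < k \<Longrightarrow> hedge i j \<in> set (path_edges P) \<Longrightarrow> hedge j i \<notin> set (path_edges D)"
    and nov: "\<And>i j. 1 \<le> i \<Longrightarrow> i < k \<Longrightarrow> 0 \<le> j \<Longrightarrow> j < k - 1 \<Longrightarrow> vedge i j \<in> set (path_edges P) \<Longrightarrow> vedge (j + 1) (i - 1) \<notin> set (path_edges D)"
    by blast+
  \<comment> \<open>As \<open>D\<close> is transposed, \<open>hedge y i\<close> in \<open>D\<close>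
    stands for the dual of the primal edge \<open>hedge i y\<close>. Hence \<open>N x y\<close>
    counts how often \<open>D\<close> crosses the half-line to the left of
    \<open>(x, y)\<close>.\<close>
  define crs where "crs = (\<lambda>x y e. \<exists>i<x. e = hedge y i)"
  define N where "N = (\<lambda>x y. length (filter (crs x y) (path_edges D)))"
  have Dh: "0 \<le> j \<and> j < k" if "hedge i j \<in> set (path_edges D)" for i j
    using D(3) path_edges_endpoint[OF that, of "(i, j)"] by (force simp: hedge_def)
  have Dv: "0 \<le> j \<and> j + 1 < k" if "vedge i j \<in> set (path_edges D)" for i j
    using D(3) path_edges_endpoint[OF that, of "(i, j)"] path_edges_endpoint[OF that, of "(i, j + 1)"]
    by (force simp: vedge_def)
  have hdD: "hd D \<in> set D" "last D \<in> set D" and hdP: "hd P \<in> set P" "last P \<in> set P"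
    using D(1) P(1) by auto
  have horiz: "N (x + 1) y = N x y" if "0 \<le> y" "y < k" "hedge x y \<in> set (path_edges P)" for x y
  proof -
    \<comment> \<open>\<open>P\<close> may run outside the block. There \<open>D\<close> has no edge
      to offer, since its second coordinates lie in \<open>[0, k)\<close>.\<close>
    have "hedge y x \<notin> set (path_edges D)"
      using noh[of x y] Dh[of y x] that by (cases "0 \<le> x \<and> x < k") auto
    then have "crs (x + 1) y e \<longleftrightarrow> crs x y e" if "e \<in> set (path_edges D)" for e
      using that by (auto simp: crs_def order_le_less)
    then show ?thesis unfolding N_def by (metis (mono_tags, lifting) filter_cong)
  qed
  have vert: "even (N x y) = even (N x (y + 1))" if "0 \<le> y" "y + 1 < k" "vedge x y \<in> set (path_edges P)" for x y
  proof -
    \<comment> \<open>In dual terms, the row of faces between heights \<open>y\<close> and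
      \<open>y + 1\<close> to the left of \<open>x\<close>. \<open>D\<close> can leave it through
      its two long sides, counted by \<open>N x y\<close> and \<open>N x (y + 1)\<close>, or at its
      end through the edge excluded by \<open>nv\<close>. Both endpoints of \<open>D\<close> lie
      outside, so the total is even.\<close>
    let ?A = "{v. fst v = y + 1 \<and> snd v < x}"
    have nv: "vedge (y + 1) (x - 1) \<notin> set (path_edges D)"
      using nov[of x y] Dv[of "y + 1" "x - 1"] that by (cases "1 \<le> x \<and> x < k") auto
    have "card (e \<inter> ?A) = 1 \<longleftrightarrow> crs x y e \<or> crs x (y + 1) e" if e: "e \<in> set (path_edges D)" for e
    proof (rule edge_in_path_cases[OF D(2) e])
      fix i j assume eq: "e = hedge i j"
      show ?thesis unfolding eq
        by (subst hedge_def, subst card_Int_1_doubleton) (auto simp: crs_def)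
    next
      fix i j assume eq: "e = vedge i j"
      with nv e have "\<not> (i = y + 1 \<and> j = x - 1)" by auto
      then show ?thesis unfolding eq
        by (subst vedge_def, subst card_Int_1_doubleton) (auto simp: crs_def)
    qed
    then have "length (filter (\<lambda>e. card (e \<inter> ?A) = 1) (path_edges D)) = N x y + N x (y + 1)"
      unfolding N_def by (intro length_filter_disj) (auto simp: crs_def)
    moreover have "even (length (filter (\<lambda>e. card (e \<inter> ?A) = 1) (path_edges D)))"
      using odd_crossings_iff[OF D(1,2), of ?A] D(4,5) that by auto
    ultimately show ?thesis by simp
  qed
  define f where "f = (\<lambda>v. even (N (fst v) (snd v)))"
  have "f (hd P) = f (last P)"
  proof (rule constant_along_path[OF P(1)])
    fix i assume i: "Suc i < length P"
    let ?u = "P ! i" and ?v = "P ! Suc i"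
    have adj: "adjacent ?u ?v" using P(2) i by (simp add: successively_conv_nth)
    have eP: "{?u, ?v} \<in> set (path_edges P)" using i by (auto simp: in_set_path_edges_iff)
    have r: "0 \<le> snd ?u" "snd ?u < k" "0 \<le> snd ?v" "snd ?v < k" using P(3) i by auto
    from adj show "f ?u = f ?v"
    proof (cases rule: adjacent_cases)
      case right
      then show ?thesis using horiz[of "snd ?u" "fst ?u"] r eP by (auto simp: f_def)
    next
      case left
      then show ?thesis using horiz[of "snd ?v" "fst ?v"] r eP by (auto simp: f_def)
    next
      case up
      then show ?thesis using vert[of "snd ?u" "fst ?u"] r eP by (auto simp: f_def)
    next
      case down
      then show ?thesis using vert[of "snd ?v" "fst ?v"] r eP by (auto simp: f_def)
    qed
  qed
  moreover have "f (hd P)"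
  proof -
    \<comment> \<open>A crossing would be some \<open>hedge y i\<close> with \<open>i < 0\<close>,
      out of reach of \<open>D\<close>.\<close>
    have "filter (crs (fst (hd P)) (snd (hd P))) (path_edges D) = []"
      using Dh P(4) by (fastforce simp: filter_empty_conv crs_def)
    then show ?thesis by (simp add: f_def N_def)
  qed
  moreover have "\<not> f (last P)"
  proof -
    define y where "y = snd (last P)"
    \<comment> \<open>At the end of \<open>P\<close> the half-line spans the whole block, so
      \<open>N\<close> counts every passage of \<open>D\<close> between first coordinates
      \<open>y\<close> and \<open>y + 1\<close>. \<open>D\<close> starts on one side and ends on the
      other, hence odd.\<close>
    let ?A = "{v. fst v \<le> y}"
    have y: "0 \<le> y" "y < k" using P(3)[OF hdP(2)] by (auto simp: y_def)
    have "card (e \<inter> ?A) = 1 \<longleftrightarrow> crs (fst (last P)) y e" if e: "e \<in> set (path_edges D)" for e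
    proof (rule edge_in_path_cases[OF D(2) e])
      fix i j assume eq: "e = hedge i j"
      show ?thesis using Dh[of i j] e P(5) unfolding eq
        by (subst hedge_def, subst card_Int_1_doubleton) (auto simp: crs_def)
    next
      fix i j assume eq: "e = vedge i j"
      show ?thesis unfolding eq
        by (subst vedge_def, subst card_Int_1_doubleton) (auto simp: crs_def)
    qed
    then have "filter (\<lambda>e. card (e \<inter> ?A) = 1) (path_edges D) = filter (crs (fst (last P)) y) (path_edges D)"
      by (rule filter_cong[OF refl])
    then have "odd (N (fst (last P)) y)"
      using odd_crossings_iff[OF D(1,2), of ?A] D(4,5) y by (auto simp: N_def)
    then show ?thesis by (simp add: f_def y_def)
  qed
  ultimately show False by simp
qed

section \<open>Strips, square blocks and the self-duality of a block\<close>

definition strip_paths :: "nat \<Rightarrow> nat \<Rightarrow> int \<Rightarrow> vertex list set" where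
  "strip_paths n k m = {vs. vs \<noteq> [] \<and> successively adjacent vs \<and> (\<forall>v\<in>set vs. in_box n v) \<and>
     fst (hd vs) = 0 \<and> fst (last vs) = int n \<and> (\<forall>v\<in>set vs. m \<le> snd v \<and> snd v < m + int k)}"

definition strip_edges :: "nat \<Rightarrow> nat \<Rightarrow> int \<Rightarrow> edge set" where
  "strip_edges n k m = {e \<in> edges_box n. \<forall>v\<in>e. m \<le> snd v \<and> snd v < m + int k}"

text \<open>The standard self-dual rectangle with \<open>k + 1\<close> columns and \<open>k\<close>
  rows. The vertical edges on its left and right sides are left out, so that the dual edges
  reflected in the diagonal fill the same set.\<close>

definition block_edges :: "nat \<Rightarrow> int \<Rightarrow> int \<Rightarrow> edge set" where
  "block_edges k x m = {hedge (x + i) (m + j) | i j. 0 \<le> i \<and> i < int k \<and> 0 \<le> j \<and> j < int k} \<union>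
     {vedge (x + i) (m + j) | i j. 1 \<le> i \<and> i < int k \<and> 0 \<le> j \<and> j < int k - 1}"

lemma finite_in_box: "finite {v. in_box n v}"
proof -
  have "{v. in_box n v} \<subseteq> {0..int n} \<times> {0..int n}"
    by (auto simp: in_box_def)
  then show ?thesis by (rule finite_subset) simp
qed

lemma finite_edges_box: "finite (edges_box n)"
proof -
  have "edges_box n \<subseteq> Pow {v. in_box n v}"
    by (auto simp: edges_box_def)
  then show ?thesis by (rule finite_subset) (simp add: finite_in_box)
qed

lemma edges_box_cases:
  assumes "e \<in> edges_box n"
  obtains i j where "e = hedge i j" "0 \<le> i" "i + 1 \<le> int n" "0 \<le> j" "j < int n"
    | i j where "e = vedge i j" "0 \<le> i" "i \<le> int n" "0 \<le> j" "j + 1 < int n"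
proof -
  obtain u v where uv: "e = {u, v}" "adjacent u v" "in_box n u" "in_box n v"
    using assms by (auto simp: edges_box_def)
  from uv(2) show thesis
  proof (cases rule: adjacent_cases)
    case right
    then show ?thesis using uv by (intro that(1)[of "fst u" "snd u"]) (auto simp: in_box_def)
  next
    case left
    then show ?thesis using uv by (intro that(1)[of "fst v" "snd v"]) (auto simp: in_box_def)
  next
    case up
    then show ?thesis using uv by (intro that(2)[of "fst u" "snd u"]) (auto simp: in_box_def)
  next
    case down
    then show ?thesis using uv by (intro that(2)[of "fst v" "snd v"]) (auto simp: in_box_def)
  qed
qed

lemma hedge_in_edges_box: "hedge i j \<in> edges_box n \<longleftrightarrow> 0 \<le> i \<and> i + 1 \<le> int n \<and> 0 \<le> j \<and> j < int n"
proof
  assume "hedge i j \<in> edges_box n"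
  then show "0 \<le> i \<and> i + 1 \<le> int n \<and> 0 \<le> j \<and> j < int n"
    by (cases rule: edges_box_cases) auto
next
  assume "0 \<le> i \<and> i + 1 \<le> int n \<and> 0 \<le> j \<and> j < int n"
  then show "hedge i j \<in> edges_box n"
    unfolding edges_box_def hedge_def mem_Collect_eq
    by (intro exI[of _ "(i, j)"] exI[of _ "(i + 1, j)"]) (auto simp: adjacent_def in_box_def)
qed

lemma vedge_in_edges_box: "vedge i j \<in> edges_box n \<longleftrightarrow> 0 \<le> i \<and> i \<le> int n \<and> 0 \<le> j \<and> j + 1 < int n"
proof
  assume "vedge i j \<in> edges_box n"
  then show "0 \<le> i \<and> i \<le> int n \<and> 0 \<le> j \<and> j + 1 < int n"
    by (cases rule: edges_box_cases) auto
next
  assume "0 \<le> i \<and> i \<le> int n \<and> 0 \<le> j \<and> j + 1 < int n"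
  then show "vedge i j \<in> edges_box n"
    unfolding edges_box_def vedge_def mem_Collect_eq
    by (intro exI[of _ "(i, j)"] exI[of _ "(i, j + 1)"]) (auto simp: adjacent_def in_box_def)
qed

lemma strip_edges_subset: "strip_edges n k m \<subseteq> edges_box n"
  by (auto simp: strip_edges_def)

lemma strip_path_edges:
  assumes "vs \<in> strip_paths n k m"
  shows "set (path_edges vs) \<subseteq> strip_edges n k m"
proof
  fix e assume e: "e \<in> set (path_edges vs)"
  then obtain i where i: "Suc i < length vs" "e = {vs ! i, vs ! Suc i}"
    by (auto simp: in_set_path_edges_iff)
  have v: "vs ! i \<in> set vs" "vs ! Suc i \<in> set vs" using i by auto
  have "adjacent (vs ! i) (vs ! Suc i)" "in_box n (vs ! i)" "in_box n (vs ! Suc i)"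
    using assms i v by (auto simp: strip_paths_def successively_conv_nth)
  then have "e \<in> edges_box n" unfolding edges_box_def i by blast
  then show "e \<in> strip_edges n k m"
    using assms v i by (auto simp: strip_edges_def strip_paths_def)
qed

lemma card_strip_edges: "card (strip_edges n k m) \<le> 2 * (n + 1) * k"
proof -
  let ?R = "{0..int n} \<times> {m..<m + int k}"
  have "strip_edges n k m \<subseteq> case_prod hedge ` ?R \<union> case_prod vedge ` ?R"
  proof
    fix e assume e: "e \<in> strip_edges n k m"
    then have "e \<in> edges_box n" by (simp add: strip_edges_def)
    then show "e \<in> case_prod hedge ` ?R \<union> case_prod vedge ` ?R"
    proof (cases rule: edges_box_cases)
      case (1 i j)
      then have "(i, j) \<in> ?R" using e by (auto simp: strip_edges_def hedge_def)
      then show ?thesis using 1 by force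
    next
      case (2 i j)
      then have "(i, j) \<in> ?R" using e by (auto simp: strip_edges_def vedge_def)
      then show ?thesis using 2 by force
    qed
  qed
  then have "card (strip_edges n k m) \<le> card (case_prod hedge ` ?R \<union> case_prod vedge ` ?R)"
    by (intro card_mono) auto
  also have "\<dots> \<le> card (case_prod hedge ` ?R) + card (case_prod vedge ` ?R)"
    by (rule card_Un_le)
  also have "\<dots> \<le> card ?R + card ?R"
    by (intro add_mono card_image_le) auto
  also have "\<dots> = 2 * (n + 1) * k" by (simp add: card_cartesian_product nat_add_distrib)
  finally show ?thesis .
qed

lemma block_edges_subset:
  assumes "0 \<le> x" "x + int k \<le> int n" "0 \<le> m" "m + int k \<le> int n"
  shows "block_edges k x m \<subseteq> edges_box n"
  using assms by (auto simp: block_edges_def hedge_in_edges_box vedge_in_edges_box)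

lemma block_edges_disjoint:
  assumes "c \<noteq> c'"
  shows "block_edges k (int (c * k)) m \<inter> block_edges k (int (c' * k)) m = {}"
proof -
  have "c = c'" if "int (c * k) + i = int (c' * k) + i'" "0 \<le> i" "i < int k" "0 \<le> i'" "i' < int k" for i i'
  proof -
    have "(int (c * k) + i) div int k = int c" "(int (c' * k) + i') div int k = int c'"
      using that(2-5) by simp_all
    then have "int c = int c'" by (simp only: that(1))
    then show ?thesis by simp
  qed
  then show ?thesis using assms by (fastforce simp: block_edges_def)
qed

text \<open>The dual edge, reflected in the diagonal of the block. An edge is an unordered pair, so
  its lower left endpoint is recovered by minima. A vertical edge at \<open>(i, j)\<close> goes to
  the vertical edge at \<open>(j + 1, i - 1)\<close>; the shift by one comes from the half-step
  offset of the dual lattice and makes the map an involution.\<close>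

definition dual_edge :: "int \<Rightarrow> int \<Rightarrow> edge \<Rightarrow> edge" where
  "dual_edge x m e = (let i = Min (fst ` e) - x; j = Min (snd ` e) - m in
     if Max (snd ` e) = Min (snd ` e) then hedge (x + j) (m + i) else vedge (x + j + 1) (m + i - 1))"

lemma dual_edge_hedge: "dual_edge x m (hedge (x + i) (m + j)) = hedge (x + j) (m + i)"
  by (simp add: dual_edge_def hedge_def)

lemma dual_edge_vedge: "dual_edge x m (vedge (x + i) (m + j)) = vedge (x + (j + 1)) (m + (i - 1))"
  by (simp add: dual_edge_def vedge_def algebra_simps)

lemma dual_edge_block:
  assumes "e \<in> block_edges k x m"
  shows "dual_edge x m e \<in> block_edges k x m" "dual_edge x m (dual_edge x m e) = e"
proof -
  from assms consider i j where "e = hedge (x + i) (m + j)" "0 \<le> i" "i < int k" "0 \<le> j" "j < int k"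
    | i j where "e = vedge (x + i) (m + j)" "1 \<le> i" "i < int k" "0 \<le> j" "j < int k - 1"
    by (auto simp: block_edges_def)
  then have "dual_edge x m e \<in> block_edges k x m \<and> dual_edge x m (dual_edge x m e) = e"
  proof cases
    case (1 i j)
    then show ?thesis unfolding 1(1) dual_edge_hedge by (auto simp: block_edges_def)
  next
    case (2 i j)
    have "vedge (x + (j + 1)) (m + (i - 1)) \<in> block_edges k x m"
      using 2 unfolding block_edges_def
      by (intro UnI2 CollectI exI[of _ "j + 1"] exI[of _ "i - 1"]) auto
    then show ?thesis unfolding 2(1) dual_edge_vedge by simp
  qed
  then show "dual_edge x m e \<in> block_edges k x m" "dual_edge x m (dual_edge x m e) = e" by auto
qed

text \<open>The path may begin and end far outside the block, and only its edges inside are tested.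
  A crossing of the whole strip can thus be used for every block without being cut.\<close>

definition block_crossed :: "real \<Rightarrow> nat \<Rightarrow> int \<Rightarrow> int \<Rightarrow> config \<Rightarrow> bool" where
  "block_crossed a k x m \<omega> \<longleftrightarrow> (\<exists>vs. vs \<noteq> [] \<and> successively adjacent vs \<and>
     (\<forall>v\<in>set vs. m \<le> snd v \<and> snd v < m + int k) \<and> fst (hd vs) \<le> x \<and> x + int k \<le> fst (last vs) \<and>
     (\<forall>e\<in>set (path_edges vs) \<inter> block_edges k x m. \<omega> e = a))"

lemma depends_on_block_crossed: "depends_on (block_edges k x m) (block_crossed a k x m)"
proof -
  have "block_crossed a k x m \<eta>" if "block_crossed a k x m \<omega>" "\<forall>e\<in>block_edges k x m. \<omega> e = \<eta> e" for \<omega> \<eta>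
  proof -
    from that(1) obtain vs where "vs \<noteq> []" "successively adjacent vs" "\<forall>v\<in>set vs. m \<le> snd v \<and> snd v < m + int k"
      "fst (hd vs) \<le> x" "x + int k \<le> fst (last vs)" "\<forall>e\<in>set (path_edges vs) \<inter> block_edges k x m. \<omega> e = a"
      unfolding block_crossed_def by blast
    with that(2) show ?thesis unfolding block_crossed_def by (intro exI[of _ vs]) auto
  qed
  then show ?thesis unfolding depends_on_def by metis
qed

lemma shifted_hedge: "hedge i j \<in> image (\<lambda>v. (fst v - x, snd v - m)) ` S \<longleftrightarrow> hedge (x + i) (m + j) \<in> S"
proof
  assume "hedge i j \<in> image (\<lambda>v. (fst v - x, snd v - m)) ` S"
  then obtain e where e: "e \<in> S" "hedge i j = (\<lambda>v. (fst v - x, snd v - m)) ` e" by auto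
  have "(\<lambda>v. (fst v + x, snd v + m)) ` hedge i j = e"
    unfolding e(2) by (simp add: image_comp o_def)
  then show "hedge (x + i) (m + j) \<in> S" using e(1) by (simp add: hedge_def algebra_simps)
next
  assume "hedge (x + i) (m + j) \<in> S"
  moreover have "hedge i j = (\<lambda>v. (fst v - x, snd v - m)) ` hedge (x + i) (m + j)"
    by (simp add: hedge_def)
  ultimately show "hedge i j \<in> image (\<lambda>v. (fst v - x, snd v - m)) ` S" by blast
qed

lemma shifted_vedge: "vedge i j \<in> image (\<lambda>v. (fst v - x, snd v - m)) ` S \<longleftrightarrow> vedge (x + i) (m + j) \<in> S"
proof
  assume "vedge i j \<in> image (\<lambda>v. (fst v - x, snd v - m)) ` S"
  then obtain e where e: "e \<in> S" "vedge i j = (\<lambda>v. (fst v - x, snd v - m)) ` e" by auto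
  have "(\<lambda>v. (fst v + x, snd v + m)) ` vedge i j = e"
    unfolding e(2) by (simp add: image_comp o_def)
  then show "vedge (x + i) (m + j) \<in> S" using e(1) by (simp add: vedge_def algebra_simps)
next
  assume "vedge (x + i) (m + j) \<in> S"
  moreover have "vedge i j = (\<lambda>v. (fst v - x, snd v - m)) ` vedge (x + i) (m + j)"
    by (simp add: vedge_def)
  ultimately show "vedge i j \<in> image (\<lambda>v. (fst v - x, snd v - m)) ` S" by blast
qed

text \<open>The two crossings share a dual pair: \<open>e\<close> on the first,
  \<open>dual_edge x m e\<close> on the second. The first gives \<open>\<omega> e = a\<close>; the
  second, as duality is an involution, \<open>\<omega> e = b\<close>.\<close>

lemma block_crossed_dual_exclusive:
  assumes "a \<noteq> b" "block_crossed a k x m \<omega>" "block_crossed a k x m (\<lambda>e. a + b - \<omega> (dual_edge x m e))"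
  shows False
proof -
  let ?f = "\<lambda>v :: vertex. (fst v - x, snd v - m)"
  let ?ok = "\<lambda>vs. vs \<noteq> [] \<and> successively adjacent vs \<and>
     (\<forall>v\<in>set vs. m \<le> snd v \<and> snd v < m + int k) \<and> fst (hd vs) \<le> x \<and> x + int k \<le> fst (last vs)"
  obtain P where P: "?ok P" "\<And>e. e \<in> set (path_edges P) \<Longrightarrow> e \<in> block_edges k x m \<Longrightarrow> \<omega> e = a"
    using assms(2) unfolding block_crossed_def by blast
  obtain D where D: "?ok D" "\<And>e. e \<in> set (path_edges D) \<Longrightarrow> e \<in> block_edges k x m \<Longrightarrow> a + b - \<omega> (dual_edge x m e) = a"
    using assms(3) unfolding block_crossed_def by blast
  have ok: "map ?f vs \<noteq> []" "successively adjacent (map ?f vs)"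
      "\<And>v. v \<in> set (map ?f vs) \<Longrightarrow> 0 \<le> snd v \<and> snd v < int k"
      "fst (hd (map ?f vs)) \<le> 0" "int k \<le> fst (last (map ?f vs))" if "?ok vs" for vs
  proof -
    have "adjacent (?f u) (?f v)" if "adjacent u v" for u v
      using that by (simp add: adjacent_def)
    then show "successively adjacent (map ?f vs)"
      using that by (intro successively_map_adjacent) auto
  qed (use that in \<open>auto simp: hd_map last_map\<close>)
  have "(\<exists>i j. 0 \<le> i \<and> i < int k \<and> 0 \<le> j \<and> j < int k \<and> hedge i j \<in> set (path_edges (map ?f P)) \<and> hedge j i \<in> set (path_edges (map ?f D))) \<or>
    (\<exists>i j. 1 \<le> i \<and> i < int k \<and> 0 \<le> j \<and> j < int k - 1 \<and> vedge i j \<in> set (path_edges (map ?f P)) \<and> vedge (j + 1) (i - 1) \<in> set (path_edges (map ?f D)))"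
    by (rule crossing_meets_dual_crossing[OF ok[OF P(1)] ok[OF D(1)]])
  then obtain e where e: "e \<in> block_edges k x m" "e \<in> set (path_edges P)" "dual_edge x m e \<in> set (path_edges D)"
  proof (elim disjE exE conjE)
    fix i j assume ij: "0 \<le> i" "i < int k" "0 \<le> j" "j < int k"
      and *: "hedge i j \<in> set (path_edges (map ?f P))" "hedge j i \<in> set (path_edges (map ?f D))"
    have "hedge (x + i) (m + j) \<in> set (path_edges P)" "hedge (x + j) (m + i) \<in> set (path_edges D)"
      using * by (simp_all add: path_edges_map shifted_hedge)
    moreover have "hedge (x + i) (m + j) \<in> block_edges k x m"
      using ij by (auto simp: block_edges_def)
    ultimately show thesis by (intro that) (auto simp: dual_edge_hedge)
  next
    fix i j assume ij: "1 \<le> i" "i < int k" "0 \<le> j" "j < int k - 1"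
      and *: "vedge i j \<in> set (path_edges (map ?f P))" "vedge (j + 1) (i - 1) \<in> set (path_edges (map ?f D))"
    have "vedge (x + i) (m + j) \<in> set (path_edges P)" "vedge (x + (j + 1)) (m + (i - 1)) \<in> set (path_edges D)"
      using * by (simp_all only: path_edges_map shifted_vedge set_map)
    moreover have "vedge (x + i) (m + j) \<in> block_edges k x m"
      using ij by (auto simp: block_edges_def)
    ultimately show thesis by (intro that) (auto simp: dual_edge_vedge)
  qed
  have "\<omega> e = a" using P(2) e by blast
  moreover have "a + b - \<omega> e = a" using D(2)[OF e(3)] dual_edge_block[OF e(1)] by simp
  ultimately show False using assms(1) by simp
qed

text \<open>
  Self-duality: reflecting the block along its diagonal and exchanging \<open>a\<close> and \<open>b\<close> turns primal
  crossings by edges of weight \<open>a\<close> into dual crossings by edges of weight \<open>b\<close>.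
\<close>
lemma prob_block_crossed_le_half:
  assumes "a \<noteq> b" "block_edges k x m \<subseteq> edges_box n"
  shows "pr (weight_pmf a b n) {\<omega>. block_crossed a k x m \<omega>} \<le> 1/2"
proof -
  let ?W = "weight_pmf a b n" and ?E = "edges_box n" and ?B = "block_edges k x m" and ?\<mu> = "pmf_of_set {a, b}"
  let ?H = "{\<omega>. block_crossed a k x m \<omega>}"
  note dep = depends_on_block_crossed[of k x m a]
  have swap: "map_pmf (\<lambda>y. a + b - y) ?\<mu> = ?\<mu>"
  proof -
    have "inj_on (\<lambda>y. a + b - y) {a, b}" by (auto simp: inj_on_def)
    moreover have "(\<lambda>y. a + b - y) ` {a, b} = {a, b}" by auto
    ultimately show ?thesis by (subst map_pmf_of_set_inj) auto
  qed
  have "?W = map_pmf (\<lambda>\<omega> e. if e \<in> ?E then a + b - \<omega> e else 0) ?W"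
    using Pi_pmf_map_dep[OF finite_edges_box, where H = "\<lambda>_ y. a + b - y" and p = "\<lambda>_. ?\<mu>" and d = 0 and d' = 0]
    by (simp add: weight_pmf_def swap)
  then have "pr ?W ?H = pr (map_pmf (\<lambda>\<omega> e. if e \<in> ?E then a + b - \<omega> e else 0) ?W) ?H"
    by simp
  also have "\<dots> = pr ?W {\<omega>. block_crossed a k x m (\<lambda>e. if e \<in> ?E then a + b - \<omega> e else 0)}"
    by (simp add: vimage_def)
  also have "\<dots> = pr ?W {\<omega>. block_crossed a k x m (\<lambda>e. a + b - \<omega> e)}"
    using assms(2) by (intro arg_cong2[where f = pr] Collect_cong depends_onD[OF dep] refl) auto
  also have "\<dots> = pr ?W {\<omega>. \<omega> \<circ> dual_edge x m \<in> {\<omega>. block_crossed a k x m (\<lambda>e. a + b - \<omega> e)}}"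
    unfolding weight_pmf_def
  proof (rule prob_Pi_pmf_reindex[symmetric, OF finite_edges_box assms(2)])
    show "inj_on (dual_edge x m) ?B"
      by (rule inj_on_inverseI[where g = "dual_edge x m"]) (rule dual_edge_block(2))
    show "dual_edge x m ` ?B \<subseteq> ?E" using dual_edge_block(1) assms(2) by blast
    show "depends_on ?B (\<lambda>\<omega>. \<omega> \<in> {\<omega>. block_crossed a k x m (\<lambda>e. a + b - \<omega> e)})"
      unfolding depends_on_def mem_Collect_eq by (intro allI impI depends_onD[OF dep]) simp
  qed auto
  finally have eq: "pr ?W ?H = pr ?W {\<omega>. block_crossed a k x m (\<lambda>e. a + b - \<omega> (dual_edge x m e))}" (is "_ = pr ?W ?H'")
    by (simp add: o_def)
  \<comment> \<open>Exchanging the weights and reflecting preserve the measure, so \<open>?H\<close>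
    and \<open>?H'\<close> are equally likely; being disjoint, each has probability at most
    1/2.\<close>
  have "?H \<inter> ?H' = {}" using block_crossed_dual_exclusive[OF assms(1)] by blast
  then have "pr ?W ?H + pr ?W ?H' = pr ?W (?H \<union> ?H')"
    by (intro measure_pmf.finite_measure_Union[symmetric]) auto
  also have "\<dots> \<le> 1" by simp
  finally show ?thesis using eq by simp
qed

section \<open>Crossing times of strips\<close>

lemma prob_mono_support:
  assumes "\<And>x. x \<in> set_pmf p \<Longrightarrow> x \<in> A \<Longrightarrow> x \<in> B"
  shows "pr p A \<le> pr p B"
proof -
  have "pr p A = pr p (A \<inter> set_pmf p)" by (simp add: measure_Int_set_pmf)
  also have "\<dots> \<le> pr p B" using assms by (intro measure_pmf.finite_measure_mono) auto
  finally show ?thesis .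
qed

lemma weight_pmf_support:
  assumes "\<omega> \<in> set_pmf (weight_pmf a b n)"
  shows "e \<in> edges_box n \<Longrightarrow> \<omega> e = a \<or> \<omega> e = b"
  using assms by (auto simp: weight_pmf_def set_Pi_pmf finite_edges_box PiE_dflt_def)

lemma finite_set_weight_pmf: "finite (set_pmf (weight_pmf a b n))"
  unfolding weight_pmf_def by (intro finite_set_Pi_pmf finite_edges_box) auto

text \<open>Cut the strip into \<open>n div k\<close> disjoint squares. With probability at least
  1/2 a square has no crossing by edges of weight \<open>a\<close>, and then every strip crossing
  has an edge of weight \<open>b\<close> inside it. These squares are independent and the edges
  found in them distinct.\<close>

lemma few_heavy_edges_prob:
  assumes "a \<noteq> b" "0 \<le> m" "m + int k \<le> int n" "1 \<le> k"
  shows "pr (weight_pmf a b n) {\<omega>. \<exists>vs\<in>strip_paths n k m.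
      real (card {e \<in> set (path_edges vs). \<omega> e = b}) < real (n div k) / 4} \<le> (9/10) ^ (n div k)"
proof -
  let ?W = "weight_pmf a b n" and ?J = "n div k"
  let ?V = "\<lambda>c. {\<omega>. \<not> block_crossed a k (int (c * k)) m \<omega>}"
  have fits: "int (c * k) + int k \<le> int n" if "c < ?J" for c
  proof -
    have "Suc c * k \<le> ?J * k" using that by (intro mult_right_mono) auto
    also have "\<dots> \<le> n" by simp
    finally have "int (Suc c * k) \<le> int n" by (simp only: of_nat_le_iff)
    then show ?thesis by (simp add: algebra_simps)
  qed
  have sub: "block_edges k (int (c * k)) m \<subseteq> edges_box n" if "c < ?J" for c
    using fits[OF that] assms by (intro block_edges_subset) auto
  have "pr ?W {\<omega>. \<exists>vs\<in>strip_paths n k m. real (card {e \<in> set (path_edges vs). \<omega> e = b}) < real ?J / 4}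
    \<le> pr ?W {\<omega>. real (card {c. c < ?J \<and> \<omega> \<in> ?V c}) < real ?J / 4}"
  proof (rule prob_mono_support)
    fix \<omega> assume \<omega>: "\<omega> \<in> set_pmf ?W"
      "\<omega> \<in> {\<omega>. \<exists>vs\<in>strip_paths n k m. real (card {e \<in> set (path_edges vs). \<omega> e = b}) < real ?J / 4}"
    then obtain vs where vs: "vs \<in> strip_paths n k m" "real (card {e \<in> set (path_edges vs). \<omega> e = b}) < real ?J / 4"
      by auto
    let ?C = "{c. c < ?J \<and> \<omega> \<in> ?V c}"
    have "\<exists>e. e \<in> set (path_edges vs) \<and> e \<in> block_edges k (int (c * k)) m \<and> \<omega> e = b" if "c \<in> ?C" for c
    proof -
      have "\<exists>e\<in>set (path_edges vs) \<inter> block_edges k (int (c * k)) m. \<omega> e \<noteq> a"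
      proof (rule ccontr)
        assume "\<not> ?thesis"
        then have "block_crossed a k (int (c * k)) m \<omega>"
          unfolding block_crossed_def using vs(1) fits[of c] that
          by (intro exI[of _ vs]) (auto simp: strip_paths_def)
        then show False using that by simp
      qed
      moreover have "\<omega> e = a \<or> \<omega> e = b" if "e \<in> block_edges k (int (c * k)) m" for e
        using weight_pmf_support[OF \<omega>(1), of e] sub[of c] that \<open>c \<in> ?C\<close> by auto
      ultimately show ?thesis by blast
    qed
    then have "\<forall>c\<in>?C. \<exists>e. e \<in> set (path_edges vs) \<and> e \<in> block_edges k (int (c * k)) m \<and> \<omega> e = b"
      by (intro ballI)
    from bchoice[OF this] obtain g where g: "\<And>c. c \<in> ?C \<Longrightarrow> g c \<in> set (path_edges vs) \<and> g c \<in> block_edges k (int (c * k)) m \<and> \<omega> (g c) = b"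
      by blast
    have "inj_on g ?C"
    proof (rule inj_onI)
      fix c c' assume "c \<in> ?C" "c' \<in> ?C" "g c = g c'"
      then have "g c \<in> block_edges k (int (c * k)) m \<inter> block_edges k (int (c' * k)) m"
        using g[of c] g[of c'] by simp
      then show "c = c'" using block_edges_disjoint[of c c' k m] by (cases "c = c'") auto
    qed
    moreover have "g ` ?C \<subseteq> {e \<in> set (path_edges vs). \<omega> e = b}"
      using g by (intro image_subsetI) simp
    ultimately have "card ?C \<le> card {e \<in> set (path_edges vs). \<omega> e = b}"
      by (intro card_inj_on_le) auto
    then show "\<omega> \<in> {\<omega>. real (card {c. c < ?J \<and> \<omega> \<in> ?V c}) < real ?J / 4}"
      using vs(2) by simp
  qed
  also have "\<dots> \<le> (9/10) ^ ?J"
    unfolding weight_pmf_def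
  proof (rule few_events_prob_bound[OF finite_edges_box, where S = "\<lambda>c. block_edges k (int (c * k)) m"])
    fix c assume c: "c < ?J"
    show "block_edges k (int (c * k)) m \<subseteq> edges_box n" by (rule sub[OF c])
    show "depends_on (block_edges k (int (c * k)) m) (\<lambda>\<omega>. \<omega> \<in> ?V c)"
      using depends_on_comp[OF depends_on_block_crossed, where h = Not] by simp
    have "pr ?W (?V c) = 1 - pr ?W {\<omega>. block_crossed a k (int (c * k)) m \<omega>}"
      using measure_pmf.prob_compl[of "{\<omega>. block_crossed a k (int (c * k)) m \<omega>}" ?W]
      by (simp add: Compl_eq_Diff_UNIV[symmetric] Collect_neg_eq)
    then show "1/2 \<le> pr (Pi_pmf (edges_box n) 0 (\<lambda>_. pmf_of_set {a, b})) (?V c)"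
      using prob_block_crossed_le_half[OF assms(1) sub[OF c]] by (simp add: weight_pmf_def)
  next
    fix c c' :: nat assume "c \<noteq> c'"
    then show "block_edges k (int (c * k)) m \<inter> block_edges k (int (c' * k)) m = {}"
      by (rule block_edges_disjoint)
  qed auto
  finally show ?thesis .
qed

text \<open>The events that the crossing time of one strip is at most, or below, \<open>q\<close>,
  phrased by a witnessing path instead of an infimum so that locality and monotonicity can be read
  off.\<close>

definition strip_le :: "nat \<Rightarrow> nat \<Rightarrow> real \<Rightarrow> int \<Rightarrow> config set" where
  "strip_le n k q m = {\<omega>. \<exists>vs\<in>strip_paths n k m. passage_time \<omega> vs \<le> q}"

definition strip_less :: "nat \<Rightarrow> nat \<Rightarrow> real \<Rightarrow> int \<Rightarrow> config set" where
  "strip_less n k q m = {\<omega>. \<exists>vs\<in>strip_paths n k m. passage_time \<omega> vs < q}"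

lemma passage_time_cong:
  "(\<And>e. e \<in> set (path_edges vs) \<Longrightarrow> \<omega> e = \<eta> e) \<Longrightarrow> passage_time \<omega> vs = passage_time \<eta> vs"
  unfolding passage_time_def by (intro arg_cong[where f = sum_list] map_cong) auto

lemma sum_list_strict_mono_ex:
  fixes f g :: "'a \<Rightarrow> real"
  assumes "\<And>x. x \<in> set xs \<Longrightarrow> f x \<le> g x" "y \<in> set xs" "f y < g y"
  shows "sum_list (map f xs) < sum_list (map g xs)"
  using assms
proof (induction xs)
  case (Cons x xs)
  have "sum_list (map f xs) \<le> sum_list (map g xs)"
    using Cons.prems by (intro sum_list_mono) auto
  moreover have "f x \<le> g x" using Cons.prems by simp
  moreover have "f x < g x \<or> sum_list (map f xs) < sum_list (map g xs)"
    using Cons by (cases "y = x") auto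
  ultimately show ?case by auto
qed simp

lemma depends_on_strip:
  "depends_on (strip_edges n k m) (\<lambda>\<omega>. \<omega> \<in> strip_le n k q m)"
  "depends_on (strip_edges n k m) (\<lambda>\<omega>. \<omega> \<in> strip_less n k q m)"
proof -
  have eq: "passage_time \<omega> vs = passage_time \<eta> vs"
    if "\<forall>e\<in>strip_edges n k m. \<omega> e = \<eta> e" "vs \<in> strip_paths n k m" for \<omega> \<eta> vs
    using that strip_path_edges by (intro passage_time_cong) blast
  show "depends_on (strip_edges n k m) (\<lambda>\<omega>. \<omega> \<in> strip_le n k q m)"
    unfolding depends_on_def strip_le_def mem_Collect_eq
    by (intro allI impI bex_cong refl) (simp only: eq)
  show "depends_on (strip_edges n k m) (\<lambda>\<omega>. \<omega> \<in> strip_less n k q m)"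
    unfolding depends_on_def strip_less_def mem_Collect_eq
    by (intro allI impI bex_cong refl) (simp only: eq)
qed

lemma passage_time_map: "passage_time \<omega> (map f vs) = passage_time (\<omega> \<circ> image f) vs"
  by (simp add: passage_time_def path_edges_map)

lemma strip_paths_shift:
  assumes "0 \<le> m" "m + int k \<le> int n"
  shows "strip_paths n k m = map (\<lambda>v. (fst v, snd v + m)) ` strip_paths n k 0"
proof -
  have shift: "map (\<lambda>v. (fst v, snd v + d)) vs \<in> strip_paths n k (m' + d)"
    if "vs \<in> strip_paths n k m'" "0 \<le> m' + d" "m' + d + int k \<le> int n" for vs m' d
  proof -
    have "successively adjacent (map (\<lambda>v. (fst v, snd v + d)) vs)"
      using that by (intro successively_map_adjacent) (auto simp: adjacent_def strip_paths_def)
    then show ?thesis using that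
      by (auto simp: strip_paths_def hd_map last_map in_box_def)
  qed
  show ?thesis
  proof (intro equalityI subsetI)
    fix vs assume vs: "vs \<in> strip_paths n k m"
    have "map (\<lambda>v. (fst v, snd v + - m)) vs \<in> strip_paths n k 0"
      using shift[OF vs, of "- m"] assms by simp
    moreover have "vs = map (\<lambda>v. (fst v, snd v + m)) (map (\<lambda>v. (fst v, snd v + - m)) vs)"
      by (simp add: o_def)
    ultimately show "vs \<in> map (\<lambda>v. (fst v, snd v + m)) ` strip_paths n k 0" by blast
  next
    fix vs assume "vs \<in> map (\<lambda>v. (fst v, snd v + m)) ` strip_paths n k 0"
    then show "vs \<in> strip_paths n k m" using shift[of _ 0 m] assms by auto
  qed
qed

lemma prob_strip_shift:
  assumes "0 \<le> m" "m + int k \<le> int n"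
  shows "pr (weight_pmf a b n) (strip_le n k q m) = pr (weight_pmf a b n) (strip_le n k q 0)"
    and "pr (weight_pmf a b n) (strip_less n k q m) = pr (weight_pmf a b n) (strip_less n k q 0)"
proof -
  let ?s = "\<lambda>v :: vertex. (fst v, snd v + m)"
  have eq: "strip_le n k q m = {\<omega>. \<omega> \<circ> image ?s \<in> strip_le n k q 0}"
    "strip_less n k q m = {\<omega>. \<omega> \<circ> image ?s \<in> strip_less n k q 0}"
    unfolding strip_le_def strip_less_def strip_paths_shift[OF assms] by (auto simp: passage_time_map)
  have inj: "inj_on (image ?s) (strip_edges n k 0)"
  proof (rule inj_onI)
    have "inj ?s" by (auto simp: inj_on_def)
    then show "A = B" if "?s ` A = ?s ` B" for A B using that by (simp add: inj_image_eq_iff)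
  qed
  have sub: "image ?s ` strip_edges n k 0 \<subseteq> edges_box n"
  proof
    fix e' assume "e' \<in> image ?s ` strip_edges n k 0"
    then obtain e where e: "e' = ?s ` e" "e \<in> edges_box n" "\<forall>v\<in>e. 0 \<le> snd v \<and> snd v < int k"
      by (auto simp: strip_edges_def)
    from e(2) show "e' \<in> edges_box n"
    proof (cases rule: edges_box_cases)
      case (1 i j)
      have "e' = hedge i (j + m)" by (auto simp: e(1) 1(1) hedge_def)
      moreover have "j < int k" using e(3) 1(1) by (auto simp: hedge_def)
      ultimately show ?thesis using 1 assms by (simp add: hedge_in_edges_box)
    next
      case (2 i j)
      have "e' = vedge i (j + m)" by (auto simp: e(1) 2(1) vedge_def)
      moreover have "j + 1 < int k" using e(3) 2(1) by (auto simp: vedge_def)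
      ultimately show ?thesis using 2 assms by (simp add: vedge_in_edges_box)
    qed
  qed
  show "pr (weight_pmf a b n) (strip_le n k q m) = pr (weight_pmf a b n) (strip_le n k q 0)"
    "pr (weight_pmf a b n) (strip_less n k q m) = pr (weight_pmf a b n) (strip_less n k q 0)"
    unfolding eq weight_pmf_def
    by (rule prob_Pi_pmf_reindex[OF finite_edges_box strip_edges_subset inj sub _ depends_on_strip(1)], simp)
      (rule prob_Pi_pmf_reindex[OF finite_edges_box strip_edges_subset inj sub _ depends_on_strip(2)], simp)
qed

lemma strip_atom_bound:
  assumes "a < b" "0 \<le> m" "m + int k \<le> int n" "1 \<le> k" "0 \<le> s"
  defines "g \<equiv> real (card (strip_edges n k m))"
  shows "real (n div k) / 4 * (pr (weight_pmf a b n) (strip_le n k q m - strip_less n k q m) - (9/10) ^ (n div k))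
    \<le> s * pr (weight_pmf a b n) (strip_less n k q m) + g * exp (- s\<^sup>2 / (2 * g))"
proof -
  let ?W = "weight_pmf a b n" and ?\<nu> = "real (n div k) / 4" and ?S = "strip_edges n k m"
  let ?A = "strip_le n k q m - strip_less n k q m" and ?D = "strip_less n k q m"
  define Bad where "Bad = {\<omega>. \<exists>vs\<in>strip_paths n k m. real (card {e \<in> set (path_edges vs). \<omega> e = b}) < ?\<nu>}"
  have "?\<nu> * pr ?W (?A - Bad) \<le> s * pr ?W ?D + g * exp (- s\<^sup>2 / (2 * g))"
    unfolding weight_pmf_def g_def
  proof (rule boundary_prob_bound[OF finite_edges_box strip_edges_subset])
    have "0 \<le> int n - 1" using assms by auto
    then have "hedge 0 m \<in> ?S"
      using assms hedge_in_edges_box[of 0 m n] by (auto simp: strip_edges_def hedge_def)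
    then show "?S \<noteq> {}" by auto
  next
    fix \<omega> :: config and e assume "\<omega> (e := b) \<in> ?D"
    then obtain vs where vs: "vs \<in> strip_paths n k m" "passage_time (\<omega> (e := b)) vs < q"
      by (auto simp: strip_less_def)
    have "passage_time (\<omega> (e := a)) vs \<le> passage_time (\<omega> (e := b)) vs"
      unfolding passage_time_def using assms(1) by (intro sum_list_mono) auto
    then show "\<omega> (e := a) \<in> ?D" using vs by (force simp: strip_less_def)
  next
    fix \<omega> assume \<omega>: "\<omega> \<in> ?A - Bad"
    then obtain vs where vs: "vs \<in> strip_paths n k m" "passage_time \<omega> vs \<le> q"
      by (auto simp: strip_le_def)
    have "?\<nu> \<le> real (card {e \<in> set (path_edges vs). \<omega> e = b})"
      using \<omega> vs(1) by (force simp: Bad_def)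
    also have "card {e \<in> set (path_edges vs). \<omega> e = b} \<le> card {e \<in> ?S. \<omega> e = b \<and> \<omega> \<notin> ?D \<and> \<omega> (e := a) \<in> ?D}"
    proof (rule card_mono)
      show "finite {e \<in> ?S. \<omega> e = b \<and> \<omega> \<notin> ?D \<and> \<omega> (e := a) \<in> ?D}"
        using finite_subset[OF strip_edges_subset finite_edges_box] by simp
      show "{e \<in> set (path_edges vs). \<omega> e = b} \<subseteq> {e \<in> ?S. \<omega> e = b \<and> \<omega> \<notin> ?D \<and> \<omega> (e := a) \<in> ?D}"
      proof
        fix e assume e: "e \<in> {e \<in> set (path_edges vs). \<omega> e = b}"
        \<comment> \<open>A path may traverse \<open>e\<close> several times; lowering its weight
          still strictly lowers the passage time, and \<open>e\<close> is counted once as an element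
          of the edge set.\<close>
        have "passage_time (\<omega> (e := a)) vs < passage_time \<omega> vs"
          unfolding passage_time_def using e assms(1) by (intro sum_list_strict_mono_ex[of _ _ _ e]) auto
        then have "\<omega> (e := a) \<in> ?D" using vs by (auto simp: strip_less_def intro!: bexI[of _ vs])
        then show "e \<in> {e \<in> ?S. \<omega> e = b \<and> \<omega> \<notin> ?D \<and> \<omega> (e := a) \<in> ?D}"
          using e \<omega> strip_path_edges[OF vs(1)] by auto
      qed
    qed
    finally show "?\<nu> \<le> real (card {e \<in> ?S. \<omega> e = b \<and> \<omega> \<notin> ?D \<and> \<omega> (e := a) \<in> ?D})" by simp
  qed (use assms in auto)
  moreover have "pr ?W ?A \<le> pr ?W (?A - Bad) + pr ?W Bad"
  proof -
    have "pr ?W ?A \<le> pr ?W ((?A - Bad) \<union> Bad)" by (intro measure_pmf.finite_measure_mono) auto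
    also have "\<dots> \<le> pr ?W (?A - Bad) + pr ?W Bad" by (rule measure_Un_le) auto
    finally show ?thesis .
  qed
  moreover have "pr ?W Bad \<le> (9/10) ^ (n div k)"
    unfolding Bad_def using assms by (intro few_heavy_edges_prob) auto
  ultimately have "pr ?W ?A - (9/10) ^ (n div k) \<le> pr ?W (?A - Bad)" by linarith
  then have "?\<nu> * (pr ?W ?A - (9/10) ^ (n div k)) \<le> ?\<nu> * pr ?W (?A - Bad)"
    by (intro mult_left_mono) auto
  also have "\<dots> \<le> s * pr ?W ?D + g * exp (- s\<^sup>2 / (2 * g))" by fact
  finally show ?thesis .
qed

section \<open>The restricted passage time as a minimum over strips\<close>

lemma paths_k_eq:
  assumes "1 \<le> k" "k \<le> n"
  shows "paths_k n k = (\<Union>m\<in>{0..int n - int k}. strip_paths n k m)"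
proof (intro equalityI subsetI)
  fix vs assume "vs \<in> paths_k n k"
  then obtain m where vs: "vs \<noteq> []" "successively adjacent vs" "\<forall>v\<in>set vs. in_box n v"
    "fst (hd vs) = 0" "fst (last vs) = int n" and m: "\<forall>v\<in>set vs. m \<le> snd v \<and> snd v \<le> m + int k - 1"
    by (auto simp: paths_k_def successively_conv_nth)
  \<comment> \<open>The offset \<open>m\<close> is an arbitrary integer. Clamping it to
    \<open>[0, n - k]\<close> keeps the path inside the strip because the path already lies in the
    box.\<close>
  define m' where "m' = max 0 (min m (int n - int k))"
  have "\<forall>v\<in>set vs. m' \<le> snd v \<and> snd v < m' + int k"
    using vs(3) m by (fastforce simp: m'_def in_box_def)
  then have "vs \<in> strip_paths n k m'" using vs by (simp add: strip_paths_def)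
  moreover have "m' \<in> {0..int n - int k}" using assms by (auto simp: m'_def)
  ultimately show "vs \<in> (\<Union>m\<in>{0..int n - int k}. strip_paths n k m)" by blast
next
  fix vs assume "vs \<in> (\<Union>m\<in>{0..int n - int k}. strip_paths n k m)"
  then show "vs \<in> paths_k n k"
    by (force simp: paths_k_def strip_paths_def successively_conv_nth)
qed

lemma paths_k_nonempty:
  assumes "1 \<le> k" "k \<le> n"
  shows "paths_k n k \<noteq> {}"
proof -
  let ?vs = "map (\<lambda>i. (int i, 0 :: int)) [0..<Suc n]"
  have "?vs \<in> paths_k n k"
    unfolding paths_k_def mem_Collect_eq
  proof (intro conjI exI[of _ 0] allI impI)
    fix i assume "Suc i < length ?vs"
    then show "adjacent (?vs ! i) (?vs ! Suc i)"
      by (simp add: adjacent_def del: upt_Suc)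
  qed (use assms in \<open>auto simp: in_box_def hd_map last_map simp del: upt_Suc\<close>)
  then show ?thesis by blast
qed

lemma passage_time_ge:
  assumes "\<And>e. e \<in> set (path_edges vs) \<Longrightarrow> a \<le> \<omega> e"
  shows "a * real (length vs - 1) \<le> passage_time \<omega> vs"
proof -
  have "a * real (length vs - 1) = sum_list (map (\<lambda>_. a) (path_edges vs))"
    by (simp add: sum_list_triv length_path_edges)
  also have "\<dots> \<le> passage_time \<omega> vs"
    unfolding passage_time_def using assms by (intro sum_list_mono) auto
  finally show ?thesis .
qed

lemma tau_iff:
  assumes "0 < a" "a < b" "1 \<le> k" "k \<le> n" "\<omega> \<in> set_pmf (weight_pmf a b n)"
  shows "tau n k \<omega> < q \<longleftrightarrow> (\<exists>m\<in>{0..int n - int k}. \<omega> \<in> strip_less n k q m)"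
    and "tau n k \<omega> \<le> q \<longleftrightarrow> (\<exists>m\<in>{0..int n - int k}. \<omega> \<in> strip_le n k q m)"
proof -
  let ?T = "passage_time \<omega> ` paths_k n k"
  have ge: "a * real (length vs - 1) \<le> passage_time \<omega> vs" if vs: "vs \<in> paths_k n k" for vs
  proof (rule passage_time_ge)
    fix e assume e: "e \<in> set (path_edges vs)"
    obtain m where "vs \<in> strip_paths n k m"
      using vs unfolding paths_k_eq[OF assms(3,4)] by blast
    then have "e \<in> edges_box n" using e strip_path_edges strip_edges_subset by blast
    then show "a \<le> \<omega> e" using weight_pmf_support[OF assms(5), of e] assms(2) by auto
  qed
  have ne: "?T \<noteq> {}" using paths_k_nonempty[OF assms(3,4)] by simp
  have bdd: "bdd_below ?T"
  proof (rule bdd_belowI2)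
    fix vs assume "vs \<in> paths_k n k"
    then show "0 \<le> passage_time \<omega> vs"
      using ge[of vs] assms(1) by (smt (verit) mult_nonneg_nonneg of_nat_0_le_iff)
  qed
  show less: "tau n k \<omega> < q \<longleftrightarrow> (\<exists>m\<in>{0..int n - int k}. \<omega> \<in> strip_less n k q m)" for q
  proof -
    have "tau n k \<omega> < q \<longleftrightarrow> (\<exists>t\<in>?T. t < q)"
      unfolding tau_def by (rule cInf_less_iff[OF ne bdd])
    then show ?thesis
      unfolding paths_k_eq[OF assms(3,4)] strip_less_def by blast
  qed
  have attained: "\<exists>vs\<in>paths_k n k. passage_time \<omega> vs \<le> tau n k \<omega>"
  proof -
    obtain v0 where v0: "v0 \<in> paths_k n k" using ne by auto
    \<comment> \<open>Infinitely many paths compete, since they may revisit vertices. As every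
      weight is at least \<open>a > 0\<close>, those no slower than \<open>v0\<close> have bounded
      length, which leaves finitely many and makes the infimum a minimum.\<close>
    define L where "L = {vs \<in> paths_k n k. passage_time \<omega> vs \<le> passage_time \<omega> v0}"
    have "L \<subseteq> {vs. set vs \<subseteq> {v. in_box n v} \<and> length vs \<le> nat \<lceil>passage_time \<omega> v0 / a\<rceil> + 1}"
    proof
      fix vs assume vs: "vs \<in> L"
      then have "a * real (length vs - 1) \<le> passage_time \<omega> v0" using ge[of vs] by (simp add: L_def)
      then have "real (length vs - 1) \<le> passage_time \<omega> v0 / a"
        using assms(1) by (simp add: field_simps)
      then have "length vs - 1 \<le> nat \<lceil>passage_time \<omega> v0 / a\<rceil>" by linarith
      then show "vs \<in> {vs. set vs \<subseteq> {v. in_box n v} \<and> length vs \<le> nat \<lceil>passage_time \<omega> v0 / a\<rceil> + 1}"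
        using vs by (auto simp: L_def paths_k_def)
    qed
    then have fin: "finite L" using finite_lists_length_le[OF finite_in_box] finite_subset by blast
    have "L \<noteq> {}" using v0 by (auto simp: L_def)
    then obtain v where v: "v \<in> L" "\<And>w. w \<in> L \<Longrightarrow> passage_time \<omega> v \<le> passage_time \<omega> w"
      using arg_min_if_finite(1)[OF fin, of "passage_time \<omega>"] arg_min_least[OF fin, of _ "passage_time \<omega>"]
      by metis
    have "passage_time \<omega> v \<le> passage_time \<omega> w" if "w \<in> paths_k n k" for w
      using v that by (cases "w \<in> L") (auto simp: L_def intro: order_trans)
    then have "passage_time \<omega> v \<le> tau n k \<omega>"
      unfolding tau_def by (intro cInf_greatest[OF ne]) auto
    then show ?thesis using v(1) by (auto simp: L_def)
  qed
  show "tau n k \<omega> \<le> q \<longleftrightarrow> (\<exists>m\<in>{0..int n - int k}. \<omega> \<in> strip_le n k q m)"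
  proof
    assume "tau n k \<omega> \<le> q"
    then obtain vs where "vs \<in> paths_k n k" "passage_time \<omega> vs \<le> q" using attained by auto
    then show "\<exists>m\<in>{0..int n - int k}. \<omega> \<in> strip_le n k q m"
      unfolding paths_k_eq[OF assms(3,4)] strip_le_def by blast
  next
    assume "\<exists>m\<in>{0..int n - int k}. \<omega> \<in> strip_le n k q m"
    then obtain vs where vs: "vs \<in> paths_k n k" "passage_time \<omega> vs \<le> q"
      unfolding paths_k_eq[OF assms(3,4)] strip_le_def by blast
    then have "tau n k \<omega> \<le> passage_time \<omega> vs"
      unfolding tau_def by (intro cInf_lower bdd) auto
    then show "tau n k \<omega> \<le> q" using vs(2) by simp
  qed
qed

section \<open>Quantitative bounds and conclusion\<close>

lemma real_div_ge_half:
  assumes "1 \<le> k" "k \<le> n"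
  shows "real n / (2 * real k) \<le> real (n div k)" "0 < real (n div k)"
proof -
  have "1 \<le> n div k" using assms by (simp add: Suc_le_eq div_greater_zero_iff)
  then show "0 < real (n div k)" by simp
  have "n = n div k * k + n mod k" by simp
  also have "\<dots> \<le> n div k * k + k"
    using assms mod_less_divisor[of k n] by (intro add_left_mono) simp
  also have "\<dots> \<le> n div k * k + n div k * k" using \<open>1 \<le> n div k\<close> by simp
  finally have "real n \<le> real (n div k * k + n div k * k)" by (simp only: of_nat_le_iff)
  then show "real n / (2 * real k) \<le> real (n div k)"
    using assms by (simp add: field_simps)
qed

lemma strip_edges_disjoint:
  assumes "i \<noteq> i'"
  shows "strip_edges n k (int (i * k)) \<inter> strip_edges n k (int (i' * k)) = {}"
proof (rule ccontr)
  assume "\<not> ?thesis"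
  then obtain e where e: "e \<in> strip_edges n k (int (i * k))" "e \<in> strip_edges n k (int (i' * k))" by blast
  have "e \<noteq> {}" using e(1) by (auto simp: strip_edges_def edges_box_def)
  then obtain v where "v \<in> e" by blast
  then have v: "int (i * k) \<le> snd v" "snd v < int (i * k) + int k" "int (i' * k) \<le> snd v" "snd v < int (i' * k) + int k"
    using e by (auto simp: strip_edges_def)
  define d where "d = nat (snd v)"
  have "0 \<le> snd v" using v(1) by (rule order_trans[rotated]) simp
  then have "snd v = int d" by (simp add: d_def)
  then have "i * k \<le> d" "d < i * k + k" "i' * k \<le> d" "d < i' * k + k"
    using v by linarith+
  then have "d div k = i" "d div k = i'"
    by (auto intro!: div_nat_eqI simp: mult.commute)
  then show False using assms by simp
qed

text \<open>The strips at heights that are multiples of \<open>k\<close> are disjoint and, by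
  translation, equally likely to be fast. The strict version of \<open>A\<close> serves the atom
  estimate, the other one the noise estimate.\<close>

lemma strip_prob_bound:
  assumes "1 \<le> k" "k \<le> n" "0 < c"
    and A: "A = strip_le n k q \<or> A = strip_less n k q"
    and c: "c \<le> pr (weight_pmf a b n) {\<omega>. \<forall>m\<in>{0..int n - int k}. \<omega> \<notin> A m}"
  shows "real (n div k) * pr (weight_pmf a b n) (A 0) \<le> - ln c"
proof -
  let ?W = "weight_pmf a b n" and ?J = "n div k"
  have fits: "int (i * k) + int k \<le> int n" if "i < ?J" for i
  proof -
    have "Suc i * k \<le> ?J * k" using that by (intro mult_right_mono) auto
    also have "\<dots> \<le> n" by simp
    finally have "int (Suc i * k) \<le> int n" by (simp only: of_nat_le_iff)
    then show ?thesis by (simp add: algebra_simps)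
  qed
  have "(\<Sum>i<?J. pr ?W (A (int (i * k)))) \<le> - ln c"
    unfolding weight_pmf_def
  proof (rule sum_prob_le_ln_prob_none[OF finite_edges_box, where S = "\<lambda>i. strip_edges n k (int (i * k))"])
    show "depends_on (strip_edges n k (int (i * k))) (\<lambda>\<omega>. \<omega> \<in> A (int (i * k)))" for i
      using A depends_on_strip by blast
    have "c \<le> pr ?W {\<omega>. \<forall>m\<in>{0..int n - int k}. \<omega> \<notin> A m}" by fact
    also have "\<dots> \<le> pr ?W {\<omega>. \<forall>i\<in>{..<?J}. \<omega> \<notin> A (int (i * k))}"
      using fits by (intro measure_pmf.finite_measure_mono) fastforce+
    finally show "c \<le> pr (Pi_pmf (edges_box n) 0 (\<lambda>_. pmf_of_set {a, b})) {\<omega>. \<forall>i\<in>{..<?J}. \<omega> \<notin> A (int (i * k))}"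
      by (simp add: weight_pmf_def)
  qed (use strip_edges_disjoint strip_edges_subset assms in auto)
  moreover have "pr ?W (A (int (i * k))) = pr ?W (A 0)" if "i < ?J" for i
    using A fits[OF that] prob_strip_shift[of "int (i * k)" k n a b q] by auto
  ultimately show ?thesis by simp
qed

lemma atom_prob_bound:
  assumes "a < b" "1 \<le> k" "k \<le> n" "0 < c" "c \<le> 1" "0 \<le> s"
    and c: "c \<le> pr (weight_pmf a b n) {\<omega>. \<forall>m\<in>{0..int n - int k}. \<omega> \<notin> strip_less n k q m}"
  shows "pr (weight_pmf a b n) {\<omega>. (\<exists>m\<in>{0..int n - int k}. \<omega> \<in> strip_le n k q m) \<and>
      (\<forall>m\<in>{0..int n - int k}. \<omega> \<notin> strip_less n k q m)}
    \<le> real n * ((9/10) ^ (n div k) + 16 * s * - ln c * (real k)\<^sup>2 / (real n)\<^sup>2 + 32 * (real k)\<^sup>2 * exp (- s\<^sup>2 / (8 * real n * real k)))"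
proof -
  let ?W = "weight_pmf a b n" and ?J = "real (n div k)" and ?M = "{0..int n - int k}"
  let ?B = "(9/10) ^ (n div k) + 16 * s * - ln c * (real k)\<^sup>2 / (real n)\<^sup>2 + 32 * (real k)\<^sup>2 * exp (- s\<^sup>2 / (8 * real n * real k))"
  have kn: "0 < real k" "0 < real n" using assms by auto
  note J = real_div_ge_half[OF assms(2,3)]
  have C: "0 \<le> - ln c" using assms by simp
  have invJ: "1 / ?J \<le> 2 * real k / real n"
    using J kn by (simp add: field_simps)
  have each: "pr ?W (strip_le n k q m - strip_less n k q m) \<le> ?B" if m: "m \<in> ?M" for m
  proof -
    define p where "p = pr ?W (strip_less n k q m)"
    define g where "g = real (card (strip_edges n k m))"
    have m': "0 \<le> m" "m + int k \<le> int n" using m by auto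
    have p: "?J * p \<le> - ln c"
      unfolding p_def prob_strip_shift(2)[OF m'] by (rule strip_prob_bound[OF assms(2,3,4) _ c, where q = q]) simp
    have "hedge 0 m \<in> strip_edges n k m"
      using assms(2,3) m' hedge_in_edges_box[of 0 m n] by (auto simp: strip_edges_def hedge_def)
    then have g0: "0 < g"
      unfolding g_def using finite_subset[OF strip_edges_subset finite_edges_box, of n k m]
      by (simp add: card_gt_0_iff) blast
    have "g \<le> real (2 * (n + 1) * k)"
      unfolding g_def by (simp only: of_nat_le_iff card_strip_edges)
    also have "\<dots> \<le> real (2 * (n + n) * k)"
      using assms by (intro of_nat_mono mult_right_mono mult_left_mono) auto
    finally have g: "g \<le> 4 * real n * real k" by simp
    have "pr ?W (strip_le n k q m - strip_less n k q m) - (9/10) ^ (n div k) \<le> (s * p + g * exp (- s\<^sup>2 / (2 * g))) * (4 * (1 / ?J))"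
      using strip_atom_bound[OF assms(1) m' assms(2,6), of q] J by (simp add: p_def g_def field_simps)
    \<comment> \<open>Multiplying and dividing by \<open>?J\<close> exposes \<open>?J * p\<close>,
      which is bounded by \<open>- ln c\<close>; this yields the square of \<open>1 / ?J\<close>,
      hence \<open>k^2 / n^2\<close>.\<close>
    also have "\<dots> = 4 * s * (?J * p) * (1 / ?J)\<^sup>2 + 4 * (g * exp (- s\<^sup>2 / (2 * g))) * (1 / ?J)"
      using J by (simp add: field_simps power2_eq_square)
    also have "\<dots> \<le> 4 * s * (- ln c) * (2 * real k / real n)\<^sup>2 +
        4 * (4 * real n * real k * exp (- s\<^sup>2 / (2 * (4 * real n * real k)))) * (2 * real k / real n)"
    proof (intro add_mono mult_mono power_mono)
      show "exp (- s\<^sup>2 / (2 * g)) \<le> exp (- s\<^sup>2 / (2 * (4 * real n * real k)))"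
        using g g0 kn by (subst exp_le_cancel_iff) (auto intro!: divide_left_mono mult_pos_pos simp: mult_ac)
      show "0 \<le> 4 * s * - ln c" using C assms(6) by (intro mult_nonneg_nonneg) auto
    qed (use p g g0 invJ J kn C assms in \<open>auto simp: p_def\<close>)
    also have "\<dots> = 16 * s * - ln c * (real k)\<^sup>2 / (real n)\<^sup>2 + 32 * (real k)\<^sup>2 * exp (- s\<^sup>2 / (8 * real n * real k))"
      using kn by (simp add: field_simps power2_eq_square)
    finally show ?thesis by simp
  qed
  have "pr ?W {\<omega>. (\<exists>m\<in>?M. \<omega> \<in> strip_le n k q m) \<and> (\<forall>m\<in>?M. \<omega> \<notin> strip_less n k q m)}
      \<le> pr ?W (\<Union>m\<in>?M. strip_le n k q m - strip_less n k q m)"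
    by (intro measure_pmf.finite_measure_mono) auto
  also have "\<dots> \<le> (\<Sum>m\<in>?M. pr ?W (strip_le n k q m - strip_less n k q m))"
    by (intro measure_pmf.finite_measure_subadditive_finite) auto
  also have "\<dots> \<le> (\<Sum>m\<in>?M. ?B)"
    by (intro sum_mono each)
  also have "\<dots> = real (n - k + 1) * ?B"
    using assms by (simp add: nat_diff_distrib' of_nat_diff)
  also have "\<dots> \<le> n * ?B"
  proof (rule mult_right_mono)
    show "0 \<le> ?B" using C assms(6)
      by (intro add_nonneg_nonneg divide_nonneg_nonneg mult_nonneg_nonneg) auto
  qed (use assms in auto)
  finally show ?thesis .
qed

lemma sum_adjacent:
  fixes u :: "nat \<Rightarrow> real"
  shows "(\<Sum>j\<le>N. \<Sum>i\<in>{i. i < N \<and> (i = j \<or> Suc i = j)}. u i) = 2 * (\<Sum>i<N. u i)"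
proof -
  have "(\<Sum>j\<le>N. \<Sum>i\<in>{i. i < N \<and> (i = j \<or> Suc i = j)}. u i) = (\<Sum>j\<le>N. \<Sum>i\<in>{i\<in>{..<N}. i = j \<or> Suc i = j}. u i)"
    by (intro sum.cong) auto
  also have "\<dots> = (\<Sum>i<N. \<Sum>j\<in>{j\<in>{..N}. i = j \<or> Suc i = j}. u i)"
    by (rule sum.swap_restrict) auto
  also have "\<dots> = (\<Sum>i<N. 2 * u i)"
  proof (rule sum.cong[OF refl])
    fix i assume "i \<in> {..<N}"
    then have "{j\<in>{..N}. i = j \<or> Suc i = j} = {i, Suc i}" by auto
    then show "(\<Sum>j\<in>{j\<in>{..N}. i = j \<or> Suc i = j}. u i) = 2 * u i" by simp
  qed
  finally show ?thesis by (simp add: sum_distrib_left)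
qed

text \<open>A strip of \<open>k\<close> rows starting in row block \<open>i\<close> meets only
  blocks \<open>i\<close> and \<open>i + 1\<close>, so the unions \<open>U i\<close> fit
  \<open>noise_covariance_bound\<close>. Each joins at most \<open>k\<close> strips of probability
  \<open>O(k / n)\<close>, whence the smallness parameter \<open>k^2 / n\<close>.\<close>

lemma noise_covariance_strips:
  fixes a b q r0 c :: real and n k :: nat
  defines "f \<equiv> \<lambda>\<omega>. of_bool (\<forall>m\<in>{0..int n - int k}. \<omega> \<notin> strip_le n k q m) :: real"
  assumes "a < b" "1 \<le> k" "k \<le> n" "0 < c" "c \<le> 1" "0 < r0" "r0 \<le> 1"
    and c: "c \<le> pr (weight_pmf a b n) {\<omega>. \<forall>m\<in>{0..int n - int k}. \<omega> \<notin> strip_le n k q m}"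
  shows "\<bar>expect (noisy (pmf_of_set {a, b}) (\<lambda>_. r0) (edges_box n) 0) (\<lambda>z. f (fst \<circ> z) * f (snd \<circ> z)) -
      (expect (weight_pmf a b n) f)\<^sup>2\<bar> \<le> 4 * - ln c * (4 * - ln c * (real k)\<^sup>2 / real n) powr (2 / (2 - r0) - 1)"
proof -
  let ?W = "weight_pmf a b n" and ?M = "{0..int n - int k}" and ?t = "2 / (2 - r0)"
  let ?E = "edges_box n"
  define N where "N = n div k + 1"
  define U where "U = (\<lambda>i. \<Union>m\<in>{m\<in>?M. nat m div k = i}. strip_le n k q m)"
  \<comment> \<open>A vertical edge joining two row blocks is assigned to the block of its lower
    endpoint.\<close>
  define blk where "blk = (\<lambda>e :: edge. nat (Min (snd ` e)) div k)"
  define B where "B = (\<lambda>j. \<Union>i\<in>{i. i < N \<and> (i = j \<or> Suc i = j)}. U i)"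
  define S where "S = (\<lambda>i. {e \<in> ?E. blk e = i \<or> blk e = Suc i})"
  have kn: "0 < real k" "0 < real n" using assms by auto
  note J = real_div_ge_half[OF assms(3,4)]
  have C: "0 \<le> - ln c" using assms by simp
  have all: "(\<forall>i<N. \<omega> \<notin> U i) \<longleftrightarrow> (\<forall>m\<in>?M. \<omega> \<notin> strip_le n k q m)" for \<omega>
  proof -
    have "nat m div k < N" if "m \<in> ?M" for m
      using that by (auto simp: N_def less_Suc_eq_le intro!: div_le_mono)
    then have "\<omega> \<in> U (nat m div k) \<and> nat m div k < N" if "m \<in> ?M" "\<omega> \<in> strip_le n k q m" for m
      using that unfolding U_def by blast
    moreover have "\<exists>m\<in>?M. \<omega> \<in> strip_le n k q m" if "\<omega> \<in> U i" for i
      using that unfolding U_def by blast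
    ultimately show ?thesis by metis
  qed
  have dep: "depends_on (S i) (\<lambda>\<omega>. \<omega> \<in> U i)" for i
  proof -
    have "depends_on (S i) (\<lambda>\<omega>. \<omega> \<in> strip_le n k q m)" if m: "m \<in> ?M" "nat m div k = i" for m
    proof (rule depends_on_mono[OF depends_on_strip(1)], rule subsetI)
      fix e assume e: "e \<in> strip_edges n k m"
      have fe: "finite e" "e \<noteq> {}" using e by (auto simp: strip_edges_def edges_box_def)
      then have "Min (snd ` e) \<in> snd ` e" by (intro Min_in) auto
      then have "m \<le> Min (snd ` e)" "Min (snd ` e) < m + int k"
        using e by (auto simp: strip_edges_def)
      then have "nat m \<le> nat (Min (snd ` e))" "nat (Min (snd ` e)) \<le> nat m + k"
        using m by auto
      then have "nat m div k \<le> blk e" "blk e \<le> (nat m + k) div k"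
        unfolding blk_def by (auto intro: div_le_mono)
      moreover have "(nat m + k) div k = Suc (nat m div k)" using assms(3) by simp
      ultimately show "e \<in> S i" using e m by (auto simp: S_def strip_edges_def)
    qed
    then have "\<omega> \<in> U i \<longleftrightarrow> \<eta> \<in> U i" if "\<forall>e\<in>S i. \<omega> e = \<eta> e" for \<omega> \<eta>
      using that unfolding U_def depends_on_def by blast
    then show ?thesis unfolding depends_on_def by blast
  qed
  have blkN: "blk e \<le> N" if "e \<in> ?E" for e
  proof -
    have fe: "finite e" "e \<noteq> {}" using that by (auto simp: edges_box_def)
    then have "Min (snd ` e) \<in> snd ` e" by (intro Min_in) auto
    then have "Min (snd ` e) \<le> int n" using that by (auto simp: edges_box_def in_box_def)
    then have "nat (Min (snd ` e)) div k \<le> n div k" by (intro div_le_mono) auto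
    then show ?thesis by (simp add: blk_def N_def)
  qed
  define p where "p = pr ?W (strip_le n k q 0)"
  define \<delta> where "\<delta> = 2 * - ln c * (real k)\<^sup>2 / real n"
  have p: "p \<le> - ln c * (2 * real k / real n)"
  proof -
    have "real (n div k) * p \<le> - ln c"
      unfolding p_def by (rule strip_prob_bound[OF assms(3,4,5) _ c, where q = q]) simp
    then have "p \<le> - ln c * (1 / real (n div k))"
      using J by (simp add: field_simps)
    also have "\<dots> \<le> - ln c * (2 * real k / real n)"
      using J kn C by (intro mult_left_mono) (auto simp: field_simps)
    finally show ?thesis .
  qed
  have Udelta: "pr ?W (U i) \<le> \<delta>" for i
  proof -
    let ?Mi = "{m\<in>?M. nat m div k = i}"
    have "finite ?Mi" by (rule finite_subset[of _ ?M]) auto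
    have "?Mi \<subseteq> int ` {i * k..<i * k + k}"
    proof
      fix m assume m: "m \<in> ?Mi"
      then have "i = nat m div k" by simp
      then have "i * k \<le> nat m" "nat m < i * k + k"
        using assms(3) dividend_less_div_times[of k "nat m"] by (auto simp: add.commute)
      then show "m \<in> int ` {i * k..<i * k + k}" using m by (intro image_eqI[of _ _ "nat m"]) auto
    qed
    then have "card ?Mi \<le> card (int ` {i * k..<i * k + k})" by (intro card_mono) auto
    also have "\<dots> = k" by (simp add: card_image)
    finally have card: "card ?Mi \<le> k" .
    have "pr ?W (U i) \<le> (\<Sum>m\<in>?Mi. pr ?W (strip_le n k q m))"
      unfolding U_def using \<open>finite ?Mi\<close> by (intro measure_pmf.finite_measure_subadditive_finite) auto
    also have "\<dots> = (\<Sum>m\<in>?Mi. p)"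
      unfolding p_def by (intro sum.cong refl prob_strip_shift) auto
    also have "\<dots> \<le> real k * p"
      using card by (simp add: p_def mult_right_mono)
    also have "\<dots> \<le> real k * (- ln c * (2 * real k / real n))"
      using p by (intro mult_left_mono) auto
    also have "\<dots> = \<delta>" by (simp add: \<delta>_def power2_eq_square)
    finally show ?thesis .
  qed
  \<comment> \<open>Groups whose indices differ by at least 2 read disjoint edge sets; the even and
    the odd indices are two such families.\<close>
  have half: "(\<Sum>i\<in>I. pr ?W (U i)) \<le> - ln c"
    if "I \<subseteq> {..<N}" "\<And>i i'. i \<in> I \<Longrightarrow> i' \<in> I \<Longrightarrow> i \<noteq> i' \<Longrightarrow> Suc i \<noteq> i'" for I
    unfolding weight_pmf_def
  proof (rule sum_prob_le_ln_prob_none[OF finite_edges_box, where S = S])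
    have "c \<le> pr ?W {\<omega>. \<forall>i<N. \<omega> \<notin> U i}" using c by (simp add: all)
    also have "\<dots> \<le> pr ?W {\<omega>. \<forall>i\<in>I. \<omega> \<notin> U i}"
      using that by (intro measure_pmf.finite_measure_mono) auto
    finally show "c \<le> pr (Pi_pmf ?E 0 (\<lambda>_. pmf_of_set {a, b})) {\<omega>. \<forall>i\<in>I. \<omega> \<notin> U i}"
      by (simp add: weight_pmf_def)
    show "S i \<inter> S i' = {}" if "i \<in> I" "i' \<in> I" "i \<noteq> i'" for i i'
      using \<open>\<And>i i'. i \<in> I \<Longrightarrow> i' \<in> I \<Longrightarrow> i \<noteq> i' \<Longrightarrow> Suc i \<noteq> i'\<close>[of i i']
        \<open>\<And>i i'. i \<in> I \<Longrightarrow> i' \<in> I \<Longrightarrow> i \<noteq> i' \<Longrightarrow> Suc i \<noteq> i'\<close>[of i' i] that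
      by (auto simp: S_def)
    show "finite I" using that finite_subset by blast
  qed (use assms dep in \<open>auto simp: S_def\<close>)
  have "(\<Sum>i<N. pr ?W (U i)) = (\<Sum>i\<in>{i\<in>{..<N}. even i}. pr ?W (U i)) + (\<Sum>i\<in>{i\<in>{..<N}. \<not> even i}. pr ?W (U i))"
    by (subst sum.union_disjoint[symmetric]) (auto intro!: sum.cong)
  also have "\<dots> \<le> - ln c + - ln c"
  proof (intro add_mono half)
    fix i i' assume "i \<in> {i \<in> {..<N}. even i}" "i' \<in> {i \<in> {..<N}. even i}"
    then show "Suc i \<noteq> i'" by auto
  next
    fix i i' assume "i \<in> {i \<in> {..<N}. odd i}" "i' \<in> {i \<in> {..<N}. odd i}"
    then show "Suc i \<noteq> i'" by auto
  qed auto
  finally have sumU: "(\<Sum>i<N. pr ?W (U i)) \<le> 2 * - ln c" by simp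
  have Bsum: "pr ?W (B j) \<le> (\<Sum>i\<in>{i. i < N \<and> (i = j \<or> Suc i = j)}. pr ?W (U i))" for j
    unfolding B_def by (intro measure_pmf.finite_measure_subadditive_finite) auto
  have Bdelta: "pr ?W (B j) \<le> 2 * \<delta>" for j
  proof -
    have "0 \<le> \<delta>" unfolding \<delta>_def using C by (intro divide_nonneg_nonneg mult_nonneg_nonneg) auto
    have "card {i. i < N \<and> (i = j \<or> Suc i = j)} \<le> card {j, j - 1}"
      by (intro card_mono) auto
    also have "\<dots> \<le> 2" by (simp add: card_insert_if)
    finally have card2: "card {i. i < N \<and> (i = j \<or> Suc i = j)} \<le> 2" .
    note Bsum[of j]
    also have "(\<Sum>i\<in>{i. i < N \<and> (i = j \<or> Suc i = j)}. pr ?W (U i)) \<le> real (card {i. i < N \<and> (i = j \<or> Suc i = j)}) * \<delta>"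
      by (intro sum_bounded_above Udelta)
    also have "\<dots> \<le> 2 * \<delta>"
      using card2 \<open>0 \<le> \<delta>\<close> by (intro mult_right_mono) auto
    finally show ?thesis .
  qed
  have t: "1 \<le> ?t" using assms by (simp add: field_simps)
  have "\<bar>expect (noisy (pmf_of_set {a, b}) (\<lambda>_. r0) ?E 0) (\<lambda>z. f (fst \<circ> z) * f (snd \<circ> z)) - (expect ?W f)\<^sup>2\<bar>
      \<le> (\<Sum>j\<le>N. pr ?W (B j) powr ?t)"
    unfolding f_def all[symmetric] weight_pmf_def B_def
    using finite_edges_box assms dep blkN unfolding S_def by (intro noise_covariance_bound[where blk = blk]) auto
  \<comment> \<open>One factor \<open>P(B j)\<close> is kept for the bounded sum, and the surplus
    power is replaced by its uniform bound.\<close>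
  also have "\<dots> \<le> (\<Sum>j\<le>N. (2 * \<delta>) powr (?t - 1) * pr ?W (B j))"
  proof (rule sum_mono)
    fix j
    have "pr ?W (B j) powr ?t = pr ?W (B j) powr (?t - 1) * pr ?W (B j)"
      using powr_add[of "pr ?W (B j)" "?t - 1" 1] by simp
    also have "\<dots> \<le> (2 * \<delta>) powr (?t - 1) * pr ?W (B j)"
      using t Bdelta by (intro mult_right_mono powr_mono2) auto
    finally show "pr ?W (B j) powr ?t \<le> (2 * \<delta>) powr (?t - 1) * pr ?W (B j)" .
  qed
  also have "\<dots> = (2 * \<delta>) powr (?t - 1) * (\<Sum>j\<le>N. pr ?W (B j))"
    by (simp add: sum_distrib_left)
  also have "\<dots> \<le> (2 * \<delta>) powr (?t - 1) * (2 * (2 * - ln c))"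
  proof (rule mult_left_mono)
    have "(\<Sum>j\<le>N. pr ?W (B j)) \<le> 2 * (\<Sum>i<N. pr ?W (U i))"
      unfolding sum_adjacent[symmetric] by (intro sum_mono Bsum)
    then show "(\<Sum>j\<le>N. pr ?W (B j)) \<le> 2 * (2 * - ln c)" using sumU by simp
  qed simp
  also have "2 * \<delta> = 4 * - ln c * (real k)\<^sup>2 / real n" by (simp add: \<delta>_def)
  finally show ?thesis by (simp only: mult_ac)
qed

text \<open>Noise sensitivity ranges over all \<open>\<epsilon> > 0\<close>, and
  \<open>bernoulli_pmf\<close> truncates its parameter to \<open>[0, 1]\<close>. This reduces
  \<open>\<epsilon> > 1\<close> to full resampling.\<close>

lemma bernoulli_pmf_min_1: "bernoulli_pmf (min 1 p) = bernoulli_pmf p"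
  by (rule pmf_eqI) (simp add: bernoulli_pmf.rep_eq min_def max_def)

lemma noisy_pair_expectation:
  assumes "a \<noteq> b"
  shows "expect (noisy_pair_pmf a b n \<epsilon>) (\<lambda>(\<omega>, \<eta>). F \<omega> * F \<eta>) =
    expect (noisy (pmf_of_set {a, b}) (\<lambda>_. min 1 \<epsilon>) (edges_box n) 0) (\<lambda>z. F (fst \<circ> z) * F (snd \<circ> z))"
proof -
  have fin: "finite (set_pmf (resample_pmf a b n \<epsilon> \<omega>))" for \<omega>
    unfolding resample_pmf_def by (intro finite_set_Pi_pmf finite_edges_box) (auto split: if_splits)
  have "expect (noisy_pair_pmf a b n \<epsilon>) (\<lambda>(\<omega>, \<eta>). F \<omega> * F \<eta>) =
      expect (weight_pmf a b n) (\<lambda>\<omega>. F \<omega> * expect (resample_pmf a b n \<epsilon> \<omega>) F)"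
    unfolding noisy_pair_pmf_def using finite_set_weight_pmf fin
    by (subst expectation_bind_pmf) auto
  also have "\<dots> = expect (noisy (pmf_of_set {a, b}) (\<lambda>_. min 1 \<epsilon>) (edges_box n) 0) (\<lambda>z. F (fst \<circ> z) * F (snd \<circ> z))"
    by (subst expectation_noisy[OF finite_edges_box])
      (simp_all add: weight_pmf_def resample_pmf_def bernoulli_pmf_min_1)
  finally show ?thesis .
qed

lemma set_noisy:
  assumes "z \<in> set_pmf (noisy (pmf_of_set {a, b}) r (edges_box n) 0)"
  shows "fst \<circ> z \<in> set_pmf (weight_pmf a b n)" "snd \<circ> z \<in> set_pmf (weight_pmf a b n)"
proof -
  let ?N = "noisy (pmf_of_set {a, b}) r (edges_box n) 0"
  have "weight_pmf a b n = map_pmf (\<lambda>z. fst \<circ> z) ?N" "weight_pmf a b n = map_pmf (\<lambda>z. snd \<circ> z) ?N"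
    by (simp_all only: weight_pmf_def map_fst_noisy[OF finite_edges_box] map_snd_noisy[OF finite_edges_box])
  then show "fst \<circ> z \<in> set_pmf (weight_pmf a b n)" "snd \<circ> z \<in> set_pmf (weight_pmf a b n)"
    using assms by (metis imageI set_map_pmf)+
qed

lemma tau_atom_bound:
  assumes "0 < a" "a < b" "1 \<le> k" "1 \<le> n" "real k \<le> real n powr (1/22)" "0 < c" "c \<le> 1"
    and c: "c \<le> pr (weight_pmf a b n) {\<omega>. \<not> tau n k \<omega> < q}"
  shows "pr (weight_pmf a b n) {\<omega>. tau n k \<omega> = q} \<le>
     n * ((9/10) powr (n powr (21/22) / 2) + 16 * - ln c * n powr (3/4 + 2/22 - 2)
       + 32 * n powr (2/22) * exp (- (n powr (5/11) / 8)))"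
proof -
  let ?W = "weight_pmf a b n" and ?M = "{0..int n - int k}"
  \<comment> \<open>The exponent 3/4 balances two demands for \<open>k <= n powr (1/22)\<close>. The
    deviation must dominate the standard deviation of the spin sum: \<open>s^2 / (n k)\<close> is at
    least \<open>n powr (5/11)\<close>. And the sum over the strips, of order
    \<open>s k^2 / n\<close>, must vanish: it is at most \<open>n powr (-7/44)\<close>.\<close>
  define s where "s = real n powr (3/4)"
  have n: "1 \<le> real n" "0 < real n" using assms by auto
  have "real n powr (1/22) \<le> real n powr 1" using n by (intro powr_mono) auto
  then have kn: "k \<le> n" using assms(5) n by simp
  have k0: "0 < real k" using assms by simp
  have C: "0 \<le> - ln c" using assms by simp
  have "pr ?W {\<omega>. tau n k \<omega> = q} \<le> pr ?W {\<omega>. (\<exists>m\<in>?M. \<omega> \<in> strip_le n k q m) \<and> (\<forall>m\<in>?M. \<omega> \<notin> strip_less n k q m)}"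
  proof (rule prob_mono_support)
    fix \<omega> assume w: "\<omega> \<in> set_pmf ?W" "\<omega> \<in> {\<omega>. tau n k \<omega> = q}"
    note iff = tau_iff[OF assms(1-3) kn w(1), of q]
    show "\<omega> \<in> {\<omega>. (\<exists>m\<in>?M. \<omega> \<in> strip_le n k q m) \<and> (\<forall>m\<in>?M. \<omega> \<notin> strip_less n k q m)}"
      using iff w(2) by auto
  qed
  also have "\<dots> \<le> real n * ((9/10) ^ (n div k) + 16 * s * - ln c * (real k)\<^sup>2 / (real n)\<^sup>2 + 32 * (real k)\<^sup>2 * exp (- s\<^sup>2 / (8 * real n * real k)))"
  proof (rule atom_prob_bound[OF assms(2,3) kn assms(6,7)])
    have "c \<le> pr ?W {\<omega>. \<not> tau n k \<omega> < q}" by fact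
    also have "\<dots> \<le> pr ?W {\<omega>. \<forall>m\<in>?M. \<omega> \<notin> strip_less n k q m}"
    proof (rule prob_mono_support)
      fix \<omega> assume w: "\<omega> \<in> set_pmf ?W" "\<omega> \<in> {\<omega>. \<not> tau n k \<omega> < q}"
      show "\<omega> \<in> {\<omega>. \<forall>m\<in>?M. \<omega> \<notin> strip_less n k q m}"
        using tau_iff(1)[OF assms(1-3) kn w(1), of q] w(2) by simp
    qed
    finally show "c \<le> pr ?W {\<omega>. \<forall>m\<in>?M. \<omega> \<notin> strip_less n k q m}" .
  qed (simp add: s_def)
  also have "\<dots> \<le> n * ((9/10) powr (n powr (21/22) / 2) + 16 * - ln c * n powr (3/4 + 2/22 - 2)
       + 32 * n powr (2/22) * exp (- (n powr (5/11) / 8)))"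
  proof (intro mult_left_mono add_mono)
    have "real n powr (21/22) / 2 = real n / (2 * real n powr (1/22))"
      using n powr_diff[of "real n" 1 "1/22"] by simp
    also have "\<dots> \<le> real n / (2 * real k)"
      using assms(5) k0 n by (intro divide_left_mono) auto
    also have "\<dots> \<le> real (n div k)" by (rule real_div_ge_half(1)[OF assms(3) kn])
    finally have "(9/10) powr real (n div k) \<le> (9/10 :: real) powr (real n powr (21/22) / 2)"
      by (intro powr_mono') auto
    then show "(9/10) ^ (n div k) \<le> (9/10 :: real) powr (n powr (21/22) / 2)"
      by (simp add: powr_realpow)
    have k2: "(real k)\<^sup>2 \<le> real n powr (2/22)"
    proof -
      have "(real k)\<^sup>2 \<le> (real n powr (1/22))\<^sup>2" using assms(5) by (intro power_mono) auto
      also have "\<dots> = real n powr (2/22)"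
        using n powr_add[of "real n" "1/22" "1/22"] by (simp add: power2_eq_square)
      finally show ?thesis by simp
    qed
    have "16 * s * - ln c * (real k)\<^sup>2 / (real n)\<^sup>2 = 16 * - ln c * (s * (real k)\<^sup>2 / (real n)\<^sup>2)" by simp
    also have "\<dots> \<le> 16 * - ln c * (s * real n powr (2/22) / (real n)\<^sup>2)"
      using k2 C by (intro mult_left_mono divide_right_mono) (auto simp: s_def)
    also have "s * real n powr (2/22) / (real n)\<^sup>2 = real n powr (3/4 + 2/22 - 2)"
      unfolding powr_diff powr_add s_def using n by simp
    finally show "16 * s * - ln c * (real k)\<^sup>2 / (real n)\<^sup>2 \<le> 16 * - ln c * n powr (3/4 + 2/22 - 2)" .
    have "n powr (5/11) / 8 = n powr (3/2) / (8 * n * n powr (1/22))"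
      using n powr_diff[of "real n" "3/2" "1 + 1/22"] powr_add[of "real n" 1 "1/22"] by (simp add: field_simps)
    also have "\<dots> \<le> n powr (3/2) / (8 * real n * real k)"
      using assms(5) k0 n by (intro divide_left_mono mult_left_mono) auto
    also have "n powr (3/2) = s\<^sup>2"
      unfolding s_def power2_eq_square powr_add[symmetric] by simp
    finally have "exp (- s\<^sup>2 / (8 * real n * real k)) \<le> exp (- (n powr (5/11) / 8))" by simp
    then show "32 * (real k)\<^sup>2 * exp (- s\<^sup>2 / (8 * real n * real k)) \<le> 32 * n powr (2/22) * exp (- (n powr (5/11) / 8))"
      using k2 by (intro mult_mono) auto
  qed simp
  finally show ?thesis .
qed

lemma tau_noise_bound:
  fixes a b q \<epsilon> c :: real and n k :: nat
  defines "f \<equiv> \<lambda>\<omega>. if tau n k \<omega> > q then 1 else 0 :: real"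
  assumes "0 < a" "a < b" "1 \<le> k" "1 \<le> n" "real k \<le> real n powr (1/22)" "0 < c" "c \<le> 1" "0 < \<epsilon>"
    and c: "c \<le> pr (weight_pmf a b n) {\<omega>. tau n k \<omega> > q}"
  shows "\<bar>expect (noisy_pair_pmf a b n \<epsilon>) (\<lambda>(\<omega>, \<eta>). f \<omega> * f \<eta>) - (expect (weight_pmf a b n) f)\<^sup>2\<bar>
    \<le> 4 * - ln c * (4 * - ln c * n powr (2/22 - 1)) powr (2 / (2 - min 1 \<epsilon>) - 1)"
proof -
  let ?W = "weight_pmf a b n" and ?M = "{0..int n - int k}"
  let ?N = "noisy (pmf_of_set {a, b}) (\<lambda>_. min 1 \<epsilon>) (edges_box n) 0"
  define F where "F = (\<lambda>\<omega>. of_bool (\<forall>m\<in>?M. \<omega> \<notin> strip_le n k q m) :: real)"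
  have n: "1 \<le> real n" "0 < real n" using assms by auto
  have "real n powr (1/22) \<le> real n powr 1" using n by (intro powr_mono) auto
  then have kn: "k \<le> n" using assms(6) n by simp
  have C: "0 \<le> - ln c" using assms by simp
  have fF: "f \<omega> = F \<omega>" if "\<omega> \<in> set_pmf ?W" for \<omega>
    using tau_iff(2)[OF assms(2-4) kn that, of q] by (auto simp: f_def F_def)
  have "expect (noisy_pair_pmf a b n \<epsilon>) (\<lambda>(\<omega>, \<eta>). f \<omega> * f \<eta>) = expect ?N (\<lambda>z. f (fst \<circ> z) * f (snd \<circ> z))"
    using assms by (intro noisy_pair_expectation) auto
  also have "\<dots> = expect ?N (\<lambda>z. F (fst \<circ> z) * F (snd \<circ> z))"
    by (intro expectation_cong_support) (simp add: fF set_noisy)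
  finally have e1: "expect (noisy_pair_pmf a b n \<epsilon>) (\<lambda>(\<omega>, \<eta>). f \<omega> * f \<eta>) = expect ?N (\<lambda>z. F (fst \<circ> z) * F (snd \<circ> z))" .
  have e2: "expect ?W f = expect ?W F" by (intro expectation_cong_support fF)
  have "\<bar>expect ?N (\<lambda>z. F (fst \<circ> z) * F (snd \<circ> z)) - (expect ?W F)\<^sup>2\<bar>
     \<le> 4 * - ln c * (4 * - ln c * (real k)\<^sup>2 / real n) powr (2 / (2 - min 1 \<epsilon>) - 1)"
    unfolding F_def
  proof (rule noise_covariance_strips[OF assms(3,4) kn assms(7,8)])
    have "c \<le> pr ?W {\<omega>. tau n k \<omega> > q}" by fact
    also have "\<dots> \<le> pr ?W {\<omega>. \<forall>m\<in>?M. \<omega> \<notin> strip_le n k q m}"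
    proof (rule prob_mono_support)
      fix \<omega> assume w: "\<omega> \<in> set_pmf ?W" "\<omega> \<in> {\<omega>. tau n k \<omega> > q}"
      show "\<omega> \<in> {\<omega>. \<forall>m\<in>?M. \<omega> \<notin> strip_le n k q m}"
        using tau_iff(2)[OF assms(2-4) kn w(1), of q] w(2) by auto
    qed
    finally show "c \<le> pr ?W {\<omega>. \<forall>m\<in>?M. \<omega> \<notin> strip_le n k q m}" .
  qed (use assms in auto)
  also have "\<dots> \<le> 4 * - ln c * (4 * - ln c * n powr (2/22 - 1)) powr (2 / (2 - min 1 \<epsilon>) - 1)"
  proof (intro mult_left_mono powr_mono2)
    have "(real k)\<^sup>2 \<le> (real n powr (1/22))\<^sup>2" using assms(6) by (intro power_mono) auto
    also have "\<dots> = real n powr (2/22)"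
      using n powr_add[of "real n" "1/22" "1/22"] by (simp add: power2_eq_square)
    finally have "(real k)\<^sup>2 / n \<le> n powr (2/22) / n" using n by (intro divide_right_mono) auto
    also have "\<dots> = n powr (2/22 - 1)" using n powr_diff[of "real n" "2/22" 1] by simp
    finally have "4 * - ln c * ((real k)\<^sup>2 / n) \<le> 4 * - ln c * n powr (2/22 - 1)"
      using C by (intro mult_left_mono) auto
    then show "4 * - ln c * (real k)\<^sup>2 / n \<le> 4 * - ln c * n powr (2/22 - 1)" by simp
  next
    show "0 \<le> 4 * - ln c * (real k)\<^sup>2 / real n"
      using C n by (intro divide_nonneg_nonneg mult_nonneg_nonneg) auto
  qed (use C assms in \<open>auto simp: field_simps min_def\<close>)
  finally show ?thesis unfolding e1 e2 .
qed

theorem theorem1p1: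
  fixes a b \<alpha> \<beta> :: real and k :: "nat \<Rightarrow> nat" and q :: "nat \<Rightarrow> real"
  assumes "0 < a" and "a < b" and "\<alpha> < 1/22" and "0 < \<beta>" and "\<beta> < 1"
    and "\<And>n. n \<ge> 1 \<Longrightarrow> 1 \<le> k n \<and> real (k n) \<le> real n powr \<alpha>"
    and "\<And>n. n \<ge> 1 \<Longrightarrow> is_quantile (weight_pmf a b n) (tau n (k n)) \<beta> (q n)"
  shows "((\<lambda>n. measure_pmf.prob (weight_pmf a b n) {\<omega>. tau n (k n) \<omega> < q n}) \<longlonglongrightarrow> \<beta>) \<and>
         ((\<lambda>n. measure_pmf.prob (weight_pmf a b n) {\<omega>. tau n (k n) \<omega> > q n}) \<longlonglongrightarrow> 1 - \<beta>) \<and>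
         noise_sensitive a b (\<lambda>n \<omega>. if tau n (k n) \<omega> > q n then 1 else 0)"
proof -
  let ?W = "weight_pmf a b"
  define lt where "lt = (\<lambda>n. pr (?W n) {\<omega>. tau n (k n) \<omega> < q n})"
  define gt where "gt = (\<lambda>n. pr (?W n) {\<omega>. tau n (k n) \<omega> > q n})"
  define atom where "atom = (\<lambda>n. pr (?W n) {\<omega>. tau n (k n) \<omega> = q n})"
  have k: "1 \<le> k n" "real (k n) \<le> real n powr (1/22)" if "1 \<le> n" for n
  proof -
    show "1 \<le> k n" using assms(6)[OF that] by simp
    have "real (k n) \<le> real n powr \<alpha>" using assms(6)[OF that] by simp
    also have "\<dots> \<le> real n powr (1/22)" using that assms(3) by (intro powr_mono) auto
    finally show "real (k n) \<le> real n powr (1/22)" .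
  qed
  have not_lt: "pr (?W n) {\<omega>. \<not> tau n (k n) \<omega> < q n} = 1 - lt n" for n
    using measure_pmf.prob_compl[of "{\<omega>. tau n (k n) \<omega> < q n}" "?W n"]
    by (simp add: lt_def Compl_eq_Diff_UNIV[symmetric] Collect_neg_eq)
  have le: "pr (?W n) {\<omega>. tau n (k n) \<omega> \<le> q n} = lt n + atom n" for n
  proof -
    have "{\<omega>. tau n (k n) \<omega> \<le> q n} = {\<omega>. tau n (k n) \<omega> < q n} \<union> {\<omega>. tau n (k n) \<omega> = q n}" by auto
    then show ?thesis
      unfolding lt_def atom_def by (simp only:) (intro measure_pmf.finite_measure_Union, auto)
  qed
  have gt: "gt n = 1 - (lt n + atom n)" for n
    using measure_pmf.prob_compl[of "{\<omega>. tau n (k n) \<omega> \<le> q n}" "?W n"]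
    by (simp add: gt_def le[symmetric] Compl_eq_Diff_UNIV[symmetric] Collect_neg_eq[symmetric] not_le)
  have quant: "lt n \<le> \<beta>" "\<beta> \<le> lt n + atom n" if "1 \<le> n" for n
    using assms(7)[OF that] le[of n] by (simp_all add: is_quantile_def lt_def)
  have atom0: "atom \<longlonglongrightarrow> 0"
  proof (rule tendsto_sandwich)
    show "\<forall>\<^sub>F n in sequentially. 0 \<le> atom n" by (simp add: atom_def)
    \<comment> \<open>The quantile property gives \<open>P(\<tau> >= q) >= 1 - \<beta>\<close> for
      every \<open>n >= 1\<close>, so \<open>c = 1 - \<beta>\<close> is admissible here.\<close>
    show "\<forall>\<^sub>F n in sequentially. atom n \<le> n * ((9/10) powr (n powr (21/22) / 2)
       + 16 * - ln (1 - \<beta>) * n powr (3/4 + 2/22 - 2) + 32 * n powr (2/22) * exp (- (n powr (5/11) / 8)))"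
    proof (rule eventually_sequentiallyI[of 1])
      fix n :: nat assume n: "1 \<le> n"
      show "atom n \<le> n * ((9/10) powr (n powr (21/22) / 2)
       + 16 * - ln (1 - \<beta>) * n powr (3/4 + 2/22 - 2) + 32 * n powr (2/22) * exp (- (n powr (5/11) / 8)))"
        unfolding atom_def
        by (rule tau_atom_bound[OF assms(1,2) k(1)[OF n] n k(2)[OF n]])
          (use assms(4,5) quant[OF n] in \<open>auto simp: not_lt simp del: not_less\<close>)
    qed
    show "(\<lambda>n. n * ((9/10) powr (n powr (21/22) / 2)
       + 16 * - ln (1 - \<beta>) * n powr (3/4 + 2/22 - 2) + 32 * n powr (2/22) * exp (- (n powr (5/11) / 8)))) \<longlonglongrightarrow> 0"
      by real_asymp
  qed simp
  have lt_lim: "lt \<longlonglongrightarrow> \<beta>"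
  proof (rule tendsto_sandwich)
    show "\<forall>\<^sub>F n in sequentially. \<beta> - atom n \<le> lt n" "\<forall>\<^sub>F n in sequentially. lt n \<le> \<beta>"
      using quant by (auto intro!: eventually_sequentiallyI[of 1] simp: algebra_simps)
    show "(\<lambda>n. \<beta> - atom n) \<longlonglongrightarrow> \<beta>" using tendsto_diff[OF tendsto_const atom0, of \<beta>] by simp
  qed simp
  have gt_lim: "gt \<longlonglongrightarrow> 1 - \<beta>"
    unfolding gt using tendsto_diff[OF tendsto_const tendsto_add[OF lt_lim atom0], of 1] by simp
  \<comment> \<open>The probability of \<open>\<tau> > q\<close> is only known to tend to
    \<open>1 - \<beta>\<close>; half of the limit is a lower bound for all large
    \<open>n\<close>.\<close>
  define c where "c = (1 - \<beta>) / 2"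
  have c: "0 < c" "c < 1" using assms by (auto simp: c_def)
  have ev: "\<forall>\<^sub>F n in sequentially. c < gt n"
    using gt_lim by (rule order_tendstoD) (use assms in \<open>auto simp: c_def\<close>)
  have "noise_sensitive a b (\<lambda>n \<omega>. if tau n (k n) \<omega> > q n then 1 else 0)"
    unfolding noise_sensitive_def
  proof (intro allI impI)
    fix \<epsilon> :: real assume eps: "0 < \<epsilon>"
    define C where "C = 4 * - ln c"
    define t where "t = 2 / (2 - min 1 \<epsilon>) - 1"
    have C: "0 < C" using c by (simp add: C_def)
    have t: "0 < t" using eps by (auto simp: t_def min_def field_simps)
    show "(\<lambda>n. expect (noisy_pair_pmf a b n \<epsilon>) (\<lambda>(\<omega>, \<eta>). (if tau n (k n) \<omega> > q n then 1 else 0) * (if tau n (k n) \<eta> > q n then 1 else 0))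
        - (expect (weight_pmf a b n) (\<lambda>\<omega>. if tau n (k n) \<omega> > q n then 1 else 0))\<^sup>2) \<longlonglongrightarrow> 0"
    proof (rule Lim_null_comparison)
      show "\<forall>\<^sub>F n in sequentially. norm (expect (noisy_pair_pmf a b n \<epsilon>) (\<lambda>(\<omega>, \<eta>). (if tau n (k n) \<omega> > q n then 1 else 0) * (if tau n (k n) \<eta> > q n then 1 else 0))
        - (expect (weight_pmf a b n) (\<lambda>\<omega>. if tau n (k n) \<omega> > q n then 1 else 0))\<^sup>2) \<le> C * (C * n powr (2/22 - 1)) powr t"
        using ev eventually_ge_at_top[of 1]
      proof eventually_elim
        case (elim n)
        show ?case
          unfolding C_def t_def real_norm_def
          by (rule tau_noise_bound[OF assms(1,2) k(1) _ k(2)])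
            (use elim c eps in \<open>auto simp: gt_def\<close>)
      qed
      have "(\<lambda>n. C * n powr (2/22 - 1)) \<longlonglongrightarrow> 0" by real_asymp
      then have "(\<lambda>n. (C * n powr (2/22 - 1)) powr t) \<longlonglongrightarrow> 0 powr t"
        using C t by (intro tendsto_powr2) auto
      then show "(\<lambda>n. C * (C * n powr (2/22 - 1)) powr t) \<longlonglongrightarrow> 0"
        using t by (intro tendsto_mult_right_zero) simp
    qed
  qed
  then show ?thesis using lt_lim gt_lim by (simp add: lt_def[abs_def] gt_def[abs_def])
qed

end
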